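(* Let $X$ be a locally wep-connected space. Then the functor $\pi^{\tau}_{!}\colon\mathbf{SCov}(X)\to\mathbf{OCovMor}(\pi^{\tau}X)$, $p\mapsto \pi^{\tau}p$, is a natural equivalence of categories.
   Context: Conventions: "map" means continuous function; $I=[0,1]$; mapping spaces carry the compact-open topology. $\mathcal{P}X$ is the space of paths $I\to X$; $(\mathcal{P}X)_x$ is the subspace of paths starting at $x$; $\mathcal{P}X(x_1,x_2)$ is the subspace of paths from $x_1$ to $x_2$. Semicoverings. Let $\Delta_2=\{(s,t)\in I^2: s+t\le 1\}$, $e_1=\{(0,t): t\in I\}$, and let $(\Phi X)_x$ be the space of maps $\phi\colon\Delta_2\to X$ with $\phi(e_1)=\{x\}$. A map $p\colon Y\to X$ has continuous lifting of paths (resp. homotopies) if for each $y\in Y$ the map $(\mathcal{P}Y)_y\to(\mathcal{P}X)_{p(y)}$, $\alpha\mapsto p\circ\alpha$ (resp. $(\Phi Y)_y\to(\Phi X)_{p(y)}$, $\phi\mapsto p\circ\phi$) is a homeomorphism. A semicovering map is a local homeomorphism with continuous lifting of paths and homotopies (the empty map $\emptyset\to X$ is allowed). $\mathbf{SCov}(X)$ is the category of semicoverings of $X$; a morphism from $p\colon Y\to X$ to $p'\colon Y'\to X$ is a map $f\colon Y\to Y'$ with $p'\circ f=p$. The fundamental $\mathbf{Top}$-groupoid. A $\mathbf{Top}$-groupoid is a small groupoid whose hom-sets are topologized so that all composition maps and inversion maps are continuous; a $\mathbf{Top}$-functor is a functor continuous on each hom-space; it is open if it is also an open map on each hom-space.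 A quasitopological group is a group with a topology such that inversion and all translations are continuous. For a quasitopological group $G$, $\tau(G)$ is the topological group with underlying group $G$ and the quotient topology with respect to the homomorphism $F_M(G)\to G$ induced by the identity of $G$, where $F_M(G)$ is the free (Markov) topological group on the underlying space of $G$. Let $\pi X$ be the fundamental groupoid (composition written in the order of concatenation). $\pi^{qtop}X$ is $\pi X$ with each hom-set $\pi X(x_1,x_2)$ given the quotient topology from $\mathcal{P}X(x_1,x_2)$. $\pi^{\tau}X$ is the $\mathbf{Top}$-groupoid with underlying groupoid $\pi X$, vertex groups $\pi^\tau X(x,x)=\tau(\pi^{qtop}X(x,x))$ and, for $x_1\neq x_2$, $\pi^{\tau}X(x_1,x_2)$ having the topology generated by the sets $Ug=\{ug: u\in U\}$, $g\in\pi X(x_1,x_2)$, $U$ open in $\pi^\tau X(x_1,x_1)$. A map $p\colon Y\to X$ induces the $\mathbf{Top}$-functor $\pi^\tau p\colon\pi^\tau Y\to\pi^\tau X$, $[\alpha]\mapsto[p\circ\alpha]$; when $p$ is a semicovering, $\pi^\tau p$ is an open covering morphism. Open covering morphisms. A covering morphism of groupoids is a functor $F\colon\mathcal{H}\to\mathcal{G}$ such that for each object $y$ of $\mathcal{H}$ the function $\{h\in\mathcal{H}: \mathrm{source}(h)=y\}\to\{g\in\mathcal{G}:\mathrm{source}(g)=F(y)\}$, $h\mapsto F(h)$, is a bijection. For a $\mathbf{Top}$-groupoid $\mathcal{G}$, $\mathbf{OCovMor}(\mathcal{G})$ is the category whose objects are the open $\mathbf{Top}$-functors $\mathcal{H}\to\mathcal{G}$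 ($\mathcal{H}$ a $\mathbf{Top}$-groupoid) whose underlying functors are covering morphisms, and whose morphisms are $\mathbf{Top}$-functors commuting with the functors to $\mathcal{G}$. Locally wep-connected spaces. A path $\alpha\colon I\to X$ is well-ended if for every open neighborhood $U$ of $\alpha$ in $\mathcal{P}X$ there are open neighborhoods $V_0,V_1$ of $\alpha(0),\alpha(1)$ in $X$ such that for every $a\in V_0$, $b\in V_1$ there is a path $\beta\in U$ with $\beta(0)=a$, $\beta(1)=b$. It is locally well-ended if the same holds with $\beta$ required in addition to be well-ended. $X$ is locally wep-connected if every pair of points of $X$ can be connected by a locally well-ended path. *)

theory Defs
  imports "HOL-Analysis.Analysis" "HOL-Algebra.Group"
begin

section \<open>Topologies on mapping spaces and quotients\<close>

text \<open>Maps out of a space \<open>K\<close> are represented by functions that are \<open>undefined\<close> off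
  \<open>topspace K\<close> (\<^const>\<open>extensional\<close>), so that equal maps are equal functions. The subbasic sets
  with \<open>C = {}\<close> make the whole set of maps open.\<close>

definition maps :: "'k topology \<Rightarrow> 'a topology \<Rightarrow> ('k \<Rightarrow> 'a) set" where
  "maps K X = {f \<in> extensional (topspace K). continuous_map K X f}"

definition compact_open_topology :: "'k topology \<Rightarrow> 'a topology \<Rightarrow> ('k \<Rightarrow> 'a) topology" where
  "compact_open_topology K X =
     topology_generated_by {{f \<in> maps K X. f ` C \<subseteq> U} | C U. compactin K C \<and> openin X U}"

definition quotient_topology :: "'a topology \<Rightarrow> ('a \<Rightarrow> 'b) \<Rightarrow> 'b topology" where
  "quotient_topology X f =
     topology (\<lambda>U. U \<subseteq> f ` topspace X \<and> openin X {x \<in> topspace X. f x \<in> U})"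

lemma openin_quotient_topology:
  "openin (quotient_topology X f) U \<longleftrightarrow>
     U \<subseteq> f ` topspace X \<and> openin X {x \<in> topspace X. f x \<in> U}"
proof -
  have "istopology (\<lambda>U. U \<subseteq> f ` topspace X \<and> openin X {x \<in> topspace X. f x \<in> U})"
    unfolding istopology_def
  proof (intro conjI allI impI)
    fix S T
    assume S: "S \<subseteq> f ` topspace X \<and> openin X {x \<in> topspace X. f x \<in> S}"
      and T: "T \<subseteq> f ` topspace X \<and> openin X {x \<in> topspace X. f x \<in> T}"
    have "{x \<in> topspace X. f x \<in> S \<inter> T} =
        {x \<in> topspace X. f x \<in> S} \<inter> {x \<in> topspace X. f x \<in> T}" by auto
    then show "openin X {x \<in> topspace X. f x \<in> S \<inter> T}" using S T by (simp add: openin_Int)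
    show "S \<inter> T \<subseteq> f ` topspace X" using S by blast
  next
    fix K
    assume K: "\<forall>S\<in>K. S \<subseteq> f ` topspace X \<and> openin X {x \<in> topspace X. f x \<in> S}"
    have "{x \<in> topspace X. f x \<in> \<Union>K} = (\<Union>S\<in>K. {x \<in> topspace X. f x \<in> S})" by auto
    then show "openin X {x \<in> topspace X. f x \<in> \<Union>K}" using K by auto
    show "\<Union>K \<subseteq> f ` topspace X" using K by blast
  qed
  then show ?thesis by (simp add: quotient_topology_def topology_inverse')
qed

lemma quotient_map_quotient_topology: "quotient_map X (quotient_topology X f) f"
proof -
  have "topspace (quotient_topology X f) = f ` topspace X"
  proof
    show "topspace (quotient_topology X f) \<subseteq> f ` topspace X"
      using openin_quotient_topology[of X f "topspace (quotient_topology X f)"] by simp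
    have "{x \<in> topspace X. f x \<in> f ` topspace X} = topspace X" by auto
    then have "openin (quotient_topology X f) (f ` topspace X)"
      by (simp add: openin_quotient_topology)
    then show "f ` topspace X \<subseteq> topspace (quotient_topology X f)"
      by (rule openin_subset)
  qed
  then show ?thesis by (simp add: quotient_map_def openin_quotient_topology)
qed


section \<open>Paths\<close>

abbreviation unit_interval :: "real topology" where
  "unit_interval \<equiv> top_of_set {0..1}"

definition path_space :: "'a topology \<Rightarrow> (real \<Rightarrow> 'a) topology" where
  "path_space X = compact_open_topology unit_interval X"

definition path_space_from :: "'a topology \<Rightarrow> 'a \<Rightarrow> (real \<Rightarrow> 'a) topology" where
  "path_space_from X x = subtopology (path_space X) {\<alpha>. \<alpha> 0 = x}"

definition path_space_between :: "'a topology \<Rightarrow> 'a \<Rightarrow> 'a \<Rightarrow> (real \<Rightarrow> 'a) topology" where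
  "path_space_between X x\<^sub>1 x\<^sub>2 = subtopology (path_space X) {\<alpha>. \<alpha> 0 = x\<^sub>1 \<and> \<alpha> 1 = x\<^sub>2}"

definition well_ended :: "'a topology \<Rightarrow> (real \<Rightarrow> 'a) \<Rightarrow> bool" where
  "well_ended X \<alpha> \<longleftrightarrow> \<alpha> \<in> topspace (path_space X) \<and>
     (\<forall>U. openin (path_space X) U \<and> \<alpha> \<in> U \<longrightarrow>
       (\<exists>V\<^sub>0 V\<^sub>1. openin X V\<^sub>0 \<and> \<alpha> 0 \<in> V\<^sub>0 \<and> openin X V\<^sub>1 \<and> \<alpha> 1 \<in> V\<^sub>1 \<and>
         (\<forall>a\<in>V\<^sub>0. \<forall>b\<in>V\<^sub>1. \<exists>\<beta>\<in>U. \<beta> 0 = a \<and> \<beta> 1 = b)))"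

definition locally_well_ended :: "'a topology \<Rightarrow> (real \<Rightarrow> 'a) \<Rightarrow> bool" where
  "locally_well_ended X \<alpha> \<longleftrightarrow> \<alpha> \<in> topspace (path_space X) \<and>
     (\<forall>U. openin (path_space X) U \<and> \<alpha> \<in> U \<longrightarrow>
       (\<exists>V\<^sub>0 V\<^sub>1. openin X V\<^sub>0 \<and> \<alpha> 0 \<in> V\<^sub>0 \<and> openin X V\<^sub>1 \<and> \<alpha> 1 \<in> V\<^sub>1 \<and>
         (\<forall>a\<in>V\<^sub>0. \<forall>b\<in>V\<^sub>1. \<exists>\<beta>\<in>U. well_ended X \<beta> \<and> \<beta> 0 = a \<and> \<beta> 1 = b)))"

definition locally_wep_connected :: "'a topology \<Rightarrow> bool" where
  "locally_wep_connected X \<longleftrightarrow>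
     (\<forall>x\<in>topspace X. \<forall>y\<in>topspace X. \<exists>\<alpha>. locally_well_ended X \<alpha> \<and> \<alpha> 0 = x \<and> \<alpha> 1 = y)"


section \<open>Semicovering maps\<close>

definition triangle :: "(real \<times> real) set" where
  "triangle = {(s, t). s \<in> {0..1} \<and> t \<in> {0..1} \<and> s + t \<le> 1}"

definition homotopy_space_from :: "'a topology \<Rightarrow> 'a \<Rightarrow> (real \<times> real \<Rightarrow> 'a) topology" where
  "homotopy_space_from X x =
     subtopology (compact_open_topology (top_of_set triangle) X)
       {\<phi>. \<phi> ` {(0, t) | t. t \<in> {0..1}} = {x}}"

definition local_homeomorphism :: "'b topology \<Rightarrow> 'a topology \<Rightarrow> ('b \<Rightarrow> 'a) \<Rightarrow> bool" where
  "local_homeomorphism Y X p \<longleftrightarrow> continuous_map Y X p \<and>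
     (\<forall>y\<in>topspace Y. \<exists>V. openin Y V \<and> y \<in> V \<and> openin X (p ` V) \<and>
        homeomorphic_map (subtopology Y V) (subtopology X (p ` V)) p)"

definition continuous_lifting_of_paths ::
    "'b topology \<Rightarrow> 'a topology \<Rightarrow> ('b \<Rightarrow> 'a) \<Rightarrow> bool" where
  "continuous_lifting_of_paths Y X p \<longleftrightarrow>
     (\<forall>y\<in>topspace Y. homeomorphic_map (path_space_from Y y) (path_space_from X (p y))
        (\<lambda>\<alpha>. compose {0..1} p \<alpha>))"

definition continuous_lifting_of_homotopies ::
    "'b topology \<Rightarrow> 'a topology \<Rightarrow> ('b \<Rightarrow> 'a) \<Rightarrow> bool" where
  "continuous_lifting_of_homotopies Y X p \<longleftrightarrow>
     (\<forall>y\<in>topspace Y. homeomorphic_map (homotopy_space_from Y y) (homotopy_space_from X (p y))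
        (\<lambda>\<phi>. compose triangle p \<phi>))"

definition semicovering_map :: "'b topology \<Rightarrow> 'a topology \<Rightarrow> ('b \<Rightarrow> 'a) \<Rightarrow> bool" where
  "semicovering_map Y X p \<longleftrightarrow> local_homeomorphism Y X p \<and>
     continuous_lifting_of_paths Y X p \<and> continuous_lifting_of_homotopies Y X p"


section \<open>Categories\<close>

text \<open>Composition is written in diagrammatic order: \<open>Comp C f g\<close> is ``first \<open>f\<close>, then \<open>g\<close>''
  and is meaningful when \<open>Cod C f = Dom C g\<close>.\<close>

record ('o, 'm) cat =
  Obj :: "'o set"
  Arr :: "'m set"
  Dom :: "'m \<Rightarrow> 'o"
  Cod :: "'m \<Rightarrow> 'o"
  Ident :: "'o \<Rightarrow> 'm"
  Comp :: "'m \<Rightarrow> 'm \<Rightarrow> 'm"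

definition homset :: "('o, 'm, 'z) cat_scheme \<Rightarrow> 'o \<Rightarrow> 'o \<Rightarrow> 'm set" where
  "homset C x y = {f \<in> Arr C. Dom C f = x \<and> Cod C f = y}"

definition category :: "('o, 'm, 'z) cat_scheme \<Rightarrow> bool" where
  "category C \<longleftrightarrow>
     (\<forall>f\<in>Arr C. Dom C f \<in> Obj C \<and> Cod C f \<in> Obj C) \<and>
     (\<forall>x\<in>Obj C. Ident C x \<in> homset C x x) \<and>
     (\<forall>f\<in>Arr C. \<forall>g\<in>Arr C. Cod C f = Dom C g \<longrightarrow> Comp C f g \<in> homset C (Dom C f) (Cod C g)) \<and>
     (\<forall>f\<in>Arr C. Comp C (Ident C (Dom C f)) f = f \<and> Comp C f (Ident C (Cod C f)) = f) \<and>
     (\<forall>f\<in>Arr C. \<forall>g\<in>Arr C. \<forall>h\<in>Arr C. Cod C f = Dom C g \<and> Cod C g = Dom C h \<longrightarrow>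
        Comp C (Comp C f g) h = Comp C f (Comp C g h))"

definition inverse_arrows :: "('o, 'm, 'z) cat_scheme \<Rightarrow> 'm \<Rightarrow> 'm \<Rightarrow> bool" where
  "inverse_arrows C f g \<longleftrightarrow> f \<in> Arr C \<and> g \<in> homset C (Cod C f) (Dom C f) \<and>
     Comp C f g = Ident C (Dom C f) \<and> Comp C g f = Ident C (Cod C f)"

definition isomorphism :: "('o, 'm, 'z) cat_scheme \<Rightarrow> 'm \<Rightarrow> bool" where
  "isomorphism C f \<longleftrightarrow> (\<exists>g. inverse_arrows C f g)"

definition is_functor ::
    "('o, 'm, 'z) cat_scheme \<Rightarrow> ('p, 'n, 'w) cat_scheme \<Rightarrow> ('o \<Rightarrow> 'p) \<Rightarrow> ('m \<Rightarrow> 'n) \<Rightarrow> bool" where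
  "is_functor C D Fo Fa \<longleftrightarrow> category C \<and> category D \<and>
     (\<forall>x\<in>Obj C. Fo x \<in> Obj D) \<and>
     (\<forall>f\<in>Arr C. Fa f \<in> homset D (Fo (Dom C f)) (Fo (Cod C f))) \<and>
     (\<forall>x\<in>Obj C. Fa (Ident C x) = Ident D (Fo x)) \<and>
     (\<forall>f\<in>Arr C. \<forall>g\<in>Arr C. Cod C f = Dom C g \<longrightarrow> Fa (Comp C f g) = Comp D (Fa f) (Fa g))"

definition natural_isomorphism ::
    "('o, 'm, 'z) cat_scheme \<Rightarrow> ('p, 'n, 'w) cat_scheme \<Rightarrow> ('o \<Rightarrow> 'p) \<Rightarrow> ('m \<Rightarrow> 'n) \<Rightarrow>
     ('o \<Rightarrow> 'p) \<Rightarrow> ('m \<Rightarrow> 'n) \<Rightarrow> ('o \<Rightarrow> 'n) \<Rightarrow> bool" where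
  "natural_isomorphism C D Fo Fa Go Ga \<eta> \<longleftrightarrow>
     is_functor C D Fo Fa \<and> is_functor C D Go Ga \<and>
     (\<forall>x\<in>Obj C. \<eta> x \<in> homset D (Fo x) (Go x) \<and> isomorphism D (\<eta> x)) \<and>
     (\<forall>f\<in>Arr C. Comp D (Fa f) (\<eta> (Cod C f)) = Comp D (\<eta> (Dom C f)) (Ga f))"

definition equivalence_of_categories ::
    "('o, 'm, 'z) cat_scheme \<Rightarrow> ('p, 'n, 'w) cat_scheme \<Rightarrow> ('o \<Rightarrow> 'p) \<Rightarrow> ('m \<Rightarrow> 'n) \<Rightarrow> bool" where
  "equivalence_of_categories C D Fo Fa \<longleftrightarrow> is_functor C D Fo Fa \<and>
     (\<exists>Go Ga. is_functor D C Go Ga \<and>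
        (\<exists>\<eta>. natural_isomorphism C C (\<lambda>x. x) (\<lambda>f. f) (\<lambda>x. Go (Fo x)) (\<lambda>f. Ga (Fa f)) \<eta>) \<and>
        (\<exists>\<epsilon>. natural_isomorphism D D (\<lambda>x. Fo (Go x)) (\<lambda>f. Fa (Ga f)) (\<lambda>x. x) (\<lambda>f. f) \<epsilon>))"


section \<open>Topological groupoids and open covering morphisms\<close>

definition groupoid :: "('o, 'm, 'z) cat_scheme \<Rightarrow> bool" where
  "groupoid H \<longleftrightarrow> category H \<and> (\<forall>g\<in>Arr H. isomorphism H g)"

definition inverse_arrow :: "('o, 'm, 'z) cat_scheme \<Rightarrow> 'm \<Rightarrow> 'm" where
  "inverse_arrow H g = (THE h. inverse_arrows H g h)"

record ('o, 'm) topcat = "('o, 'm) cat" +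
  hom_top :: "'o \<Rightarrow> 'o \<Rightarrow> 'm topology"

definition top_groupoid :: "('o, 'm, 'z) topcat_scheme \<Rightarrow> bool" where
  "top_groupoid H \<longleftrightarrow> groupoid H \<and>
     (\<forall>x\<in>Obj H. \<forall>y\<in>Obj H. topspace (hom_top H x y) = homset H x y) \<and>
     (\<forall>x\<in>Obj H. \<forall>y\<in>Obj H. \<forall>z\<in>Obj H.
        continuous_map (prod_topology (hom_top H x y) (hom_top H y z)) (hom_top H x z)
          (\<lambda>(g, h). Comp H g h)) \<and>
     (\<forall>x\<in>Obj H. \<forall>y\<in>Obj H. continuous_map (hom_top H x y) (hom_top H y x) (inverse_arrow H))"

definition top_functor ::
    "('o, 'm, 'z) topcat_scheme \<Rightarrow> ('p, 'n, 'w) topcat_scheme \<Rightarrow>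
     ('o \<Rightarrow> 'p) \<Rightarrow> ('m \<Rightarrow> 'n) \<Rightarrow> bool" where
  "top_functor H G Fo Fa \<longleftrightarrow> is_functor H G Fo Fa \<and>
     (\<forall>x\<in>Obj H. \<forall>y\<in>Obj H. continuous_map (hom_top H x y) (hom_top G (Fo x) (Fo y)) Fa)"

definition open_top_functor ::
    "('o, 'm, 'z) topcat_scheme \<Rightarrow> ('p, 'n, 'w) topcat_scheme \<Rightarrow>
     ('o \<Rightarrow> 'p) \<Rightarrow> ('m \<Rightarrow> 'n) \<Rightarrow> bool" where
  "open_top_functor H G Fo Fa \<longleftrightarrow> top_functor H G Fo Fa \<and>
     (\<forall>x\<in>Obj H. \<forall>y\<in>Obj H. open_map (hom_top H x y) (hom_top G (Fo x) (Fo y)) Fa)"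

definition covering_morphism ::
    "('o, 'm, 'z) cat_scheme \<Rightarrow> ('p, 'n, 'w) cat_scheme \<Rightarrow> ('o \<Rightarrow> 'p) \<Rightarrow> ('m \<Rightarrow> 'n) \<Rightarrow> bool" where
  "covering_morphism H G Fo Fa \<longleftrightarrow> groupoid H \<and> groupoid G \<and> is_functor H G Fo Fa \<and>
     (\<forall>y\<in>Obj H. bij_betw Fa {h \<in> Arr H. Dom H h = y} {g \<in> Arr G. Dom G g = Fo y})"

type_synonym ('o, 'm, 'p, 'n) groupoid_over = "('o, 'm) topcat \<times> ('o \<Rightarrow> 'p) \<times> ('m \<Rightarrow> 'n)"

definition open_covering_morphisms ::
    "('p, 'n) topcat \<Rightarrow> ('o, 'm, 'p, 'n) groupoid_over set" where
  "open_covering_morphisms G = {(H, Fo, Fa). top_groupoid H \<and>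
     open_top_functor H G Fo Fa \<and> covering_morphism H G Fo Fa \<and>
     Fo \<in> extensional (Obj H) \<and> Fa \<in> extensional (Arr H)}"

text \<open>HOL has no type of all small groupoids, so \<open>OCovMor\<close> is formed over fixed types of objects
  and arrows. The source and target of a morphism over the base may nevertheless have different
  types, so that groupoids whose arrows are not path classes can be compared with \<open>pi_tau Y\<close>.\<close>

definition over_morphism ::
    "('o, 'm, 'p, 'n) groupoid_over \<Rightarrow> ('o', 'm', 'p, 'n) groupoid_over \<Rightarrow>
     ('o \<Rightarrow> 'o') \<times> ('m \<Rightarrow> 'm') \<Rightarrow> bool" where
  "over_morphism = (\<lambda>(H, Fo, Fa) (H', Fo', Fa') (Ko, Ka). top_functor H H' Ko Ka \<and>
     Ko \<in> extensional (Obj H) \<and> Ka \<in> extensional (Arr H) \<and>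
     (\<forall>x\<in>Obj H. Fo' (Ko x) = Fo x) \<and> (\<forall>h\<in>Arr H. Fa' (Ka h) = Fa h))"

definition OCovMor :: "('p, 'n) topcat \<Rightarrow>
    (('o, 'm, 'p, 'n) groupoid_over,
     ('o, 'm, 'p, 'n) groupoid_over \<times> ('o, 'm, 'p, 'n) groupoid_over \<times>
       (('o \<Rightarrow> 'o) \<times> ('m \<Rightarrow> 'm))) cat" where
  "OCovMor G = \<lparr>
     Obj = open_covering_morphisms G,
     Arr = {(A, B, K). A \<in> open_covering_morphisms G \<and> B \<in> open_covering_morphisms G \<and>
                       over_morphism A B K},
     Dom = (\<lambda>(A, B, K). A),
     Cod = (\<lambda>(A, B, K). B),
     Ident = (\<lambda>A. (A, A, restrict (\<lambda>x. x) (Obj (fst A)), restrict (\<lambda>h. h) (Arr (fst A)))),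
     Comp = (\<lambda>(A, B, Ko, Ka) (B', C, Lo, La).
               (A, C, compose (Obj (fst A)) Lo Ko, compose (Arr (fst A)) La Ka))\<rparr>"

definition isomorphic_over ::
    "('o, 'm, 'p, 'n) groupoid_over \<Rightarrow> ('o', 'm', 'p, 'n) groupoid_over \<Rightarrow> bool" where
  "isomorphic_over A B \<longleftrightarrow> (\<exists>Ko Ka Lo La.
     over_morphism A B (Ko, Ka) \<and> over_morphism B A (Lo, La) \<and>
     (\<forall>x\<in>Obj (fst A). Lo (Ko x) = x) \<and> (\<forall>h\<in>Arr (fst A). La (Ka h) = h) \<and>
     (\<forall>y\<in>Obj (fst B). Ko (Lo y) = y) \<and> (\<forall>k\<in>Arr (fst B). Ka (La k) = k))"


section \<open>The category of semicoverings\<close>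

definition semicoverings :: "'a topology \<Rightarrow> ('b topology \<times> ('b \<Rightarrow> 'a)) set" where
  "semicoverings X = {(Y, p). semicovering_map Y X p \<and> p \<in> extensional (topspace Y)}"

definition SCov :: "'a topology \<Rightarrow>
    ('b topology \<times> ('b \<Rightarrow> 'a),
     ('b topology \<times> ('b \<Rightarrow> 'a)) \<times> ('b topology \<times> ('b \<Rightarrow> 'a)) \<times> ('b \<Rightarrow> 'b)) cat" where
  "SCov X = \<lparr>
     Obj = semicoverings X,
     Arr = {(A, B, f). A \<in> semicoverings X \<and> B \<in> semicoverings X \<and> f \<in> maps (fst A) (fst B) \<and>
                       (\<forall>y\<in>topspace (fst A). snd B (f y) = snd A y)},
     Dom = (\<lambda>(A, B, f). A),
     Cod = (\<lambda>(A, B, f). B),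
     Ident = (\<lambda>A. (A, A, restrict (\<lambda>y. y) (topspace (fst A)))),
     Comp = (\<lambda>(A, B, f) (B', C, g). (A, C, compose (topspace (fst A)) g f))\<rparr>"


section \<open>The free topological group and the group reflection\<close>

text \<open>Reduced words: \<open>(True, x)\<close> stands for the letter \<open>x\<close> and \<open>(False, x)\<close> for its formal
  inverse.\<close>

definition flip_letter :: "bool \<times> 'x \<Rightarrow> bool \<times> 'x" where
  "flip_letter l = (\<not> fst l, snd l)"

fun push_letter :: "bool \<times> 'x \<Rightarrow> (bool \<times> 'x) list \<Rightarrow> (bool \<times> 'x) list" where
  "push_letter l [] = [l]"
| "push_letter l (k # w) = (if k = flip_letter l then w else l # k # w)"

fun reduced_word :: "(bool \<times> 'x) list \<Rightarrow> bool" where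
  "reduced_word [] = True"
| "reduced_word [l] = True"
| "reduced_word (l # k # w) = (k \<noteq> flip_letter l \<and> reduced_word (k # w))"

definition free_group :: "'x set \<Rightarrow> (bool \<times> 'x) list monoid" where
  "free_group S = \<lparr>carrier = {w. reduced_word w \<and> snd ` set w \<subseteq> S},
                   mult = (\<lambda>u v. foldr push_letter u v),
                   one = []\<rparr>"

definition free_generator :: "'x \<Rightarrow> (bool \<times> 'x) list" where
  "free_generator x = [(True, x)]"

definition free_group_extension :: "('g, 'z) monoid_scheme \<Rightarrow> ('x \<Rightarrow> 'g) \<Rightarrow> (bool \<times> 'x) list \<Rightarrow> 'g" where
  "free_group_extension G f w =
     foldr (\<lambda>(b, x) g. (if b then f x else inv\<^bsub>G\<^esub> (f x)) \<otimes>\<^bsub>G\<^esub> g) w \<one>\<^bsub>G\<^esub>"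

definition topological_group :: "('g, 'z) monoid_scheme \<Rightarrow> 'g topology \<Rightarrow> bool" where
  "topological_group G T \<longleftrightarrow> group G \<and> topspace T = carrier G \<and>
     continuous_map (prod_topology T T) T (\<lambda>(g, h). g \<otimes>\<^bsub>G\<^esub> h) \<and>
     continuous_map T T (\<lambda>g. inv\<^bsub>G\<^esub> g)"

text \<open>The Markov topology: the supremum of all group topologies on the free group for which the
  insertion of generators is continuous. The lemmas below show that it is itself such a topology
  and that the homomorphic extension of a continuous map into a topological group is continuous,
  i.e. that it is the topology of the free (Markov) topological group on \<open>T\<close>.\<close>

definition markov_topology :: "'x topology \<Rightarrow> (bool \<times> 'x) list topology" where
  "markov_topology T = topology_generated_by
     {U. \<exists>S. topological_group (free_group (topspace T)) S \<and>
             continuous_map T S free_generator \<and> openin S U}"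

text \<open>The topology of \<open>\<tau>(G)\<close>, where \<open>T\<close> is the topology of the quasitopological group \<open>G\<close>.\<close>

definition tau_topology :: "('g, 'z) monoid_scheme \<Rightarrow> 'g topology \<Rightarrow> 'g topology" where
  "tau_topology G T = quotient_topology (markov_topology T) (free_group_extension G (\<lambda>g. g))"

lemma flip_flip [simp]: "flip_letter (flip_letter l) = l"
  by (simp add: flip_letter_def)

lemma snd_flip_letter [simp]: "snd (flip_letter l) = snd l"
  by (simp add: flip_letter_def)

lemma flip_neq [simp]: "flip_letter l \<noteq> l" "l \<noteq> flip_letter l"
  by (cases l; simp add: flip_letter_def)+

lemma reduced_word_tl: "reduced_word (l # w) \<Longrightarrow> reduced_word w"
  by (cases w) auto

lemma reduced_push_letter: "reduced_word w \<Longrightarrow> reduced_word (push_letter l w)"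
  by (cases w) (auto dest: reduced_word_tl)

lemma push_push_flip: "reduced_word w \<Longrightarrow> push_letter l (push_letter (flip_letter l) w) = w"
  by (cases w rule: reduced_word.cases) auto

lemma set_push_letter: "set (push_letter l w) \<subseteq> insert l (set w)"
  by (cases w) auto

lemma reduced_foldr_push: "reduced_word w \<Longrightarrow> reduced_word (foldr push_letter u w)"
  by (induction u) (auto simp: reduced_push_letter)

lemma set_foldr_push: "set (foldr push_letter u w) \<subseteq> set u \<union> set w"
proof (induction u)
  case (Cons l u)
  then show ?case using set_push_letter[of l "foldr push_letter u w"] by auto
qed simp

lemma push_letter_reduced: "reduced_word (l # w) \<Longrightarrow> push_letter l w = l # w"
  by (cases w) auto

lemma foldr_push_Nil: "reduced_word w \<Longrightarrow> foldr push_letter w [] = w"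
proof (induction w)
  case (Cons l w)
  then show ?case using reduced_word_tl[of l w] by (simp add: push_letter_reduced)
qed simp

lemma foldr_push_letter:
  assumes "reduced_word v" "reduced_word w"
  shows "foldr push_letter (push_letter l v) w = push_letter l (foldr push_letter v w)"
proof (cases v)
  case (Cons k v')
  have "reduced_word (foldr push_letter v' w)"
    using assms by (intro reduced_foldr_push)
  then show ?thesis
    using Cons push_push_flip[of "foldr push_letter v' w" l] by (cases "k = flip_letter l") simp_all
qed simp

lemma foldr_push_assoc:
  assumes "reduced_word v" "reduced_word w"
  shows "foldr push_letter (foldr push_letter u v) w = foldr push_letter u (foldr push_letter v w)"
  using assms by (induction u) (auto simp: foldr_push_letter reduced_foldr_push)

lemma foldr_push_append_inverse:
  "reduced_word w \<Longrightarrow> foldr push_letter (rev (map flip_letter u)) (foldr push_letter u w) = w"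
proof (induction u arbitrary: w)
  case (Cons l u)
  have "reduced_word (foldr push_letter u w)" using Cons.prems by (rule reduced_foldr_push)
  then have "push_letter (flip_letter l) (push_letter l (foldr push_letter u w)) =
      foldr push_letter u w"
    using push_push_flip[of _ "flip_letter l"] by simp
  then show ?case using Cons by simp
qed simp

lemma group_free_group: "group (free_group S)"
proof (rule groupI)
  fix x y assume "x \<in> carrier (free_group S)" "y \<in> carrier (free_group S)"
  then show "x \<otimes>\<^bsub>free_group S\<^esub> y \<in> carrier (free_group S)"
    using set_foldr_push[of x y] by (fastforce simp: free_group_def reduced_foldr_push)
next
  show "\<one>\<^bsub>free_group S\<^esub> \<in> carrier (free_group S)"
    by (simp add: free_group_def)
next
  fix x y z
  assume "x \<in> carrier (free_group S)" "y \<in> carrier (free_group S)" "z \<in> carrier (free_group S)"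
  then show "x \<otimes>\<^bsub>free_group S\<^esub> y \<otimes>\<^bsub>free_group S\<^esub> z =
      x \<otimes>\<^bsub>free_group S\<^esub> (y \<otimes>\<^bsub>free_group S\<^esub> z)"
    by (simp add: free_group_def foldr_push_assoc)
next
  fix x assume "x \<in> carrier (free_group S)"
  then show "\<one>\<^bsub>free_group S\<^esub> \<otimes>\<^bsub>free_group S\<^esub> x = x"
    by (simp add: free_group_def)
next
  fix x assume x: "x \<in> carrier (free_group S)"
  let ?y = "foldr push_letter (rev (map flip_letter x)) []"
  have "?y \<in> carrier (free_group S)"
    using x set_foldr_push[of "rev (map flip_letter x)" "[]"]
    by (fastforce simp: free_group_def reduced_foldr_push)
  moreover have "foldr push_letter ?y x = []"
  proof -
    have "foldr push_letter ?y x = foldr push_letter (rev (map flip_letter x)) (foldr push_letter [] x)"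
      by (rule foldr_push_assoc) (use x in \<open>auto simp: free_group_def\<close>)
    also have "\<dots> = foldr push_letter (rev (map flip_letter x)) (foldr push_letter x [])"
      using x by (simp add: free_group_def foldr_push_Nil)
    also have "\<dots> = []" by (rule foldr_push_append_inverse) simp
    finally show ?thesis .
  qed
  ultimately show "\<exists>y\<in>carrier (free_group S). y \<otimes>\<^bsub>free_group S\<^esub> x = \<one>\<^bsub>free_group S\<^esub>"
    by (intro bexI[of _ ?y]) (simp_all add: free_group_def)
qed

lemma free_group_extension_push:
  assumes "group G" "f \<in> S \<rightarrow> carrier G" "snd l \<in> S" "snd ` set w \<subseteq> S"
  shows "free_group_extension G f (push_letter l w) = free_group_extension G f (l # w)"
    and "free_group_extension G f w \<in> carrier G"
proof -
  interpret group G by fact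
  have fin: "f x \<in> carrier G" if "x \<in> S" for x using that assms by auto
  have cl: "free_group_extension G f w \<in> carrier G" if "snd ` set w \<subseteq> S" for w
    using that by (induction w) (auto simp: free_group_extension_def fin)
  show "free_group_extension G f w \<in> carrier G" using assms by (intro cl)
  show "free_group_extension G f (push_letter l w) = free_group_extension G f (l # w)"
  proof (cases w)
    case (Cons k v)
    show ?thesis
    proof (cases "k = flip_letter l")
      case True
      have v: "free_group_extension G f v \<in> carrier G" using assms Cons by (intro cl) auto
      have s: "f (snd l) \<in> carrier G" using assms fin by auto
      obtain b x where l: "l = (b, x)" by (cases l)
      show ?thesis
        using True Cons v s
        by (cases b) (simp_all add: l flip_letter_def free_group_extension_def m_assoc[symmetric])
    qed (use Cons in simp)
  qed simp
qed

lemma free_group_extension_hom: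
  assumes "group G" "f \<in> S \<rightarrow> carrier G"
  shows "free_group_extension G f \<in> hom (free_group S) G"
proof (rule homI)
  interpret group G by fact
  have fin: "f x \<in> carrier G" if "x \<in> S" for x using that assms by auto
  have cl: "free_group_extension G f w \<in> carrier G" if "snd ` set w \<subseteq> S" for w
    using that by (induction w) (auto simp: free_group_extension_def fin)
  show "free_group_extension G f w \<in> carrier G" if "w \<in> carrier (free_group S)" for w
    using that by (intro cl) (simp add: free_group_def)
  fix x y assume x: "x \<in> carrier (free_group S)" and y: "y \<in> carrier (free_group S)"
  have "free_group_extension G f (foldr push_letter u y) =
      free_group_extension G f u \<otimes>\<^bsub>G\<^esub> free_group_extension G f y" if "snd ` set u \<subseteq> S" for u
    using that
  proof (induction u)
    case Nil
    then show ?case using y cl[of y] by (simp add: free_group_extension_def free_group_def)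
  next
    case (Cons l u)
    have "snd ` set (foldr push_letter u y) \<subseteq> S"
      using set_foldr_push[of u y] Cons.prems y by (force simp: free_group_def)
    then have "free_group_extension G f (foldr push_letter (l # u) y) =
        free_group_extension G f (l # foldr push_letter u y)"
      using free_group_extension_push(1)[OF assms, of l] Cons.prems by simp
    moreover have "free_group_extension G f (l # w) =
        (if fst l then f (snd l) else inv\<^bsub>G\<^esub> f (snd l)) \<otimes>\<^bsub>G\<^esub> free_group_extension G f w" for w
      by (simp add: free_group_extension_def case_prod_unfold)
    moreover have "f (snd l) \<in> carrier G" using Cons.prems fin by auto
    ultimately show ?case using Cons cl[of u] cl[of y] y
      by (auto simp: m_assoc free_group_def)
  qed
  then show "free_group_extension G f (x \<otimes>\<^bsub>free_group S\<^esub> y) =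
      free_group_extension G f x \<otimes>\<^bsub>G\<^esub> free_group_extension G f y"
    using x by (simp add: free_group_def)
qed

lemma topspace_markov_topology: "topspace (markov_topology T) = carrier (free_group (topspace T))"
proof -
  let ?F = "free_group (topspace T)"
  interpret group ?F by (rule group_free_group)
  define S where "S = topology (\<lambda>U. U = {} \<or> U = carrier ?F)"
  have "istopology (\<lambda>U. U = {} \<or> U = carrier ?F)"
    unfolding istopology_def by (auto; blast)
  then have S: "openin S U \<longleftrightarrow> U = {} \<or> U = carrier ?F" for U
    by (simp add: S_def topology_inverse')
  then have top: "topspace S = carrier ?F"
    unfolding topspace_def by auto
  have cont: "continuous_map Z S f" if "f ` topspace Z \<subseteq> carrier ?F" for Z :: "'z topology" and f
  proof -
    have "{x \<in> topspace Z. f x \<in> carrier ?F} = topspace Z" using that by auto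
    then show ?thesis using that by (auto simp: continuous_map_def top S)
  qed
  have "topological_group ?F S"
    unfolding topological_group_def using group_free_group
    by (auto simp: top topspace_prod_topology intro!: cont)
  moreover have "continuous_map T S free_generator"
    by (rule cont) (auto simp: free_generator_def free_group_def)
  ultimately have "\<exists>S. topological_group ?F S \<and> continuous_map T S free_generator \<and>
      openin S (carrier ?F)"
    using S by blast
  moreover have "U \<subseteq> carrier ?F" if "topological_group ?F S'" "openin S' U" for U S'
    using that openin_subset[of S' U] by (simp add: topological_group_def)
  ultimately show ?thesis
    unfolding markov_topology_def topology_generated_by_topspace by blast
qed

lemma continuous_map_to_markov_topology:
  assumes "\<And>S. \<lbrakk>topological_group (free_group (topspace T)) S; continuous_map T S free_generator\<rbrakk>
             \<Longrightarrow> continuous_map Z S f"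
    and "f ` topspace Z \<subseteq> carrier (free_group (topspace T))"
  shows "continuous_map Z (markov_topology T) f"
  using assms topspace_markov_topology[of T]
  unfolding markov_topology_def topology_generated_by_topspace
  by (intro continuous_on_generated_topo) (auto simp: continuous_map_alt)

lemma continuous_map_from_markov_topology:
  assumes "topological_group (free_group (topspace T)) S" "continuous_map T S free_generator"
  shows "continuous_map (markov_topology T) S (\<lambda>w. w)"
proof -
  have "openin (markov_topology T) U" if "openin S U" for U
    unfolding markov_topology_def using assms that
    by (intro topology_generated_by_Basis) blast
  moreover have "topspace S = carrier (free_group (topspace T))"
    using assms by (simp add: topological_group_def)
  ultimately show ?thesis
    by (simp add: continuous_map_alt topspace_markov_topology openin_Int
        flip: topspace_markov_topology)
qed

lemma continuous_map_free_generator: "continuous_map T (markov_topology T) free_generator"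
  by (rule continuous_map_to_markov_topology) (auto simp: free_generator_def free_group_def)

lemma topological_group_markov_topology:
  "topological_group (free_group (topspace T)) (markov_topology T)"
proof -
  let ?F = "free_group (topspace T)"
  let ?M = "markov_topology T"
  interpret group ?F by (rule group_free_group)
  have "continuous_map (prod_topology ?M ?M) ?M (\<lambda>(g, h). g \<otimes>\<^bsub>?F\<^esub> h)"
  proof (rule continuous_map_to_markov_topology)
    fix S assume S: "topological_group ?F S" "continuous_map T S free_generator"
    have id: "continuous_map ?M S (\<lambda>w. w)" by (rule continuous_map_from_markov_topology[OF S])
    have "continuous_map (prod_topology ?M ?M) (prod_topology S S) (\<lambda>(g, h). (g, h))"
      using continuous_map_prod_top[of ?M ?M S S "\<lambda>w. w" "\<lambda>w. w"] id by simp
    from continuous_map_compose[OF this, of S "\<lambda>(g, h). g \<otimes>\<^bsub>?F\<^esub> h"] S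
    show "continuous_map (prod_topology ?M ?M) S (\<lambda>(g, h). g \<otimes>\<^bsub>?F\<^esub> h)"
      by (simp add: topological_group_def o_def case_prod_unfold)
  qed (auto simp: topspace_markov_topology)
  moreover have "continuous_map ?M ?M (\<lambda>g. inv\<^bsub>?F\<^esub> g)"
  proof (rule continuous_map_to_markov_topology)
    fix S assume S: "topological_group ?F S" "continuous_map T S free_generator"
    from continuous_map_compose[OF continuous_map_from_markov_topology[OF S], of S "\<lambda>g. inv\<^bsub>?F\<^esub> g"] S
    show "continuous_map ?M S (\<lambda>g. inv\<^bsub>?F\<^esub> g)"
      by (simp add: topological_group_def o_def)
  qed (auto simp: topspace_markov_topology)
  ultimately show ?thesis
    by (simp add: topological_group_def group_free_group topspace_markov_topology)
qed

lemma free_group_extension_generator: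
  assumes "group G" "f x \<in> carrier G"
  shows "free_group_extension G f (free_generator x) = f x"
proof -
  interpret group G by fact
  show ?thesis using assms by (simp add: free_group_extension_def free_generator_def)
qed

theorem markov_universal_property:
  fixes T :: "'x topology"
  assumes G: "topological_group G S" and f: "continuous_map T S f"
  shows "continuous_map (markov_topology T) S (free_group_extension G f)"
proof -
  let ?F = "free_group (topspace T)"
  let ?e = "free_group_extension G f"
  interpret F: group ?F by (rule group_free_group)
  interpret G: group G using G by (simp add: topological_group_def)
  have S: "topspace S = carrier G" using G by (simp add: topological_group_def)
  have fin: "f \<in> topspace T \<rightarrow> carrier G"
    using f S by (auto simp: continuous_map_def)
  have hom: "?e \<in> hom ?F G" by (rule free_group_extension_hom[OF G.group_axioms fin])
  have e: "?e ` carrier ?F \<subseteq> carrier G" using hom by (auto simp: hom_def)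
  define P where "P = pullback_topology (carrier ?F) ?e S"
  have P: "topspace P = carrier ?F"
    using e by (auto simp: P_def topspace_pullback_topology S)
  have contP: "continuous_map Z P g" if "g ` topspace Z \<subseteq> carrier ?F" "continuous_map Z S (?e \<circ> g)"
    for Z :: "'z topology" and g
    unfolding P_def using that by (intro continuous_map_pullback') auto
  have eP: "continuous_map P S ?e"
    using continuous_map_pullback[of S S "\<lambda>x. x" "carrier ?F" ?e] by (simp add: P_def o_def)
  have mult: "continuous_map (prod_topology S S) S (\<lambda>(g, h). g \<otimes>\<^bsub>G\<^esub> h)"
    and inve: "continuous_map S S (\<lambda>g. inv\<^bsub>G\<^esub> g)"
    using G by (simp_all add: topological_group_def)
  have "topological_group ?F P"
    unfolding topological_group_def
  proof (intro conjI)
    show "continuous_map (prod_topology P P) P (\<lambda>(g, h). g \<otimes>\<^bsub>?F\<^esub> h)"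
    proof (rule contP)
      have "continuous_map (prod_topology P P) (prod_topology S S) (\<lambda>(g, h). (?e g, ?e h))"
        using eP by (simp add: continuous_map_prod_top)
      from continuous_map_compose[OF this mult]
      show "continuous_map (prod_topology P P) S (?e \<circ> (\<lambda>(g, h). g \<otimes>\<^bsub>?F\<^esub> h))"
        by (rule continuous_map_eq) (use hom in \<open>auto simp: P hom_def\<close>)
    qed (auto simp: P)
    show "continuous_map P P (\<lambda>g. inv\<^bsub>?F\<^esub> g)"
    proof (rule contP)
      interpret group_hom ?F G ?e using hom by unfold_locales
      from continuous_map_compose[OF eP inve]
      show "continuous_map P S (?e \<circ> (\<lambda>g. inv\<^bsub>?F\<^esub> g))"
        by (rule continuous_map_eq) (auto simp: P)
    qed (auto simp: P)
  qed (auto simp: P F.group_axioms)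
  moreover have "continuous_map T P free_generator"
  proof (rule contP)
    show "free_generator ` topspace T \<subseteq> carrier ?F"
      by (auto simp: free_generator_def free_group_def)
    show "continuous_map T S (?e \<circ> free_generator)"
      by (rule continuous_map_eq[OF f])
        (use fin in \<open>simp add: Pi_iff free_group_extension_generator[OF G.group_axioms]\<close>)
  qed
  ultimately have "continuous_map (markov_topology T) P (\<lambda>w. w)"
    by (rule continuous_map_from_markov_topology)
  from continuous_map_compose[OF this eP] show ?thesis by (simp add: o_def)
qed


section \<open>The fundamental groupoid\<close>

definition path_class :: "'a topology \<Rightarrow> (real \<Rightarrow> 'a) \<Rightarrow> (real \<Rightarrow> 'a) set" where
  "path_class X \<alpha> = {\<beta> \<in> topspace (path_space X).
     homotopic_with (\<lambda>\<gamma>. \<gamma> 0 = \<alpha> 0 \<and> \<gamma> 1 = \<alpha> 1) unit_interval X \<alpha> \<beta>}"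

definition path_concat :: "(real \<Rightarrow> 'a) \<Rightarrow> (real \<Rightarrow> 'a) \<Rightarrow> real \<Rightarrow> 'a" where
  "path_concat \<alpha> \<beta> = (\<lambda>t\<in>{0..1}. if t \<le> 1 / 2 then \<alpha> (2 * t) else \<beta> (2 * t - 1))"

definition fundamental_groupoid :: "'a topology \<Rightarrow> ('a, (real \<Rightarrow> 'a) set) cat" where
  "fundamental_groupoid X = \<lparr>
     Obj = topspace X,
     Arr = path_class X ` topspace (path_space X),
     Dom = (\<lambda>c. THE x. \<forall>\<alpha>\<in>c. \<alpha> 0 = x),
     Cod = (\<lambda>c. THE x. \<forall>\<alpha>\<in>c. \<alpha> 1 = x),
     Ident = (\<lambda>x. path_class X (\<lambda>t\<in>{0..1}. x)),
     Comp = (\<lambda>c d. \<Union>\<alpha>\<in>c. \<Union>\<beta>\<in>d. path_class X (path_concat \<alpha> \<beta>))\<rparr>"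

definition pi_qtop :: "'a topology \<Rightarrow> ('a, (real \<Rightarrow> 'a) set) topcat" where
  "pi_qtop X = cat.extend (fundamental_groupoid X)
     (topcat.fields (\<lambda>x\<^sub>1 x\<^sub>2. quotient_topology (path_space_between X x\<^sub>1 x\<^sub>2) (path_class X)))"

definition vertex_group :: "('o, 'm, 'z) cat_scheme \<Rightarrow> 'o \<Rightarrow> 'm monoid" where
  "vertex_group H x = \<lparr>carrier = homset H x x, mult = Comp H, one = Ident H x\<rparr>"

definition pi_tau_vertex_topology :: "'a topology \<Rightarrow> 'a \<Rightarrow> (real \<Rightarrow> 'a) set topology" where
  "pi_tau_vertex_topology X x =
     tau_topology (vertex_group (pi_qtop X) x) (hom_top (pi_qtop X) x x)"

definition pi_tau :: "'a topology \<Rightarrow> ('a, (real \<Rightarrow> 'a) set) topcat" where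
  "pi_tau X = cat.extend (fundamental_groupoid X)
     (topcat.fields (\<lambda>x\<^sub>1 x\<^sub>2.
        if x\<^sub>1 = x\<^sub>2 then pi_tau_vertex_topology X x\<^sub>1
        else topology_generated_by
          {(\<lambda>u. Comp (fundamental_groupoid X) u g) ` U | U g.
             openin (pi_tau_vertex_topology X x\<^sub>1) U \<and> g \<in> homset (fundamental_groupoid X) x\<^sub>1 x\<^sub>2}))"

definition induced_class_map ::
    "'b topology \<Rightarrow> 'a topology \<Rightarrow> ('b \<Rightarrow> 'a) \<Rightarrow> (real \<Rightarrow> 'b) set \<Rightarrow> (real \<Rightarrow> 'a) set" where
  "induced_class_map Y X p =
     (\<lambda>c\<in>Arr (fundamental_groupoid Y). \<Union>\<alpha>\<in>c. path_class X (compose {0..1} p \<alpha>))"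

definition pi_tau_shriek_obj :: "'a topology \<Rightarrow> 'b topology \<times> ('b \<Rightarrow> 'a) \<Rightarrow>
    ('b, (real \<Rightarrow> 'b) set, 'a, (real \<Rightarrow> 'a) set) groupoid_over" where
  "pi_tau_shriek_obj X = (\<lambda>(Y, p). (pi_tau Y, p, induced_class_map Y X p))"

definition pi_tau_shriek_arr :: "'a topology \<Rightarrow>
    ('b topology \<times> ('b \<Rightarrow> 'a)) \<times> ('b topology \<times> ('b \<Rightarrow> 'a)) \<times> ('b \<Rightarrow> 'b) \<Rightarrow>
    ('b, (real \<Rightarrow> 'b) set, 'a, (real \<Rightarrow> 'a) set) groupoid_over \<times>
    ('b, (real \<Rightarrow> 'b) set, 'a, (real \<Rightarrow> 'a) set) groupoid_over \<times>
    (('b \<Rightarrow> 'b) \<times> ((real \<Rightarrow> 'b) set \<Rightarrow> (real \<Rightarrow> 'b) set))" where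
  "pi_tau_shriek_arr X = (\<lambda>(A, B, f).
     (pi_tau_shriek_obj X A, pi_tau_shriek_obj X B, (f, induced_class_map (fst A) (fst B) f)))"

end

theory Submission
  imports Defs
begin

text \<open>For fullness, over a locally wep-connected base a semicovering carries the topology coinduced by the
  endpoint maps of its based path spaces, so the object part of a functor over \<open>pi_tau X\<close> is
  automatically continuous. For essential surjectivity, an open covering morphism \<open>H\<close> transports its objects
  along the paths of \<open>X\<close>; its objects receive the coinduced topology, well-ended paths
  produce the sheets over \<open>X\<close>, and maps from \<open>I\<close> and \<open>\<Delta>\<^sub>2\<close> are lifted by transporting
  along rays. Both constructions rest on two facts. A homotopy of paths is a path in the path space, so it
  lifts by continuous lifting of paths. And an open embedding of quasitopological groups stays open after
  applying \<open>\<tau>\<close>, because the conjugates of the \<open>\<tau>\<close>-open neighbourhoods of the identity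
  of the subgroup generate a group topology on the big group.\<close>

section \<open>Mapping spaces\<close>

text \<open>In the semicovering built from an open covering morphism \<open>H\<close>, openness
  enters through vertex groups: their images are \<open>\<tau>\<close>-open, so the loops at
  \<open>p y\<close> whose transport fixes \<open>y\<close> form an open set of loops. Coinducing
  the topology makes transport continuous at once; the burden moves to showing that the projection
  is open and locally injective. The obstacle is that a neighbourhood of \<open>y\<close> is not
  visible from \<open>y\<close> itself. Hence \<open>y\<close> is moved back along a locally
  well-ended loop \<alpha> at \<open>p y\<close> to a point \<open>z\<close>; points near
  \<open>y\<close> become ends of transports from the single point \<open>z\<close> along paths
  close to \<alpha>. These nearby paths have to be well-ended themselves, since the openness of a
  sheet is tested again at each of its points. On the algebraic side, quotient topologies guarantee
  in general only that translations and inversion are continuous, so statements are proved for them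
  and then transferred to \<open>\<tau>\<close>; arbitrary hom-spaces are reduced to vertex groups
  by translation. The points of the realized semicovering are the objects of \<open>H\<close>
  themselves, which leaves the type of arrows of \<open>H\<close> free.\<close>

lemma topspace_compact_open [simp]: "topspace (compact_open_topology K X) = maps K X"
proof -
  have "{f \<in> maps K X. f ` {} \<subseteq> {}} \<in> {{f \<in> maps K X. f ` C \<subseteq> U} | C U. compactin K C \<and> openin X U}"
    by (rule CollectI, rule exI[of _ "{}"], rule exI[of _ "{}"]) simp
  then have "maps K X \<subseteq> \<Union> {{f \<in> maps K X. f ` C \<subseteq> U} | C U. compactin K C \<and> openin X U}"
    by (intro Union_upper) simp
  then show ?thesis
    unfolding compact_open_topology_def topology_generated_by_topspace by auto
qed

lemma openin_compact_open:
  "\<lbrakk>compactin K C; openin X U\<rbrakk> \<Longrightarrow> openin (compact_open_topology K X) {f \<in> maps K X. f ` C \<subseteq> U}"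
  unfolding compact_open_topology_def by (intro topology_generated_by_Basis) blast

text \<open>Tube argument: if \<open>f z\<close> maps a compact \<open>C\<close> into an open
  \<open>U\<close>, the slice over \<open>z\<close> lies in the open preimage of \<open>U\<close>,
  and Wallace's theorem thickens \<open>{z}\<close> to an open set with the same property. This is
  the source of all continuous families of paths below.\<close>

lemma continuous_map_curry:
  assumes f: "continuous_map (prod_topology Z K) X (\<lambda>(z, k). f z k)"
  shows "continuous_map Z (compact_open_topology K X) (\<lambda>z. restrict (f z) (topspace K))"
proof -
  have m: "restrict (f z) (topspace K) \<in> maps K X" if "z \<in> topspace Z" for z
  proof -
    have "continuous_map K X ((\<lambda>(z, k). f z k) \<circ> (\<lambda>k. (z, k)))"
      by (rule continuous_map_compose[OF _ f]) (use that in \<open>simp add: continuous_map_paired\<close>)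
    then show ?thesis unfolding maps_def
      by (auto intro: continuous_map_eq)
  qed
  show ?thesis
    unfolding compact_open_topology_def
  proof (rule continuous_on_generated_topo)
    show "(\<lambda>z. restrict (f z) (topspace K)) ` topspace Z
        \<subseteq> \<Union> {{f \<in> maps K X. f ` C \<subseteq> U} |C U. compactin K C \<and> openin X U}"
      using m topspace_compact_open[of K X]
      unfolding compact_open_topology_def topology_generated_by_topspace by blast
    fix N assume "N \<in> {{f \<in> maps K X. f ` C \<subseteq> U} |C U. compactin K C \<and> openin X U}"
    then obtain C U where N: "N = {f \<in> maps K X. f ` C \<subseteq> U}" and C: "compactin K C" and U: "openin X U"
      by blast
    have CK: "C \<subseteq> topspace K" using C by (rule compactin_subset_topspace)
    define W where "W = {w \<in> topspace (prod_topology Z K). (\<lambda>(z, k). f z k) w \<in> U}"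
    have W: "openin (prod_topology Z K) W"
      unfolding W_def by (rule openin_continuous_map_preimage[OF f U])
    have "\<exists>T. openin Z T \<and> z \<in> T \<and> T \<subseteq> (\<lambda>z. restrict (f z) (topspace K)) -` N \<inter> topspace Z"
      if z: "z \<in> (\<lambda>z. restrict (f z) (topspace K)) -` N \<inter> topspace Z" for z
    proof -
      have "{z} \<times> C \<subseteq> W" using z CK by (force simp: N W_def image_subset_iff subset_iff split: if_splits)
      moreover have "compactin Z {z}" using z by simp
      ultimately obtain S T where "openin Z S" "openin K T" "{z} \<subseteq> S" "C \<subseteq> T" "S \<times> T \<subseteq> W"
        using Wallace_theorem_prod_topology[OF _ C W] by metis
      then show ?thesis
        using CK m openin_subset[of Z S]
        by (intro exI[of _ S]) (auto simp: N W_def image_subset_iff subset_iff)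
    qed
    then show "openin Z ((\<lambda>z. restrict (f z) (topspace K)) -` N \<inter> topspace Z)"
      by (subst openin_subopen) blast
  qed
qed

text \<open>Compact metric domains have small compact neighbourhoods: near \<open>k\<close> a closed
  ball is mapped into \<open>U\<close> by \<open>f\<close>, and mapping that ball into
  \<open>U\<close> is a subbasic open condition on \<open>f\<close>.\<close>

lemma continuous_map_eval:
  fixes S :: "'k::metric_space set"
  assumes S: "compact S"
  shows "continuous_map (prod_topology (compact_open_topology (top_of_set S) X) (top_of_set S)) X (\<lambda>(f, k). f k)"
  unfolding continuous_map_def
proof (intro conjI allI impI)
  let ?C = "compact_open_topology (top_of_set S) X"
  show "(\<lambda>(f, k). f k) \<in> topspace (prod_topology ?C (top_of_set S)) \<rightarrow> topspace X"
    by (auto simp: maps_def continuous_map_def Pi_iff)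
  fix U assume U: "openin X U"
  show "openin (prod_topology ?C (top_of_set S))
      {w \<in> topspace (prod_topology ?C (top_of_set S)). (\<lambda>(f, k). f k) w \<in> U}"
    unfolding openin_prod_topology_alt
  proof (intro allI impI)
    fix f k assume "(f, k) \<in> {w \<in> topspace (prod_topology ?C (top_of_set S)). (\<lambda>(f, k). f k) w \<in> U}"
    then have f: "f \<in> maps (top_of_set S) X" and k: "k \<in> S" and fk: "f k \<in> U" by auto
    have "openin (top_of_set S) {k \<in> topspace (top_of_set S). f k \<in> U}"
      using f U unfolding maps_def by (intro openin_continuous_map_preimage) auto
    then have "openin (top_of_set S) {k \<in> S. f k \<in> U}" by simp
    then obtain e where e: "e > 0" "ball k e \<inter> S \<subseteq> {k \<in> S. f k \<in> U}"
      using k fk unfolding openin_contains_ball by blast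
    \<comment> \<open>Half the radius, so that the closed ball still lies inside
      \<open>ball k e\<close>, on which \<open>f\<close> takes values in \<open>U\<close>.\<close>
    let ?D = "S \<inter> cball k (e / 2)"
    have "compactin (top_of_set S) ?D"
      using S by (auto simp: compactin_subtopology compact_Int_closed)
    from openin_compact_open[OF this U]
    have "openin ?C {f \<in> maps (top_of_set S) X. f ` ?D \<subseteq> U}" .
    moreover have "openin (top_of_set S) (S \<inter> ball k (e / 2))" by (simp add: openin_open_Int)
    moreover have "f ` ?D \<subseteq> U" using e by (force simp: subset_iff)
    ultimately show "\<exists>A B. openin ?C A \<and> openin (top_of_set S) B \<and> f \<in> A \<and> k \<in> B \<and>
        A \<times> B \<subseteq> {w \<in> topspace (prod_topology ?C (top_of_set S)). (\<lambda>(f, k). f k) w \<in> U}"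
      using f k e
      by (intro exI[of _ "{f \<in> maps (top_of_set S) X. f ` ?D \<subseteq> U}"] exI[of _ "S \<inter> ball k (e / 2)"])
        (auto simp: image_subset_iff)
  qed
qed

lemma continuous_map_eval_compose:
  fixes S :: "'k::metric_space set"
  assumes "compact S" "continuous_map Z (compact_open_topology (top_of_set S) X) a"
    "continuous_map Z (top_of_set S) t"
  shows "continuous_map Z X (\<lambda>z. a z (t z))"
  using continuous_map_compose[OF _ continuous_map_eval[OF assms(1), of X], of Z "\<lambda>z. (a z, t z)"] assms(2,3)
  by (simp add: continuous_map_paired o_def)

text \<open>The preimage of the subbasic set given by \<open>C\<close> and \<open>U\<close> is the
  subbasic set given by \<open>C\<close> and the preimage of \<open>U\<close> under
  \<open>p\<close>.\<close>

lemma continuous_map_compact_open_compose: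
  assumes "continuous_map Y X p"
  shows "continuous_map (compact_open_topology K Y) (compact_open_topology K X) (compose (topspace K) p)"
  unfolding compact_open_topology_def[of K X]
proof (rule continuous_on_generated_topo)
  have m: "compose (topspace K) p f \<in> maps K X" if "f \<in> maps K Y" for f
    using that continuous_map_compose[of K Y f X p] assms
    by (auto simp: maps_def compose_def o_def intro: continuous_map_eq)
  show "compose (topspace K) p ` topspace (compact_open_topology K Y)
        \<subseteq> \<Union> {{f \<in> maps K X. f ` C \<subseteq> U} |C U. compactin K C \<and> openin X U}"
    using m topspace_compact_open[of K X]
    unfolding compact_open_topology_def[of K X] topology_generated_by_topspace by auto
  fix N assume "N \<in> {{f \<in> maps K X. f ` C \<subseteq> U} |C U. compactin K C \<and> openin X U}"
  then obtain C U where N: "N = {f \<in> maps K X. f ` C \<subseteq> U}" and C: "compactin K C" and U: "openin X U"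
    by blast
  have CK: "C \<subseteq> topspace K" using C by (rule compactin_subset_topspace)
  have "compose (topspace K) p -` N \<inter> topspace (compact_open_topology K Y)
      = {f \<in> maps K Y. f ` C \<subseteq> {y \<in> topspace Y. p y \<in> U}}"
  proof -
    have "compose (topspace K) p f \<in> N \<longleftrightarrow> f ` C \<subseteq> {y \<in> topspace Y. p y \<in> U}"
      if f: "f \<in> maps K Y" for f
      using m[OF f] f CK
      by (auto simp: N compose_def image_subset_iff maps_def continuous_map_def Pi_iff)
    then show ?thesis by auto
  qed
  then show "openin (compact_open_topology K Y) (compose (topspace K) p -` N \<inter> topspace (compact_open_topology K Y))"
    using openin_compact_open[OF C openin_continuous_map_preimage[OF assms U]] by simp
qed

section \<open>Path spaces and path classes\<close>

abbreviation paths :: "'a topology \<Rightarrow> (real \<Rightarrow> 'a) set" where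
  "paths X \<equiv> topspace (path_space X)"

lemma topspace_path_space: "paths X = maps unit_interval X"
  by (simp add: path_space_def)

lemma continuous_map_curry_path:
  assumes "continuous_map (prod_topology Z unit_interval) X (\<lambda>(z, t). f z t)"
  shows "continuous_map Z (path_space X) (\<lambda>z. restrict (f z) {0..1})"
  using continuous_map_curry[OF assms] by (simp add: path_space_def)

lemma continuous_map_eval_path:
  assumes "continuous_map Z (path_space X) a" "continuous_map Z unit_interval t"
  shows "continuous_map Z X (\<lambda>z. a z (t z))"
  using assms continuous_map_eval_compose[of "{0..1}" Z X a t] by (simp add: path_space_def)

lemma continuous_map_path_compose:
  "continuous_map Y X p \<Longrightarrow> continuous_map (path_space Y) (path_space X) (compose {0..1} p)"
  using continuous_map_compact_open_compose[of Y X p unit_interval] by (simp add: path_space_def)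

lemma continuous_map_unit_interval:
  "continuous_map Z unit_interval t \<longleftrightarrow> continuous_map Z euclideanreal t \<and> (\<forall>z\<in>topspace Z. 0 \<le> t z \<and> t z \<le> 1)"
  by (auto simp: continuous_map_in_subtopology)

lemma path_in_topspace: "\<alpha> \<in> paths X \<Longrightarrow> t \<in> {0..1} \<Longrightarrow> \<alpha> t \<in> topspace X"
  by (auto simp: topspace_path_space maps_def continuous_map_def)

lemma path_eqI:
  assumes "\<alpha> \<in> paths X" "\<beta> \<in> paths X" "\<And>t. t \<in> {0..1} \<Longrightarrow> \<alpha> t = \<beta> t"
  shows "\<alpha> = \<beta>"
  using assms extensionalityI[of \<alpha> "{0..1}" \<beta>] by (auto simp: topspace_path_space maps_def)

lemma continuous_map_in_topspace: "continuous_map Z Y f \<Longrightarrow> z \<in> topspace Z \<Longrightarrow> f z \<in> topspace Y"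
  by (auto simp: continuous_map_def)

definition path_reverse :: "(real \<Rightarrow> 'a) \<Rightarrow> real \<Rightarrow> 'a" where
  "path_reverse \<alpha> = (\<lambda>t\<in>{0..1}. \<alpha> (1 - t))"

definition path_const :: "'a \<Rightarrow> real \<Rightarrow> 'a" where
  "path_const x = (\<lambda>t\<in>{0..1}. x)"

lemma path_concat_ends [simp]: "path_concat \<alpha> \<beta> 0 = \<alpha> 0" "path_concat \<alpha> \<beta> 1 = \<beta> 1"
  by (simp_all add: path_concat_def)

lemma path_reverse_ends [simp]: "path_reverse \<alpha> 0 = \<alpha> 1" "path_reverse \<alpha> 1 = \<alpha> 0"
  by (simp_all add: path_reverse_def)

lemma path_const_ends [simp]: "path_const x 0 = x" "path_const x 1 = x"
  by (simp_all add: path_const_def)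

lemma continuous_map_snd_real: "continuous_map (prod_topology Z unit_interval) euclideanreal snd"
  using continuous_map_snd[of Z unit_interval] by (simp add: continuous_map_in_subtopology)

text \<open>The reparametrization may itself depend on \<open>z\<close>. This generality covers
  reversal, straight-line homotopies between reparametrizations, and the family of initial segments
  of a path.\<close>

lemma continuous_map_reparam:
  assumes a: "continuous_map Z (path_space X) a"
    and f: "continuous_map (prod_topology Z unit_interval) unit_interval (\<lambda>(z, t). f z t)"
  shows "continuous_map Z (path_space X) (\<lambda>z. \<lambda>t\<in>{0..1}. a z (f z t))"
proof (rule continuous_map_curry_path)
  have "continuous_map (prod_topology Z unit_interval) X (\<lambda>w. a (fst w) ((\<lambda>(z, t). f z t) w))"
    by (rule continuous_map_eval_path[OF _ f])
      (use continuous_map_compose[OF continuous_map_fst a] in \<open>simp add: o_def\<close>)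
  then show "continuous_map (prod_topology Z unit_interval) X (\<lambda>(z, t). a z (f z t))"
    by (simp add: case_prod_unfold)
qed

lemma continuous_map_path_reverse:
  assumes a: "continuous_map Z (path_space X) a"
  shows "continuous_map Z (path_space X) (\<lambda>z. path_reverse (a z))"
  unfolding path_reverse_def
proof (rule continuous_map_reparam[OF a])
  show "continuous_map (prod_topology Z unit_interval) unit_interval (\<lambda>(z, t). 1 - t)"
    unfolding continuous_map_unit_interval case_prod_unfold
    by (auto intro!: continuous_intros continuous_map_snd_real)
qed

lemma continuous_map_path_const:
  assumes a: "continuous_map Z X a"
  shows "continuous_map Z (path_space X) (\<lambda>z. path_const (a z))"
  unfolding path_const_def
  by (rule continuous_map_curry_path)
    (use continuous_map_compose[OF continuous_map_fst a] in \<open>simp add: o_def case_prod_unfold\<close>)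

lemma continuous_map_path_concat:
  assumes a: "continuous_map Z (path_space X) a" and b: "continuous_map Z (path_space X) b"
    and ab: "\<And>z. z \<in> topspace Z \<Longrightarrow> a z 1 = b z 0"
  shows "continuous_map Z (path_space X) (\<lambda>z. path_concat (a z) (b z))"
  unfolding path_concat_def
proof (rule continuous_map_curry_path)
  let ?Z = "prod_topology Z unit_interval"
  have fs: "continuous_map ?Z (path_space X) (\<lambda>w. a (fst w))" "continuous_map ?Z (path_space X) (\<lambda>w. b (fst w))"
    using continuous_map_compose[OF continuous_map_fst a] continuous_map_compose[OF continuous_map_fst b]
    by (simp_all add: o_def)
  have "continuous_map ?Z X (\<lambda>w. if snd w \<le> 1 / 2 then a (fst w) (2 * snd w) else b (fst w) (2 * snd w - 1))"
  proof (rule continuous_map_cases_le)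
    show "continuous_map ?Z euclideanreal snd" by (rule continuous_map_snd_real)
    show "continuous_map (subtopology ?Z {x \<in> topspace ?Z. snd x \<le> 1 / 2}) X (\<lambda>w. a (fst w) (2 * snd w))"
      by (rule continuous_map_eval_path[OF continuous_map_from_subtopology[OF fs(1)]])
        (auto simp: continuous_map_unit_interval
          intro!: continuous_intros continuous_map_from_subtopology continuous_map_snd_real)
    show "continuous_map (subtopology ?Z {x \<in> topspace ?Z. 1 / 2 \<le> snd x}) X (\<lambda>w. b (fst w) (2 * snd w - 1))"
      by (rule continuous_map_eval_path[OF continuous_map_from_subtopology[OF fs(2)]])
        (auto simp: continuous_map_unit_interval
          intro!: continuous_intros continuous_map_from_subtopology continuous_map_snd_real)
    show "a (fst w) (2 * snd w) = b (fst w) (2 * snd w - 1)"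
      if "w \<in> topspace ?Z" "snd w = 1 / 2" for w
    proof -
      have e: "2 * snd w = 1" using that by simp
      have "fst w \<in> topspace Z" using that by auto
      then show ?thesis unfolding e using ab[of "fst w"] by simp
    qed
  qed simp
  then show "continuous_map ?Z X (\<lambda>(z, t). if t \<le> 1 / 2 then a z (2 * t) else b z (2 * t - 1))"
    by (simp add: case_prod_unfold)
qed

lemma path_reverse_in: "\<alpha> \<in> paths X \<Longrightarrow> path_reverse \<alpha> \<in> paths X"
  using continuous_map_in_topspace[OF continuous_map_path_reverse[of "path_space X" X "\<lambda>a. a"]] by simp

lemma path_const_in: "x \<in> topspace X \<Longrightarrow> path_const x \<in> paths X"
  using continuous_map_in_topspace[OF continuous_map_path_const[of X X "\<lambda>a. a"]] by simp

lemma path_concat_in: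
  assumes "\<alpha> \<in> paths X" "\<beta> \<in> paths X" "\<alpha> 1 = \<beta> 0"
  shows "path_concat \<alpha> \<beta> \<in> paths X"
  using continuous_map_in_topspace[OF continuous_map_path_concat[of unit_interval X "\<lambda>_. \<alpha>" "\<lambda>_. \<beta>"], of 0] assms
  by simp

lemma path_compose_in:
  "continuous_map Y X p \<Longrightarrow> \<alpha> \<in> paths Y \<Longrightarrow> compose {0..1} p \<alpha> \<in> paths X"
  using continuous_map_in_topspace[OF continuous_map_path_compose] by blast

lemma topspace_path_space_between:
  "topspace (path_space_between X x y) = {\<alpha> \<in> paths X. \<alpha> 0 = x \<and> \<alpha> 1 = y}"
  by (auto simp: path_space_between_def)

text \<open>Currying and evaluation translate between homotopies on the square and paths in the path
  space. The second form is the one to which continuous lifting of paths applies.\<close>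

lemma path_class_iff:
  assumes "\<alpha> \<in> paths X"
  shows "\<beta> \<in> path_class X \<alpha> \<longleftrightarrow> \<beta> \<in> paths X \<and>
    (\<exists>h. continuous_map unit_interval (path_space X) h \<and> h 0 = \<alpha> \<and> h 1 = \<beta> \<and>
      (\<forall>t\<in>{0..1}. h t 0 = \<alpha> 0 \<and> h t 1 = \<alpha> 1))" (is "_ \<longleftrightarrow> _ \<and> (\<exists>h. ?P h)")
proof -
  let ?Q = "\<lambda>H. continuous_map (prod_topology unit_interval unit_interval) X H \<and>
      (\<forall>s\<in>topspace unit_interval. H (0, s) = \<alpha> s) \<and> (\<forall>s\<in>topspace unit_interval. H (1, s) = \<beta> s) \<and>
      (\<forall>t\<in>{0..1}. H (t, 0) = \<alpha> 0 \<and> H (t, 1) = \<alpha> 1)"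
  have "(\<exists>H. ?Q H) \<longleftrightarrow> (\<exists>h. ?P h)" if b: "\<beta> \<in> paths X"
  proof
    assume "\<exists>H. ?Q H"
    then obtain H where H: "?Q H" by blast
    \<comment> \<open>Restricting each stage to \<open>{0..1}\<close> makes the first and last stage
      equal to \<alpha> and \<beta> as functions, because members of \<open>paths X\<close> are
      extensional.\<close>
    have "continuous_map unit_interval (path_space X) (\<lambda>t. restrict (\<lambda>s. H (t, s)) {0..1})"
      by (rule continuous_map_curry_path) (use H in \<open>simp add: case_prod_unfold\<close>)
    moreover have "restrict (\<lambda>s. H (0, s)) {0..1} = \<alpha>" "restrict (\<lambda>s. H (1, s)) {0..1} = \<beta>"
      using H assms b by (auto simp: topspace_path_space maps_def extensional_def fun_eq_iff restrict_def)
    ultimately show "\<exists>h. ?P h" using H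
      by (intro exI[of _ "\<lambda>t. restrict (\<lambda>s. H (t, s)) {0..1}"]) auto
  next
    assume "\<exists>h. ?P h"
    then obtain h where h: "?P h" by blast
    have "continuous_map (prod_topology unit_interval unit_interval) X (\<lambda>w. h (fst w) (snd w))"
      by (rule continuous_map_eval_path[OF continuous_map_compose[OF continuous_map_fst, unfolded o_def]
            continuous_map_snd]) (use h in blast)
    then show "\<exists>H. ?Q H"
      using h by (intro exI[of _ "\<lambda>w. h (fst w) (snd w)"]) simp
  qed
  then show ?thesis
    unfolding path_class_def by (subst homotopic_with) (auto simp: atLeastAtMost_iff)
qed

lemma path_class_self: "\<alpha> \<in> paths X \<Longrightarrow> \<alpha> \<in> path_class X \<alpha>"
  unfolding path_class_iff by (auto intro!: exI[of _ "\<lambda>_. \<alpha>"])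

lemma path_classD:
  assumes "\<beta> \<in> path_class X \<alpha>"
  shows "\<beta> \<in> paths X" "\<beta> 0 = \<alpha> 0" "\<beta> 1 = \<alpha> 1"
proof -
  obtain h where "\<forall>x. h (1, x) = \<beta> x" "\<forall>t\<in>{0..1::real}. h (t, 0) = \<alpha> 0 \<and> h (t, 1) = \<alpha> 1"
    using assms by (auto simp: path_class_def homotopic_with_def)
  then show "\<beta> 0 = \<alpha> 0" "\<beta> 1 = \<alpha> 1" by (metis atLeastAtMost_iff zero_le_one order_refl)+
qed (use assms in \<open>simp add: path_class_def\<close>)

lemma path_class_eq_iff:
  assumes "\<alpha> \<in> paths X" "\<beta> \<in> paths X"
  shows "path_class X \<alpha> = path_class X \<beta> \<longleftrightarrow> \<beta> \<in> path_class X \<alpha>"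
proof
  assume b: "\<beta> \<in> path_class X \<alpha>"
  have e: "\<alpha> 0 = \<beta> 0" "\<alpha> 1 = \<beta> 1" using path_classD[OF b] by auto
  from b have h: "homotopic_with (\<lambda>\<gamma>. \<gamma> 0 = \<beta> 0 \<and> \<gamma> 1 = \<beta> 1) unit_interval X \<alpha> \<beta>"
    by (simp add: path_class_def e)
  then have "homotopic_with (\<lambda>\<gamma>. \<gamma> 0 = \<beta> 0 \<and> \<gamma> 1 = \<beta> 1) unit_interval X \<beta> \<alpha>"
    by (simp add: homotopic_with_sym)
  then show "path_class X \<alpha> = path_class X \<beta>"
    using h by (auto simp: path_class_def e intro: homotopic_with_trans)
qed (use path_class_self[OF assms(2)] in simp)

lemma path_class_eq_ends:
  assumes "path_class X \<alpha> = path_class X \<beta>" "\<alpha> \<in> paths X"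
  shows "\<alpha> 0 = \<beta> 0" "\<alpha> 1 = \<beta> 1"
  using path_classD[of \<alpha> X \<beta>] path_class_self[of \<alpha> X] assms by auto

lemma path_class_eqI:
  assumes h: "continuous_map unit_interval (path_space X) h"
    and e: "\<And>t. t \<in> {0..1} \<Longrightarrow> h t 0 = x" "\<And>t. t \<in> {0..1} \<Longrightarrow> h t 1 = y"
  shows "path_class X (h 0) = path_class X (h 1)"
proof -
  have t: "h t \<in> paths X" if "t \<in> {0..1}" for t
    using continuous_map_in_topspace[OF h] that by simp
  then show ?thesis
    by (subst path_class_eq_iff) (use h e in \<open>auto simp: path_class_iff\<close>)
qed

lemma path_class_eqE:
  assumes "path_class X \<alpha> = path_class X \<beta>" "\<alpha> \<in> paths X" "\<beta> \<in> paths X"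
  obtains h where "continuous_map unit_interval (path_space X) h" "h 0 = \<alpha>" "h 1 = \<beta>"
    "\<And>t. t \<in> {0..1} \<Longrightarrow> h t 0 = \<alpha> 0" "\<And>t. t \<in> {0..1} \<Longrightarrow> h t 1 = \<alpha> 1"
proof -
  have "\<beta> \<in> path_class X \<alpha>" using assms by (simp add: path_class_eq_iff)
  then obtain h where "continuous_map unit_interval (path_space X) h" "h 0 = \<alpha>" "h 1 = \<beta>"
    "\<forall>t\<in>{0..1}. h t 0 = \<alpha> 0 \<and> h t 1 = \<alpha> 1"
    unfolding path_class_iff[OF assms(2)] by blast
  then show thesis using that[of h] by blast
qed

text \<open>A continuous operation on paths with fixed ends carries a homotopy, seen as a path of
  paths, to a homotopy. This one device shows that concatenation and induced maps are well defined
  on classes.\<close>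

lemma path_class_map_eq:
  assumes c: "path_class X \<alpha> = path_class X \<beta>" and a: "\<alpha> \<in> paths X"
    and b: "\<beta> \<in> paths X"
    and P: "continuous_map (path_space_between X (\<alpha> 0) (\<alpha> 1)) (path_space Z) \<Phi>"
    and e: "\<And>\<gamma>. \<gamma> \<in> topspace (path_space_between X (\<alpha> 0) (\<alpha> 1)) \<Longrightarrow> \<Phi> \<gamma> 0 = u \<and> \<Phi> \<gamma> 1 = v"
  shows "path_class Z (\<Phi> \<alpha>) = path_class Z (\<Phi> \<beta>)"
proof -
  obtain h where h: "continuous_map unit_interval (path_space X) h" "h 0 = \<alpha>" "h 1 = \<beta>"
    "\<And>t. t \<in> {0..1} \<Longrightarrow> h t 0 = \<alpha> 0" "\<And>t. t \<in> {0..1} \<Longrightarrow> h t 1 = \<alpha> 1"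
    using path_class_eqE[OF c a b] by metis
  have h': "continuous_map unit_interval (path_space_between X (\<alpha> 0) (\<alpha> 1)) h"
    unfolding path_space_between_def using h by (auto simp: continuous_map_in_subtopology)
  have "path_class Z ((\<Phi> \<circ> h) 0) = path_class Z ((\<Phi> \<circ> h) 1)"
    by (rule path_class_eqI[OF continuous_map_compose[OF h' P], of u v])
      (use e continuous_map_in_topspace[OF h'] in auto)
  then show ?thesis by (simp add: h)
qed

lemma continuous_map_path_space_between:
  "continuous_map Z (path_space_between X x y) a \<longleftrightarrow>
    continuous_map Z (path_space X) a \<and> (\<forall>z\<in>topspace Z. a z 0 = x \<and> a z 1 = y)"
  by (auto simp: path_space_between_def continuous_map_in_subtopology)

lemma continuous_map_path_space_from:
  "continuous_map Z (path_space_from X x) a \<longleftrightarrow>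
    continuous_map Z (path_space X) a \<and> (\<forall>z\<in>topspace Z. a z 0 = x)"
  by (auto simp: path_space_from_def continuous_map_in_subtopology)

lemma topspace_path_space_from:
  "topspace (path_space_from X x) = {\<alpha> \<in> paths X. \<alpha> 0 = x}"
  by (auto simp: path_space_from_def)

lemma continuous_map_id_path_space_between:
  "continuous_map (path_space_between X x y) (path_space X) (\<lambda>\<alpha>. \<alpha>)"
  unfolding path_space_between_def by (intro continuous_map_from_subtopology continuous_map_id[unfolded id_def])

lemma continuous_map_id_path_space_from:
  "continuous_map (path_space_from X x) (path_space X) (\<lambda>\<alpha>. \<alpha>)"
  unfolding path_space_from_def by (intro continuous_map_from_subtopology continuous_map_id[unfolded id_def])

lemma continuous_map_constant: "c \<in> topspace Y \<Longrightarrow> continuous_map Z Y (\<lambda>_. c)"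
  by simp

text \<open>One factor is replaced at a time, so that only an operation in a single path variable
  has to be continuous.\<close>

lemma path_class_concat_cong:
  assumes a: "path_class X \<alpha> = path_class X \<alpha>'" "\<alpha> \<in> paths X" "\<alpha>' \<in> paths X"
    and b: "path_class X \<beta> = path_class X \<beta>'" "\<beta> \<in> paths X" "\<beta>' \<in> paths X"
    and ab: "\<alpha> 1 = \<beta> 0"
  shows "path_class X (path_concat \<alpha> \<beta>) = path_class X (path_concat \<alpha>' \<beta>')"
proof -
  have e: "\<alpha>' 1 = \<alpha> 1" using path_class_eq_ends[OF a(1,2)] by simp
  have "path_class X (path_concat \<alpha> \<beta>) = path_class X (path_concat \<alpha>' \<beta>)"
    using a(1-3)
  proof (rule path_class_map_eq[where \<Phi> = "\<lambda>\<gamma>. path_concat \<gamma> \<beta>"])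
    show "continuous_map (path_space_between X (\<alpha> 0) (\<alpha> 1)) (path_space X) (\<lambda>\<gamma>. path_concat \<gamma> \<beta>)"
      by (rule continuous_map_path_concat[OF continuous_map_id_path_space_between])
        (use b ab in \<open>auto simp: topspace_path_space_between\<close>)
  qed (auto simp: topspace_path_space_between)
  also have "\<dots> = path_class X (path_concat \<alpha>' \<beta>')"
    using b(1-3)
  proof (rule path_class_map_eq[where \<Phi> = "\<lambda>\<gamma>. path_concat \<alpha>' \<gamma>"])
    show "continuous_map (path_space_between X (\<beta> 0) (\<beta> 1)) (path_space X) (\<lambda>\<gamma>. path_concat \<alpha>' \<gamma>)"
      by (rule continuous_map_path_concat[OF _ continuous_map_id_path_space_between])
        (use a ab e in \<open>auto simp: topspace_path_space_between\<close>)
  qed (auto simp: topspace_path_space_between)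
  finally show ?thesis .
qed

text \<open>The straight-line homotopy from \<open>f\<close> to \<open>g\<close> stays in the
  interval by convexity and keeps the ends. Associativity, units and inverses are all
  instances.\<close>

lemma path_class_reparam:
  assumes a: "\<alpha> \<in> paths X"
    and f: "continuous_on {0..1} f" "f ` {0..1} \<subseteq> {0..1::real}"
    and g: "continuous_on {0..1} g" "g ` {0..1} \<subseteq> {0..1::real}"
    and e: "f 0 = g 0" "f 1 = g 1"
  shows "path_class X (\<lambda>t\<in>{0..1}. \<alpha> (f t)) = path_class X (\<lambda>t\<in>{0..1}. \<alpha> (g t))"
proof -
  let ?H = "\<lambda>s t. (1 - s) * f t + s * g t"
  have c: "continuous_map unit_interval (path_space X) (\<lambda>s. \<lambda>t\<in>{0..1}. \<alpha> (?H s t))"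
  proof (rule continuous_map_reparam)
    have "continuous_on ({0..1} \<times> {0..1}) (\<lambda>w. ?H (fst w) (snd w))"
      by (intro continuous_intros continuous_on_compose2[OF f(1)] continuous_on_compose2[OF g(1)]) auto
    moreover have "0 \<le> ?H s t \<and> ?H s t \<le> 1" if "s \<in> {0..1}" "t \<in> {0..1}" for s t
    proof -
      have "f t \<in> {0..1}" "g t \<in> {0..1}" using f(2) g(2) that by blast+
      then have "?H s t \<in> {0..1}"
        using convexD[OF convex_real_interval(5)[of 0 1], of "f t" "g t" "1 - s" s] that by auto
      then show ?thesis by auto
    qed
    moreover have "prod_topology unit_interval unit_interval = top_of_set ({0..1} \<times> {0..1})"
      by (simp add: subtopology_Times)
    ultimately show "continuous_map (prod_topology unit_interval unit_interval) unit_interval (\<lambda>(s, t). ?H s t)"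
      unfolding continuous_map_unit_interval by (simp add: case_prod_unfold)
  qed (use a in simp)
  have "path_class X (\<lambda>t\<in>{0..1}. \<alpha> (?H 0 t)) = path_class X (\<lambda>t\<in>{0..1}. \<alpha> (?H 1 t))"
    by (rule path_class_eqI[OF c, of "\<alpha> (f 0)" "\<alpha> (f 1)"]) (simp_all add: e algebra_simps)
  then show ?thesis by simp
qed

section \<open>Groupoid laws up to homotopy\<close>

lemma path_restrict: "\<alpha> \<in> paths X \<Longrightarrow> restrict \<alpha> {0..1} = \<alpha>"
  by (simp add: topspace_path_space maps_def extensional_restrict)

lemma path_class_assoc:
  assumes "\<alpha> \<in> paths X" "\<beta> \<in> paths X" "\<gamma> \<in> paths X"
    "\<alpha> 1 = \<beta> 0" "\<beta> 1 = \<gamma> 0"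
  shows "path_class X (path_concat (path_concat \<alpha> \<beta>) \<gamma>) = path_class X (path_concat \<alpha> (path_concat \<beta> \<gamma>))"
proof -
  \<comment> \<open>The piecewise linear change of parameter from the subdivision 1/4, 1/2 of the
    left bracketing to the subdivision 1/2, 3/4 of the right one. Its slopes 2, 1, 1/2 decrease, so
    it is the minimum of its three affine pieces.\<close>
  let ?f = "\<lambda>t::real. min (2 * t) (min (t + 1 / 4) ((t + 1) / 2))"
  let ?d = "path_concat \<alpha> (path_concat \<beta> \<gamma>)"
  have "path_class X (\<lambda>t\<in>{0..1}. ?d (?f t)) = path_class X (\<lambda>t\<in>{0..1}. ?d t)"
    by (rule path_class_reparam)
      (use assms in \<open>auto intro!: path_concat_in continuous_intros simp: min_le_iff_disj\<close>)
  moreover have "(\<lambda>t\<in>{0..1}. ?d (?f t)) = path_concat (path_concat \<alpha> \<beta>) \<gamma>"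
  proof
    fix t :: real
    consider "t < 0 \<or> t > 1" | "0 \<le> t" "t \<le> 1 / 4" | "1 / 4 < t" "t \<le> 1 / 2" | "1 / 2 < t" "t \<le> 1" by linarith
    then show "(\<lambda>t\<in>{0..1}. ?d (?f t)) t = path_concat (path_concat \<alpha> \<beta>) \<gamma> t"
    proof cases
      case 2
      then have "?f t = 2 * t" by (simp add: min_def)
      then show ?thesis using 2 by (simp add: path_concat_def)
    next
      case 3
      then have "?f t = t + 1 / 4" by (simp add: min_def)
      then show ?thesis using 3 by (simp add: path_concat_def algebra_simps)
    next
      case 4
      then have "?f t = (t + 1) / 2" by (simp add: min_def)
      then show ?thesis using 4 by (simp add: path_concat_def add_divide_distrib algebra_simps)
    qed (auto simp: path_concat_def)
  qed
  moreover have "(\<lambda>t\<in>{0..1}. ?d t) = ?d" by (simp add: path_concat_def fun_eq_iff)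
  ultimately show ?thesis by simp
qed

text \<open>Waiting at an end is a reparametrization: \<open>max 0 (2 * t - 1)\<close> rests at 0
  during the first half, \<open>min 1 (2 * t)\<close> rests at 1 during the second.\<close>

lemma path_class_const_concat:
  assumes a: "\<alpha> \<in> paths X"
  shows "path_class X (path_concat (path_const (\<alpha> 0)) \<alpha>) = path_class X \<alpha>"
    and "path_class X (path_concat \<alpha> (path_const (\<alpha> 1))) = path_class X \<alpha>"
proof -
  have "path_class X (\<lambda>t\<in>{0..1}. \<alpha> (max 0 (2 * t - 1))) = path_class X (\<lambda>t\<in>{0..1}. \<alpha> t)"
    by (rule path_class_reparam[OF a]) (auto intro!: continuous_intros)
  moreover have "(\<lambda>t\<in>{0..1}. \<alpha> (max 0 (2 * t - 1))) = path_concat (path_const (\<alpha> 0)) \<alpha>"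
    by (auto simp: path_concat_def path_const_def fun_eq_iff max_absorb1 max_absorb2)
  ultimately show "path_class X (path_concat (path_const (\<alpha> 0)) \<alpha>) = path_class X \<alpha>"
    using path_restrict[OF a] by simp
  have "path_class X (\<lambda>t\<in>{0..1}. \<alpha> (min 1 (2 * t))) = path_class X (\<lambda>t\<in>{0..1}. \<alpha> t)"
    by (rule path_class_reparam[OF a]) (auto intro!: continuous_intros)
  moreover have "(\<lambda>t\<in>{0..1}. \<alpha> (min 1 (2 * t))) = path_concat \<alpha> (path_const (\<alpha> 1))"
    by (auto simp: path_concat_def path_const_def fun_eq_iff min_absorb1 min_absorb2)
  ultimately show "path_class X (path_concat \<alpha> (path_const (\<alpha> 1))) = path_class X \<alpha>"
    using path_restrict[OF a] by simp
qed

text \<open>Going there and back is the reparametrization \<open>min (2 * t) (2 - 2 * t)\<close>,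
  which has the same ends as the constant reparametrization 0.\<close>

lemma path_class_concat_reverse:
  assumes a: "\<alpha> \<in> paths X"
  shows "path_class X (path_concat \<alpha> (path_reverse \<alpha>)) = path_class X (path_const (\<alpha> 0))"
proof -
  have "path_class X (\<lambda>t\<in>{0..1}. \<alpha> (min (2 * t) (2 - 2 * t))) = path_class X (\<lambda>t\<in>{0..1}. \<alpha> 0)"
    by (rule path_class_reparam[OF a]) (auto intro!: continuous_intros simp: min_le_iff_disj)
  moreover have "(\<lambda>t\<in>{0..1}. \<alpha> (min (2 * t) (2 - 2 * t))) = path_concat \<alpha> (path_reverse \<alpha>)"
    by (auto simp: path_concat_def path_reverse_def fun_eq_iff min_absorb1 min_absorb2 algebra_simps)
  ultimately show ?thesis by (simp add: path_const_def)
qed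

lemma path_reverse_reverse: "\<alpha> \<in> paths X \<Longrightarrow> path_reverse (path_reverse \<alpha>) = \<alpha>"
  by (rule path_eqI[of _ X]) (auto intro: path_reverse_in, simp add: path_reverse_def)

lemma path_class_reverse_concat:
  assumes a: "\<alpha> \<in> paths X"
  shows "path_class X (path_concat (path_reverse \<alpha>) \<alpha>) = path_class X (path_const (\<alpha> 1))"
  using path_class_concat_reverse[OF path_reverse_in[OF a]] path_reverse_reverse[OF a] by simp

lemma compose_path_concat:
  "compose {0..1} p (path_concat \<alpha> \<beta>) = path_concat (compose {0..1} p \<alpha>) (compose {0..1} p \<beta>)"
  by (auto simp: compose_def path_concat_def fun_eq_iff)

lemma compose_path_reverse: "compose {0..1} p (path_reverse \<alpha>) = path_reverse (compose {0..1} p \<alpha>)"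
  by (auto simp: compose_def path_reverse_def fun_eq_iff)

lemma compose_path_const: "compose {0..1} p (path_const x) = path_const (p x)"
  by (auto simp: compose_def path_const_def fun_eq_iff)

lemma compose_ends [simp]: "compose {0..1} p \<alpha> (0::real) = p (\<alpha> 0)" "compose {0..1} p \<alpha> (1::real) = p (\<alpha> 1)"
  by (simp_all add: compose_def)


section \<open>The fundamental groupoid\<close>

abbreviation FG :: "'a topology \<Rightarrow> ('a, (real \<Rightarrow> 'a) set) cat" where "FG \<equiv> fundamental_groupoid"

lemma FG_Obj: "Obj (FG X) = topspace X"
  and FG_Arr: "Arr (FG X) = path_class X ` paths X"
  by (simp_all add: fundamental_groupoid_def)

lemma FG_path_in_Arr: "\<alpha> \<in> paths X \<Longrightarrow> path_class X \<alpha> \<in> Arr (FG X)"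
  by (simp add: FG_Arr)

lemma FG_ends:
  assumes a: "\<alpha> \<in> paths X"
  shows "Dom (FG X) (path_class X \<alpha>) = \<alpha> 0" "Cod (FG X) (path_class X \<alpha>) = \<alpha> 1"
proof -
  have the: "(THE x. \<forall>\<beta>\<in>path_class X \<alpha>. \<beta> e = x) = \<alpha> e"
    if "\<And>\<beta>. \<beta> \<in> path_class X \<alpha> \<Longrightarrow> \<beta> e = \<alpha> e" for e
    by (rule the_equality) (use path_class_self[OF a] that in metis)+
  have "(THE x. \<forall>\<beta>\<in>path_class X \<alpha>. \<beta> 0 = x) = \<alpha> 0" "(THE x. \<forall>\<beta>\<in>path_class X \<alpha>. \<beta> 1 = x) = \<alpha> 1"
    by (rule the[OF path_classD(2)], assumption) (rule the[OF path_classD(3)])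
  then show "Dom (FG X) (path_class X \<alpha>) = \<alpha> 0" "Cod (FG X) (path_class X \<alpha>) = \<alpha> 1"
    by (simp_all add: fundamental_groupoid_def)
qed

lemma FG_Ident: "Ident (FG X) x = path_class X (path_const x)"
  by (simp add: fundamental_groupoid_def path_const_def)

text \<open>The union over representatives in the definition of composition collapses: all its
  members coincide, and the index classes are nonempty.\<close>

lemma FG_Comp:
  assumes a: "\<alpha> \<in> paths X" and b: "\<beta> \<in> paths X" and ab: "\<alpha> 1 = \<beta> 0"
  shows "Comp (FG X) (path_class X \<alpha>) (path_class X \<beta>) = path_class X (path_concat \<alpha> \<beta>)"
proof -
  have "path_class X (path_concat \<alpha>' \<beta>') = path_class X (path_concat \<alpha> \<beta>)"
    if a': "\<alpha>' \<in> path_class X \<alpha>" and b': "\<beta>' \<in> path_class X \<beta>" for \<alpha>' \<beta>'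
  proof (rule path_class_concat_cong[symmetric])
    show "path_class X \<alpha> = path_class X \<alpha>'"
      using path_class_eq_iff[OF a path_classD(1)[OF a']] a' by simp
    show "path_class X \<beta> = path_class X \<beta>'"
      using path_class_eq_iff[OF b path_classD(1)[OF b']] b' by simp
  qed (use path_classD(1)[OF a'] path_classD(1)[OF b'] a b ab in auto)
  then have "(\<Union>\<alpha>'\<in>path_class X \<alpha>. \<Union>\<beta>'\<in>path_class X \<beta>. path_class X (path_concat \<alpha>' \<beta>')) =
      (\<Union>\<alpha>'\<in>path_class X \<alpha>. \<Union>\<beta>'\<in>path_class X \<beta>. path_class X (path_concat \<alpha> \<beta>))"
    by (intro SUP_cong refl)
  moreover have "path_class X \<alpha> \<noteq> {}" "path_class X \<beta> \<noteq> {}"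
    using path_class_self a b by blast+
  ultimately show ?thesis by (simp add: fundamental_groupoid_def)
qed

lemma FG_homset: "homset (FG X) x y = path_class X ` topspace (path_space_between X x y)"
  by (auto simp: homset_def FG_Arr FG_ends topspace_path_space_between)

lemma FG_ArrE:
  assumes "c \<in> Arr (FG X)"
  obtains \<alpha> where "\<alpha> \<in> paths X" "c = path_class X \<alpha>"
  using assms by (auto simp: FG_Arr)

lemma groupoid_FG: "groupoid (FG X)"
proof -
  have cat: "category (FG X)"
    unfolding category_def
  proof (intro conjI ballI impI)
    fix f assume "f \<in> Arr (FG X)"
    then obtain \<alpha> where a: "\<alpha> \<in> paths X" "f = path_class X \<alpha>" by (rule FG_ArrE)
    have x: "\<alpha> 0 \<in> topspace X" "\<alpha> 1 \<in> topspace X" using path_in_topspace[OF a(1)] by auto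
    show "Dom (FG X) f \<in> Obj (FG X)" "Cod (FG X) f \<in> Obj (FG X)"
      using a x by (simp_all add: FG_ends FG_Obj)
    show "Comp (FG X) (Ident (FG X) (Dom (FG X) f)) f = f" "Comp (FG X) f (Ident (FG X) (Cod (FG X) f)) = f"
      using a x by (simp_all add: FG_ends FG_Ident FG_Comp path_const_in path_class_const_concat)
    fix g assume "g \<in> Arr (FG X)"
    then obtain \<beta> where b: "\<beta> \<in> paths X" "g = path_class X \<beta>" by (rule FG_ArrE)
    show "Comp (FG X) f g \<in> homset (FG X) (Dom (FG X) f) (Cod (FG X) g)" if "Cod (FG X) f = Dom (FG X) g"
      using that a b by (auto simp: FG_ends FG_Comp homset_def path_concat_in FG_path_in_Arr)
    fix h assume "h \<in> Arr (FG X)"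
    then obtain \<gamma> where c: "\<gamma> \<in> paths X" "h = path_class X \<gamma>" by (rule FG_ArrE)
    show "Comp (FG X) (Comp (FG X) f g) h = Comp (FG X) f (Comp (FG X) g h)"
      if "Cod (FG X) f = Dom (FG X) g \<and> Cod (FG X) g = Dom (FG X) h"
      using that a b c by (simp add: FG_ends FG_Comp path_concat_in path_class_assoc)
  next
    fix x assume "x \<in> Obj (FG X)"
    then show "Ident (FG X) x \<in> homset (FG X) x x"
      by (simp add: FG_Obj FG_Ident homset_def FG_ends path_const_in FG_path_in_Arr)
  qed
  have "isomorphism (FG X) g" if "g \<in> Arr (FG X)" for g
  proof -
    from that obtain \<alpha> where a: "\<alpha> \<in> paths X" "g = path_class X \<alpha>" by (rule FG_ArrE)
    have "inverse_arrows (FG X) g (path_class X (path_reverse \<alpha>))"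
      using a by (simp add: inverse_arrows_def FG_path_in_Arr homset_def FG_ends path_reverse_in FG_Comp
          FG_Ident path_class_concat_reverse path_class_reverse_concat)
    then show ?thesis by (auto simp: isomorphism_def)
  qed
  with cat show ?thesis by (simp add: groupoid_def)
qed

lemma induced_class_map_class:
  assumes p: "continuous_map Y X p" and a: "\<alpha> \<in> paths Y"
  shows "induced_class_map Y X p (path_class Y \<alpha>) = path_class X (compose {0..1} p \<alpha>)"
proof -
  have "path_class X (compose {0..1} p \<beta>) = path_class X (compose {0..1} p \<alpha>)" if "\<beta> \<in> path_class Y \<alpha>" for \<beta>
  proof (rule path_class_map_eq[symmetric, where \<Phi> = "compose {0..1} p" and \<alpha> = \<alpha> and \<beta> = \<beta>])
    show b: "\<beta> \<in> paths Y" by (rule path_classD(1)[OF that])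
    show "path_class Y \<alpha> = path_class Y \<beta>" using path_class_eq_iff[OF a b] that by simp
    show "continuous_map (path_space_between Y (\<alpha> 0) (\<alpha> 1)) (path_space X) (compose {0..1} p)"
      unfolding path_space_between_def by (intro continuous_map_from_subtopology continuous_map_path_compose p)
  qed (use a in \<open>auto simp: topspace_path_space_between\<close>)
  then have "(\<Union>\<beta>\<in>path_class Y \<alpha>. path_class X (compose {0..1} p \<beta>)) =
      (\<Union>\<beta>\<in>path_class Y \<alpha>. path_class X (compose {0..1} p \<alpha>))"
    by (intro SUP_cong refl)
  moreover have "path_class Y \<alpha> \<noteq> {}" using path_class_self[OF a] by blast
  ultimately show ?thesis using a by (simp add: induced_class_map_def FG_path_in_Arr)
qed

lemma is_functor_FG:
  assumes p: "continuous_map Y X p"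
  shows "is_functor (FG Y) (FG X) p (induced_class_map Y X p)"
  unfolding is_functor_def
proof (intro conjI ballI impI)
  show "category (FG Y)" "category (FG X)" using groupoid_FG by (auto simp: groupoid_def)
  fix f assume "f \<in> Arr (FG Y)"
  then obtain \<alpha> where a: "\<alpha> \<in> paths Y" "f = path_class Y \<alpha>" by (rule FG_ArrE)
  show "induced_class_map Y X p f \<in> homset (FG X) (p (Dom (FG Y) f)) (p (Cod (FG Y) f))"
    using a p by (simp add: induced_class_map_class homset_def path_compose_in FG_path_in_Arr FG_ends)
  fix g assume "g \<in> Arr (FG Y)" and fg: "Cod (FG Y) f = Dom (FG Y) g"
  from \<open>g \<in> Arr (FG Y)\<close> obtain \<beta> where b: "\<beta> \<in> paths Y" "g = path_class Y \<beta>" by (rule FG_ArrE)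
  show "induced_class_map Y X p (Comp (FG Y) f g) =
      Comp (FG X) (induced_class_map Y X p f) (induced_class_map Y X p g)"
    using a b p fg by (simp add: induced_class_map_class FG_Comp FG_ends path_compose_in path_concat_in
        compose_path_concat)
qed (use p in \<open>auto simp: FG_Obj FG_Ident induced_class_map_class path_const_in compose_path_const
      continuous_map_def\<close>)

section \<open>The group reflection of a group with topology\<close>

lemma openin_prod_topologyE:
  assumes "openin (prod_topology X Y) S" "(x, y) \<in> S"
  obtains U V where "openin X U" "openin Y V" "x \<in> U" "y \<in> V" "\<And>u v. u \<in> U \<Longrightarrow> v \<in> V \<Longrightarrow> (u, v) \<in> S"
proof -
  have "\<exists>U V. openin X U \<and> openin Y V \<and> x \<in> U \<and> y \<in> V \<and> U \<times> V \<subseteq> S"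
    using assms(1)[unfolded openin_prod_topology_alt, rule_format, OF assms(2)] .
  then obtain U V where *: "openin X U" "openin Y V" "x \<in> U" "y \<in> V" "U \<times> V \<subseteq> S" by (elim exE conjE)
  show thesis by (rule that[OF *(1-4)]) (use *(5) in blast)
qed

text \<open>A product of quotient maps need not be a quotient map, but a product of open maps is
  open. This is how multiplication descends to the reflected group.\<close>

lemma open_map_prod_map:
  assumes f: "open_map X X' f" and g: "open_map Y Y' g"
  shows "open_map (prod_topology X Y) (prod_topology X' Y') (\<lambda>(x, y). (f x, g y))"
  unfolding open_map_def
proof (intro allI impI)
  fix U assume U: "openin (prod_topology X Y) U"
  show "openin (prod_topology X' Y') ((\<lambda>(x, y). (f x, g y)) ` U)"
  proof (subst openin_subopen, rule ballI)
    fix w assume "w \<in> (\<lambda>(x, y). (f x, g y)) ` U"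
    then obtain x y where xy: "(x, y) \<in> U" "w = (f x, g y)" by auto
    show "\<exists>T. openin (prod_topology X' Y') T \<and> w \<in> T \<and> T \<subseteq> (\<lambda>(x, y). (f x, g y)) ` U"
    proof (rule openin_prod_topologyE[OF U xy(1)])
      fix V W assume VW: "openin X V" "openin Y W" "x \<in> V" "y \<in> W" "\<And>u v. u \<in> V \<Longrightarrow> v \<in> W \<Longrightarrow> (u, v) \<in> U"
      have "openin (prod_topology X' Y') (f ` V \<times> g ` W)"
        using f g VW by (auto simp: open_map_def openin_prod_Times_iff)
      then show ?thesis using VW xy by (intro exI[of _ "f ` V \<times> g ` W"]) force
    qed
  qed
qed

lemma topspace_tau_topology:
  assumes G: "group G" and T: "topspace T = carrier G"
  shows "topspace (tau_topology G T) = carrier G"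
proof -
  have q: "quotient_map (markov_topology T) (tau_topology G T) (free_group_extension G (\<lambda>g. g))"
    unfolding tau_topology_def by (rule quotient_map_quotient_topology)
  have h: "free_group_extension G (\<lambda>g. g) \<in> hom (free_group (carrier G)) G"
    by (rule free_group_extension_hom[OF G]) simp
  have "g \<in> free_group_extension G (\<lambda>g. g) ` carrier (free_group (carrier G))" if "g \<in> carrier G" for g
  proof
    show "g = free_group_extension G (\<lambda>g. g) (free_generator g)"
      using free_group_extension_generator[OF G, of "\<lambda>g. g" g] that by simp
    show "free_generator g \<in> carrier (free_group (carrier G))"
      using that by (simp add: free_generator_def free_group_def)
  qed
  then have "free_group_extension G (\<lambda>g. g) ` carrier (free_group (carrier G)) = carrier G"
    using h by (auto simp: hom_def)
  then show ?thesis
    using quotient_imp_surjective_map[OF q] by (simp add: topspace_markov_topology T)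
qed

text \<open>Each element is the image of its own generator, so the identity factors through the
  insertion of generators into the free topological group.\<close>

lemma continuous_map_tau_unit:
  assumes G: "group G" and T: "topspace T = carrier G"
  shows "continuous_map T (tau_topology G T) (\<lambda>g. g)"
proof -
  have q: "continuous_map (markov_topology T) (tau_topology G T) (free_group_extension G (\<lambda>g. g))"
    unfolding tau_topology_def by (intro quotient_imp_continuous_map quotient_map_quotient_topology)
  show ?thesis
    by (rule continuous_map_eq[OF continuous_map_compose[OF continuous_map_free_generator q]])
      (use free_group_extension_generator[OF G, of "\<lambda>g. g"] T in simp)
qed

lemma continuous_map_translations:
  assumes G: "topological_group G T" and a: "a \<in> carrier G"
  shows "continuous_map T T (\<lambda>x. a \<otimes>\<^bsub>G\<^esub> x)" "continuous_map T T (\<lambda>x. x \<otimes>\<^bsub>G\<^esub> a)"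
proof -
  have T: "topspace T = carrier G" and m: "continuous_map (prod_topology T T) T (\<lambda>(g, h). g \<otimes>\<^bsub>G\<^esub> h)"
    using G by (auto simp: topological_group_def)
  have c: "continuous_map T T (\<lambda>x. a)" "continuous_map T T (\<lambda>x. x)" using a T by auto
  show "continuous_map T T (\<lambda>x. a \<otimes>\<^bsub>G\<^esub> x)" "continuous_map T T (\<lambda>x. x \<otimes>\<^bsub>G\<^esub> a)"
    using continuous_map_compose[OF continuous_map_pairedI[OF c] m]
      continuous_map_compose[OF continuous_map_pairedI[OF c(2,1)] m] by (simp_all add: o_def)
qed

lemma translation_open:
  assumes G: "group G" and T: "topspace T = carrier G"
    and c: "\<And>a. a \<in> carrier G \<Longrightarrow> continuous_map T T (\<lambda>x. a \<otimes>\<^bsub>G\<^esub> x)"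
    and U: "openin T U" and a: "a \<in> carrier G"
  shows "openin T ((\<lambda>x. a \<otimes>\<^bsub>G\<^esub> x) ` U)"
proof -
  interpret group G by fact
  have UG: "U \<subseteq> carrier G" using openin_subset[OF U] T by simp
  have "openin T {x \<in> topspace T. inv\<^bsub>G\<^esub> a \<otimes>\<^bsub>G\<^esub> x \<in> U}"
    by (rule openin_continuous_map_preimage[OF c U]) (use a in simp)
  also have "{x \<in> topspace T. inv\<^bsub>G\<^esub> a \<otimes>\<^bsub>G\<^esub> x \<in> U} = (\<lambda>x. a \<otimes>\<^bsub>G\<^esub> x) ` U"
  proof (intro equalityI subsetI)
    fix x assume x: "x \<in> {x \<in> topspace T. inv\<^bsub>G\<^esub> a \<otimes>\<^bsub>G\<^esub> x \<in> U}"
    then have "x = a \<otimes>\<^bsub>G\<^esub> (inv\<^bsub>G\<^esub> a \<otimes>\<^bsub>G\<^esub> x)" using a T by (simp add: m_assoc[symmetric])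
    then show "x \<in> (\<lambda>x. a \<otimes>\<^bsub>G\<^esub> x) ` U" using x by blast
  next
    fix x assume "x \<in> (\<lambda>x. a \<otimes>\<^bsub>G\<^esub> x) ` U"
    then show "x \<in> {x \<in> topspace T. inv\<^bsub>G\<^esub> a \<otimes>\<^bsub>G\<^esub> x \<in> U}"
      using UG a T by (auto simp: m_assoc[symmetric] subset_iff)
  qed
  finally show ?thesis .
qed

text \<open>The saturation of an open set is the union of its translates by kernel elements.\<close>

lemma open_map_tau:
  assumes G: "group G" and T: "topspace T = carrier G"
  shows "open_map (markov_topology T) (tau_topology G T) (free_group_extension G (\<lambda>g. g))"
  unfolding open_map_def
proof (intro allI impI)
  let ?M = "markov_topology T" and ?e = "free_group_extension G (\<lambda>g. g)" and ?F = "free_group (topspace T)"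
  fix V assume V: "openin ?M V"
  interpret G: group G by fact
  interpret F: group ?F by (rule group_free_group)
  have tF: "topological_group ?F ?M" by (rule topological_group_markov_topology)
  have M: "topspace ?M = carrier ?F" by (rule topspace_markov_topology)
  have h: "?e \<in> hom ?F G" by (rule free_group_extension_hom[OF G]) (simp add: T)
  interpret e: group_hom ?F G ?e using h by unfold_locales
  have VF: "V \<subseteq> carrier ?F" using openin_subset[OF V] M by simp
  have "{w \<in> topspace ?M. ?e w \<in> ?e ` V} = (\<Union>k\<in>{k \<in> carrier ?F. ?e k = \<one>\<^bsub>G\<^esub>}. (\<lambda>v. k \<otimes>\<^bsub>?F\<^esub> v) ` V)"
  proof (intro equalityI subsetI)
    fix w assume "w \<in> {w \<in> topspace ?M. ?e w \<in> ?e ` V}"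
    then obtain v where w: "w \<in> carrier ?F" and v: "v \<in> V" "?e w = ?e v" using M by auto
    then have vF: "v \<in> carrier ?F" using VF by auto
    have "?e (w \<otimes>\<^bsub>?F\<^esub> inv\<^bsub>?F\<^esub> v) = \<one>\<^bsub>G\<^esub>" using w vF v e.hom_closed by simp
    moreover have "w = (w \<otimes>\<^bsub>?F\<^esub> inv\<^bsub>?F\<^esub> v) \<otimes>\<^bsub>?F\<^esub> v" using w vF by (simp add: F.m_assoc)
    ultimately show "w \<in> (\<Union>k\<in>{k \<in> carrier ?F. ?e k = \<one>\<^bsub>G\<^esub>}. (\<lambda>v. k \<otimes>\<^bsub>?F\<^esub> v) ` V)"
      using w vF v by (intro UN_I[of "w \<otimes>\<^bsub>?F\<^esub> inv\<^bsub>?F\<^esub> v"]) auto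
  next
    fix w assume "w \<in> (\<Union>k\<in>{k \<in> carrier ?F. ?e k = \<one>\<^bsub>G\<^esub>}. (\<lambda>v. k \<otimes>\<^bsub>?F\<^esub> v) ` V)"
    then obtain k v where kv: "k \<in> carrier ?F" "?e k = \<one>\<^bsub>G\<^esub>" "v \<in> V" "w = k \<otimes>\<^bsub>?F\<^esub> v" by blast
    then have vF: "v \<in> carrier ?F" using VF by auto
    then have "?e w = ?e v" using kv by simp
    then show "w \<in> {w \<in> topspace ?M. ?e w \<in> ?e ` V}" using kv vF M by auto
  qed
  moreover have "openin ?M ((\<lambda>v. k \<otimes>\<^bsub>?F\<^esub> v) ` V)" if "k \<in> carrier ?F" for k
    by (rule translation_open[OF F.group_axioms M continuous_map_translations(1)[OF tF] V that])
  ultimately have "openin ?M {w \<in> topspace ?M. ?e w \<in> ?e ` V}" by auto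
  moreover have "?e ` V \<subseteq> ?e ` topspace ?M" using openin_subset[OF V] by blast
  ultimately show "openin (tau_topology G T) (?e ` V)"
    unfolding tau_topology_def openin_quotient_topology by blast
qed

text \<open>Since the evaluation of words is open, its square is again a quotient map, and the
  continuous multiplication of the free topological group descends along it. Inversion descends
  along the evaluation itself.\<close>

lemma topological_group_tau:
  assumes G: "group G" and T: "topspace T = carrier G"
  shows "topological_group G (tau_topology G T)"
proof -
  let ?M = "markov_topology T" and ?e = "free_group_extension G (\<lambda>g. g)" and ?F = "free_group (topspace T)"
  let ?S = "tau_topology G T"
  interpret G: group G by fact
  interpret F: group ?F by (rule group_free_group)
  have S: "topspace ?S = carrier G" by (rule topspace_tau_topology[OF G T])
  have M: "topspace ?M = carrier ?F" by (rule topspace_markov_topology)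
  have q: "quotient_map ?M ?S ?e"
    unfolding tau_topology_def by (rule quotient_map_quotient_topology)
  have c: "continuous_map ?M ?S ?e" using q by (rule quotient_imp_continuous_map)
  have h: "?e \<in> hom ?F G" by (rule free_group_extension_hom[OF G]) (simp add: T)
  interpret e: group_hom ?F G ?e using h by unfold_locales
  have mF: "continuous_map (prod_topology ?M ?M) ?M (\<lambda>(g, h). g \<otimes>\<^bsub>?F\<^esub> h)"
    and iF: "continuous_map ?M ?M (\<lambda>g. inv\<^bsub>?F\<^esub> g)"
    using topological_group_markov_topology[of T] by (simp_all add: topological_group_def)
  have surj: "?e ` topspace ?M = topspace ?S" by (rule quotient_imp_surjective_map[OF q])
  have q2: "quotient_map (prod_topology ?M ?M) (prod_topology ?S ?S) (\<lambda>(x, y). (?e x, ?e y))"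
  proof (rule continuous_open_imp_quotient_map)
    show "continuous_map (prod_topology ?M ?M) (prod_topology ?S ?S) (\<lambda>(x, y). (?e x, ?e y))"
      using c by (simp add: continuous_map_prod_top)
    show "open_map (prod_topology ?M ?M) (prod_topology ?S ?S) (\<lambda>(x, y). (?e x, ?e y))"
      by (intro open_map_prod_map open_map_tau G T)
    show "(\<lambda>(x, y). (?e x, ?e y)) ` topspace (prod_topology ?M ?M) = topspace (prod_topology ?S ?S)"
    proof -
      have "(\<lambda>(x, y). (?e x, ?e y)) ` (A \<times> B) = ?e ` A \<times> ?e ` B" for A B by auto
      then show ?thesis by (simp add: surj)
    qed
  qed
  have "continuous_map (prod_topology ?M ?M) ?S ((\<lambda>(g, h). g \<otimes>\<^bsub>G\<^esub> h) \<circ> (\<lambda>(x, y). (?e x, ?e y)))"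
    by (rule continuous_map_eq[OF continuous_map_compose[OF mF c]]) (auto simp: M)
  then have "continuous_map (prod_topology ?S ?S) ?S (\<lambda>(g, h). g \<otimes>\<^bsub>G\<^esub> h)"
    by (simp add: continuous_compose_quotient_map_eq[OF q2])
  moreover have "continuous_map ?M ?S ((\<lambda>g. inv\<^bsub>G\<^esub> g) \<circ> ?e)"
    by (rule continuous_map_eq[OF continuous_map_compose[OF iF c]]) (auto simp: M)
  then have "continuous_map ?S ?S (\<lambda>g. inv\<^bsub>G\<^esub> g)"
    by (simp add: continuous_compose_quotient_map_eq[OF q])
  ultimately show ?thesis by (simp add: topological_group_def G S)
qed

text \<open>The universal property of the reflection: composed with the evaluation of words,
  \<open>f\<close> becomes the homomorphic extension of \<open>f\<close> to the free group, which is
  continuous by the universal property of the Markov topology.\<close>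

lemma continuous_map_from_tau:
  assumes G: "group G" and T: "topspace T = carrier G" and K: "topological_group K S"
    and f: "f \<in> hom G K" and c: "continuous_map T S f"
  shows "continuous_map (tau_topology G T) S f"
proof -
  let ?M = "markov_topology T" and ?e = "free_group_extension G (\<lambda>g. g)"
  interpret G: group G by fact
  interpret K: group K using K by (simp add: topological_group_def)
  interpret f: group_hom G K f using f by unfold_locales
  have q: "quotient_map ?M (tau_topology G T) ?e"
    unfolding tau_topology_def by (rule quotient_map_quotient_topology)
  have "?e w \<in> carrier G \<and> f (?e w) = free_group_extension K f w" if "snd ` set w \<subseteq> carrier G" for w
    using that
  proof (induction w)
    case (Cons l w)
    then show ?case by (cases l) (auto simp: free_group_extension_def)
  qed (simp add: free_group_extension_def)
  then have "continuous_map ?M S (f \<circ> ?e)"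
    by (intro continuous_map_eq[OF markov_universal_property[OF K c]])
      (auto simp: topspace_markov_topology free_group_def T)
  then show ?thesis by (simp add: continuous_compose_quotient_map_eq[OF q])
qed

lemma continuous_map_tau_hom:
  assumes G: "group G" and T: "topspace T = carrier G" and K: "group K" and S: "topspace S = carrier K"
    and f: "f \<in> hom G K" and c: "continuous_map T S f"
  shows "continuous_map (tau_topology G T) (tau_topology K S) f"
  using continuous_map_compose[OF c continuous_map_tau_unit[OF K S]]
  by (intro continuous_map_from_tau[OF G T topological_group_tau[OF K S] f]) (simp add: o_def)

text \<open>The classical axioms for a neighbourhood base at the identity. Members of the base need
  not be open, so the last conclusion supplies an open set inside each of their translates.\<close>

lemma group_topology_from_base:
  fixes G (structure)
  assumes G: "group G" and ne: "\<B> \<noteq> {}" and one: "\<And>B. B \<in> \<B> \<Longrightarrow> \<one> \<in> B \<and> B \<subseteq> carrier G"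
    and int: "\<And>A B. \<lbrakk>A \<in> \<B>; B \<in> \<B>\<rbrakk> \<Longrightarrow> \<exists>C\<in>\<B>. C \<subseteq> A \<inter> B"
    and mult: "\<And>A. A \<in> \<B> \<Longrightarrow> \<exists>B\<in>\<B>. \<forall>x\<in>B. \<forall>y\<in>B. x \<otimes> y \<in> A"
    and inve: "\<And>A. A \<in> \<B> \<Longrightarrow> \<exists>B\<in>\<B>. \<forall>x\<in>B. inv x \<in> A"
    and conj: "\<And>A g. \<lbrakk>A \<in> \<B>; g \<in> carrier G\<rbrakk> \<Longrightarrow> \<exists>B\<in>\<B>. \<forall>x\<in>B. g \<otimes> x \<otimes> inv g \<in> A"
  obtains S where "topological_group G S"
    "\<And>U. openin S U \<longleftrightarrow> U \<subseteq> carrier G \<and> (\<forall>u\<in>U. \<exists>B\<in>\<B>. \<forall>x\<in>B. u \<otimes> x \<in> U)"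
    "\<And>u A. \<lbrakk>u \<in> carrier G; A \<in> \<B>\<rbrakk> \<Longrightarrow> \<exists>W. openin S W \<and> u \<in> W \<and> W \<subseteq> (\<lambda>x. u \<otimes> x) ` A"
proof -
  interpret group G by fact
  define P where "P U \<longleftrightarrow> U \<subseteq> carrier G \<and> (\<forall>u\<in>U. \<exists>B\<in>\<B>. \<forall>x\<in>B. u \<otimes> x \<in> U)" for U
  have "istopology P"
    unfolding istopology_def
  proof (intro conjI allI impI)
    fix U V assume U: "P U" and V: "P V"
    have "\<exists>C\<in>\<B>. \<forall>x\<in>C. u \<otimes> x \<in> U \<inter> V" if u: "u \<in> U \<inter> V" for u
    proof -
      obtain A B where "A \<in> \<B>" "\<forall>x\<in>A. u \<otimes> x \<in> U" "B \<in> \<B>" "\<forall>x\<in>B. u \<otimes> x \<in> V"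
        using U V u unfolding P_def by blast
      then show ?thesis using int[of A B] by blast
    qed
    then show "P (U \<inter> V)" using U by (auto simp: P_def)
  next
    fix K assume K: "\<forall>U\<in>K. P U"
    show "P (\<Union>K)" unfolding P_def
    proof (intro conjI ballI)
      show "\<Union>K \<subseteq> carrier G" using K by (auto simp: P_def)
      fix u assume "u \<in> \<Union>K"
      then obtain U where U: "U \<in> K" "u \<in> U" by blast
      then obtain B where "B \<in> \<B>" "\<forall>x\<in>B. u \<otimes> x \<in> U" using K unfolding P_def by blast
      then show "\<exists>B\<in>\<B>. \<forall>x\<in>B. u \<otimes> x \<in> \<Union>K" using U by blast
    qed
  qed
  then have S: "openin (topology P) = P" by (rule topology_inverse')
  have "P (carrier G)"
    using ne one by (fastforce simp: P_def)
  then have top: "topspace (topology P) = carrier G"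
    unfolding topspace_def S by (auto simp: P_def)
  have nbhd: "\<exists>W. P W \<and> u \<in> W \<and> W \<subseteq> (\<lambda>x. u \<otimes> x) ` A" if u: "u \<in> carrier G" and A: "A \<in> \<B>" for u A
  proof (intro exI conjI)
    let ?A = "(\<lambda>x. u \<otimes> x) ` A"
    \<comment> \<open>The interior of the translate: the points that some base set translates into
      it. It is open because \<open>C\<close> times \<open>C\<close> lies in \<open>B\<close> for a
      suitable base set \<open>C\<close>.\<close>
    let ?W = "{v \<in> carrier G. \<exists>B\<in>\<B>. \<forall>x\<in>B. v \<otimes> x \<in> ?A}"
    show "u \<in> ?W" using u A by blast
    show "?W \<subseteq> ?A"
    proof
      fix v assume "v \<in> ?W"
      then obtain B where "v \<in> carrier G" "B \<in> \<B>" "\<forall>x\<in>B. v \<otimes> x \<in> ?A" by blast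
      then show "v \<in> ?A" using one[of B] r_one[of v] by metis
    qed
    show "P ?W"
      unfolding P_def
    proof (intro conjI ballI)
      fix v assume "v \<in> ?W"
      then obtain B where v: "v \<in> carrier G" and B: "B \<in> \<B>" "\<forall>x\<in>B. v \<otimes> x \<in> ?A" by blast
      obtain C where C: "C \<in> \<B>" "\<forall>x\<in>C. \<forall>y\<in>C. x \<otimes> y \<in> B" using mult[OF B(1)] by blast
      have CG: "C \<subseteq> carrier G" using one[OF C(1)] by blast
      have "v \<otimes> x \<in> ?W" if x: "x \<in> C" for x
      proof -
        have "\<forall>y\<in>C. v \<otimes> x \<otimes> y \<in> ?A"
          using B C CG x v by (metis m_assoc subsetD)
        then show ?thesis using C(1) v x CG by blast
      qed
      then show "\<exists>B\<in>\<B>. \<forall>x\<in>B. v \<otimes> x \<in> ?W" using C by blast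
    qed blast
  qed
  have "topological_group G (topology P)"
    unfolding topological_group_def
  proof (intro conjI)
    show "group G" by (rule G)
    show "topspace (topology P) = carrier G" by (rule top)
    show "continuous_map (prod_topology (topology P) (topology P)) (topology P) (\<lambda>(g, h). g \<otimes> h)"
      unfolding continuous_map_def
    proof (intro conjI allI impI)
      fix U assume "openin (topology P) U"
      then have U: "P U" by (simp add: S)
      show "openin (prod_topology (topology P) (topology P))
          {w \<in> topspace (prod_topology (topology P) (topology P)). (\<lambda>(g, h). g \<otimes> h) w \<in> U}"
        unfolding openin_prod_topology_alt
      proof (intro allI impI)
        fix g h
        assume "(g, h) \<in> {w \<in> topspace (prod_topology (topology P) (topology P)). (\<lambda>(g, h). g \<otimes> h) w \<in> U}"
        then have g: "g \<in> carrier G" and h: "h \<in> carrier G" and gh: "g \<otimes> h \<in> U" by (auto simp: top)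
        obtain A where A: "A \<in> \<B>" "\<forall>x\<in>A. g \<otimes> h \<otimes> x \<in> U" using U gh unfolding P_def by blast
        obtain B where B: "B \<in> \<B>" "\<forall>x\<in>B. \<forall>y\<in>B. x \<otimes> y \<in> A" using mult[OF A(1)] by blast
        \<comment> \<open>Conjugation is needed to move the perturbation \<open>c\<close> of
          \<open>g\<close> past \<open>h\<close>: g c h d = g h (h^-1 c h) d.\<close>
        obtain C where C: "C \<in> \<B>" "\<forall>x\<in>C. inv h \<otimes> x \<otimes> inv (inv h) \<in> B"
          using conj[OF B(1), of "inv h"] h by auto
        obtain W1 where W1: "P W1" "g \<in> W1" "W1 \<subseteq> (\<lambda>x. g \<otimes> x) ` C" using nbhd[OF g C(1)] by blast
        obtain W2 where W2: "P W2" "h \<in> W2" "W2 \<subseteq> (\<lambda>x. h \<otimes> x) ` B" using nbhd[OF h B(1)] by blast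
        have "a \<otimes> b \<in> U" if a: "a \<in> W1" and b: "b \<in> W2" for a b
        proof -
          obtain c d where cd: "c \<in> C" "a = g \<otimes> c" "d \<in> B" "b = h \<otimes> d" using a b W1 W2 by blast
          have cdG: "c \<in> carrier G" "d \<in> carrier G" using cd one[OF C(1)] one[OF B(1)] by auto
          have "a \<otimes> b = g \<otimes> h \<otimes> ((inv h \<otimes> c \<otimes> h) \<otimes> d)"
          proof -
            have "h \<otimes> (inv h \<otimes> (c \<otimes> (h \<otimes> d))) = c \<otimes> (h \<otimes> d)"
              using h cdG by (simp add: m_assoc[symmetric])
            then show ?thesis using g h cdG by (simp add: cd m_assoc)
          qed
          moreover have "(inv h \<otimes> c \<otimes> h) \<otimes> d \<in> A" using B C cd h by auto
          ultimately show ?thesis using A by auto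
        qed
        then show "\<exists>V W. openin (topology P) V \<and> openin (topology P) W \<and> g \<in> V \<and> h \<in> W \<and> V \<times> W \<subseteq>
            {w \<in> topspace (prod_topology (topology P) (topology P)). (\<lambda>(g, h). g \<otimes> h) w \<in> U}"
          using W1 W2 by (intro exI[of _ W1] exI[of _ W2]) (auto simp: S top P_def)
      qed
    qed (auto simp: top)
    show "continuous_map (topology P) (topology P) (\<lambda>g. inv g)"
      unfolding continuous_map_def
    proof (intro conjI allI impI)
      fix U assume "openin (topology P) U"
      then have U: "P U" by (simp add: S)
      have "\<exists>B\<in>\<B>. \<forall>x\<in>B. g \<otimes> x \<in> {x \<in> carrier G. inv x \<in> U}" if g: "g \<in> carrier G" "inv g \<in> U" for g
      proof -
        obtain A where A: "A \<in> \<B>" "\<forall>x\<in>A. inv g \<otimes> x \<in> U" using U g unfolding P_def by blast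
        \<comment> \<open>The perturbation has to be moved to the right of the inverse: (g x)^-1 =
          g^-1 (g x^-1 g^-1).\<close>
        obtain B where B: "B \<in> \<B>" "\<forall>x\<in>B. g \<otimes> x \<otimes> inv g \<in> A" using conj[OF A(1), of g] g by auto
        obtain C where C: "C \<in> \<B>" "\<forall>x\<in>C. inv x \<in> B" using inve[OF B(1)] by blast
        have "inv (g \<otimes> x) \<in> U" if x: "x \<in> C" for x
        proof -
          have xG: "x \<in> carrier G" using x one[OF C(1)] by auto
          have "inv (g \<otimes> x) = inv g \<otimes> (g \<otimes> inv x \<otimes> inv g)"
            using g xG by (simp add: inv_mult_group m_assoc[symmetric])
          then show ?thesis using A B C x by auto
        qed
        then show ?thesis using C(1) one[OF C(1)] g by (intro bexI[of _ C]) auto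
      qed
      then have "P {x \<in> carrier G. inv x \<in> U}" by (auto simp: P_def)
      then show "openin (topology P) {x \<in> topspace (topology P). inv x \<in> U}"
        by (simp add: S top)
    qed (auto simp: top)
  qed
  then show thesis
    by (rule that) (use nbhd in \<open>simp_all add: S P_def\<close>)
qed

text \<open>The conjugates of the images of \<open>tau\<close>-open neighbourhoods generate a group topology on \<open>G'\<close>
  that is coarser than \<open>T'\<close>, hence coarser than the one of \<open>tau\<close>.\<close>

lemma open_map_tau_hom:
  assumes G: "group G" and T: "topspace T = carrier G" and G': "group G'" and T': "topspace T' = carrier G'"
    and l: "\<And>a. a \<in> carrier G' \<Longrightarrow> continuous_map T' T' (\<lambda>x. a \<otimes>\<^bsub>G'\<^esub> x)"
    and r: "\<And>a. a \<in> carrier G' \<Longrightarrow> continuous_map T' T' (\<lambda>x. x \<otimes>\<^bsub>G'\<^esub> a)"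
    and f: "f \<in> hom G G'" and inj: "inj_on f (carrier G)" and o: "open_map T T' f"
  shows "open_map (tau_topology G T) (tau_topology G' T') f"
proof -
  let ?S = "tau_topology G T" and ?S' = "tau_topology G' T'"
  interpret G: group G by fact
  interpret G': group G' by fact
  interpret f: group_hom G G' f using f by unfold_locales
  have tS: "topological_group G ?S" by (rule topological_group_tau[OF G T])
  have tS': "topological_group G' ?S'" by (rule topological_group_tau[OF G' T'])
  have S: "topspace ?S = carrier G" and S': "topspace ?S' = carrier G'"
    using tS tS' by (simp_all add: topological_group_def)
  \<comment> \<open>Elements all of whose conjugates by members of \<open>J\<close> lie in the image
    of \<open>N\<close>. Only finite \<open>J\<close> are used: a finite intersection keeps these
    sets open, and the family remains closed under further conjugation.\<close>
  define B where "B J N = {x \<in> carrier G'. \<forall>g\<in>J. g \<otimes>\<^bsub>G'\<^esub> x \<otimes>\<^bsub>G'\<^esub> inv\<^bsub>G'\<^esub> g \<in> f ` N}" for J N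
  define \<N> where "\<N> = {N. openin ?S N \<and> \<one>\<^bsub>G\<^esub> \<in> N}"
  define \<B> where "\<B> = {B J N | J N. finite J \<and> J \<subseteq> carrier G' \<and> N \<in> \<N>}"
  have NG: "N \<subseteq> carrier G" if "N \<in> \<N>" for N using that openin_subset[of ?S N] S by (auto simp: \<N>_def)
  have pair: "\<exists>M\<in>\<N>. \<forall>x\<in>M. \<forall>y\<in>M. x \<otimes>\<^bsub>G\<^esub> y \<in> N" if N: "N \<in> \<N>" for N
  proof -
    have m: "continuous_map (prod_topology ?S ?S) ?S (\<lambda>(g, h). g \<otimes>\<^bsub>G\<^esub> h)"
      using tS by (simp add: topological_group_def)
    have N1: "openin ?S N" using N by (simp add: \<N>_def)
    have o: "openin (prod_topology ?S ?S) {w \<in> topspace (prod_topology ?S ?S). (\<lambda>(g, h). g \<otimes>\<^bsub>G\<^esub> h) w \<in> N}"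
      by (rule openin_continuous_map_preimage[OF m N1])
    have "(\<one>\<^bsub>G\<^esub>, \<one>\<^bsub>G\<^esub>) \<in> {w \<in> topspace (prod_topology ?S ?S). (\<lambda>(g, h). g \<otimes>\<^bsub>G\<^esub> h) w \<in> N}"
      using N by (simp add: \<N>_def S)
    from o this show ?thesis
    proof (rule openin_prod_topologyE)
      fix U V
      assume UV: "openin ?S U" "openin ?S V" "\<one>\<^bsub>G\<^esub> \<in> U" "\<one>\<^bsub>G\<^esub> \<in> V"
        "\<And>u v. u \<in> U \<Longrightarrow> v \<in> V \<Longrightarrow> (u, v) \<in> {w \<in> topspace (prod_topology ?S ?S). (\<lambda>(g, h). g \<otimes>\<^bsub>G\<^esub> h) w \<in> N}"
      have "U \<inter> V \<in> \<N>" using UV by (simp add: \<N>_def openin_Int)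
      moreover have "x \<otimes>\<^bsub>G\<^esub> y \<in> N" if "x \<in> U \<inter> V" "y \<in> U \<inter> V" for x y using UV(5)[of x y] that by simp
      ultimately show ?thesis by blast
    qed
  qed
  have invN: "\<exists>M\<in>\<N>. \<forall>x\<in>M. inv\<^bsub>G\<^esub> x \<in> N" if N: "N \<in> \<N>" for N
  proof -
    have "openin ?S {x \<in> topspace ?S. inv\<^bsub>G\<^esub> x \<in> N}"
      by (rule openin_continuous_map_preimage) (use tS N in \<open>auto simp: topological_group_def \<N>_def\<close>)
    then show ?thesis using N by (intro bexI[of _ "{x \<in> topspace ?S. inv\<^bsub>G\<^esub> x \<in> N}"]) (auto simp: \<N>_def S)
  qed
  have one_B: "\<one>\<^bsub>G'\<^esub> \<in> B J N" if J: "J \<subseteq> carrier G'" and N: "N \<in> \<N>" for J N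
  proof -
    have "\<one>\<^bsub>G'\<^esub> = f \<one>\<^bsub>G\<^esub>" "\<one>\<^bsub>G\<^esub> \<in> N" using N by (simp_all add: \<N>_def)
    then have "\<one>\<^bsub>G'\<^esub> \<in> f ` N" by blast
    then show ?thesis using J by (auto simp: B_def subset_iff)
  qed
  obtain R where R: "topological_group G' R"
    and oR: "\<And>U. openin R U \<longleftrightarrow> U \<subseteq> carrier G' \<and> (\<forall>u\<in>U. \<exists>A\<in>\<B>. \<forall>x\<in>A. u \<otimes>\<^bsub>G'\<^esub> x \<in> U)"
    and nR: "\<And>u A. \<lbrakk>u \<in> carrier G'; A \<in> \<B>\<rbrakk> \<Longrightarrow> \<exists>W. openin R W \<and> u \<in> W \<and> W \<subseteq> (\<lambda>x. u \<otimes>\<^bsub>G'\<^esub> x) ` A"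
  proof (rule group_topology_from_base[OF G', of \<B>])
    have "carrier G \<in> \<N>" using S openin_topspace[of ?S] by (simp add: \<N>_def)
    then show "\<B> \<noteq> {}" unfolding \<B>_def by blast
    show "\<one>\<^bsub>G'\<^esub> \<in> A \<and> A \<subseteq> carrier G'" if A: "A \<in> \<B>" for A
    proof -
      obtain J N where *: "A = B J N" "J \<subseteq> carrier G'" "N \<in> \<N>"
        using A unfolding \<B>_def by blast
      then show ?thesis using one_B by (auto simp: B_def)
    qed
    show "\<exists>C\<in>\<B>. C \<subseteq> A \<inter> A'" if "A \<in> \<B>" "A' \<in> \<B>" for A A'
    proof -
      obtain J N J' N' where *: "A = B J N" "finite J" "J \<subseteq> carrier G'" "N \<in> \<N>"
        "A' = B J' N'" "finite J'" "J' \<subseteq> carrier G'" "N' \<in> \<N>"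
        using \<open>A \<in> \<B>\<close> \<open>A' \<in> \<B>\<close> unfolding \<B>_def by blast
      have "B (J \<union> J') (N \<inter> N') \<in> \<B>"
        using * by (auto simp: \<B>_def \<N>_def intro!: exI[of _ "J \<union> J'"] exI[of _ "N \<inter> N'"])
      moreover have "B (J \<union> J') (N \<inter> N') \<subseteq> A \<inter> A'" using * by (auto simp: B_def)
      ultimately show ?thesis by blast
    qed
    show "\<exists>A'\<in>\<B>. \<forall>x\<in>A'. \<forall>y\<in>A'. x \<otimes>\<^bsub>G'\<^esub> y \<in> A" if A: "A \<in> \<B>" for A
    proof -
      obtain J N where *: "A = B J N" "finite J" "J \<subseteq> carrier G'" "N \<in> \<N>" using A unfolding \<B>_def by blast
      obtain M where M: "M \<in> \<N>" "\<forall>x\<in>M. \<forall>y\<in>M. x \<otimes>\<^bsub>G\<^esub> y \<in> N" using pair[OF *(4)] by blast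
      have "x \<otimes>\<^bsub>G'\<^esub> y \<in> B J N" if x: "x \<in> B J M" and y: "y \<in> B J M" for x y
        unfolding B_def
      proof (intro CollectI conjI ballI)
        have xy: "x \<in> carrier G'" "y \<in> carrier G'" using x y by (auto simp: B_def)
        then show "x \<otimes>\<^bsub>G'\<^esub> y \<in> carrier G'" by simp
        fix g assume g: "g \<in> J"
        then have gG: "g \<in> carrier G'" using * by auto
        obtain m n where mn: "m \<in> M" "g \<otimes>\<^bsub>G'\<^esub> x \<otimes>\<^bsub>G'\<^esub> inv\<^bsub>G'\<^esub> g = f m" "n \<in> M"
          "g \<otimes>\<^bsub>G'\<^esub> y \<otimes>\<^bsub>G'\<^esub> inv\<^bsub>G'\<^esub> g = f n" using x y g unfolding B_def by blast
        have "inv\<^bsub>G'\<^esub> g \<otimes>\<^bsub>G'\<^esub> (g \<otimes>\<^bsub>G'\<^esub> (y \<otimes>\<^bsub>G'\<^esub> inv\<^bsub>G'\<^esub> g)) = y \<otimes>\<^bsub>G'\<^esub> inv\<^bsub>G'\<^esub> g"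
          using gG xy by (simp add: G'.m_assoc[symmetric])
        then have "g \<otimes>\<^bsub>G'\<^esub> (x \<otimes>\<^bsub>G'\<^esub> y) \<otimes>\<^bsub>G'\<^esub> inv\<^bsub>G'\<^esub> g
            = (g \<otimes>\<^bsub>G'\<^esub> x \<otimes>\<^bsub>G'\<^esub> inv\<^bsub>G'\<^esub> g) \<otimes>\<^bsub>G'\<^esub> (g \<otimes>\<^bsub>G'\<^esub> y \<otimes>\<^bsub>G'\<^esub> inv\<^bsub>G'\<^esub> g)"
          using gG xy by (simp add: G'.m_assoc)
        also have "\<dots> = f (m \<otimes>\<^bsub>G\<^esub> n)" unfolding mn using mn NG[OF M(1)] by (simp add: subset_iff)
        finally show "g \<otimes>\<^bsub>G'\<^esub> (x \<otimes>\<^bsub>G'\<^esub> y) \<otimes>\<^bsub>G'\<^esub> inv\<^bsub>G'\<^esub> g \<in> f ` N"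
          using M mn by auto
      qed
      then show ?thesis using * M unfolding \<B>_def by (intro bexI[of _ "B J M"]) auto
    qed
    show "\<exists>A'\<in>\<B>. \<forall>x\<in>A'. inv\<^bsub>G'\<^esub> x \<in> A" if A: "A \<in> \<B>" for A
    proof -
      obtain J N where *: "A = B J N" "finite J" "J \<subseteq> carrier G'" "N \<in> \<N>" using A unfolding \<B>_def by blast
      obtain M where M: "M \<in> \<N>" "\<forall>x\<in>M. inv\<^bsub>G\<^esub> x \<in> N" using invN[OF *(4)] by blast
      have "inv\<^bsub>G'\<^esub> x \<in> B J N" if x: "x \<in> B J M" for x
        unfolding B_def
      proof (intro CollectI conjI ballI)
        have xG: "x \<in> carrier G'" using x by (auto simp: B_def)
        then show "inv\<^bsub>G'\<^esub> x \<in> carrier G'" by simp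
        fix g assume g: "g \<in> J"
        then have gG: "g \<in> carrier G'" using * by auto
        obtain m where m: "m \<in> M" "g \<otimes>\<^bsub>G'\<^esub> x \<otimes>\<^bsub>G'\<^esub> inv\<^bsub>G'\<^esub> g = f m" using x g unfolding B_def by blast
        have "g \<otimes>\<^bsub>G'\<^esub> inv\<^bsub>G'\<^esub> x \<otimes>\<^bsub>G'\<^esub> inv\<^bsub>G'\<^esub> g = inv\<^bsub>G'\<^esub> (g \<otimes>\<^bsub>G'\<^esub> x \<otimes>\<^bsub>G'\<^esub> inv\<^bsub>G'\<^esub> g)"
          using gG xG by (simp add: G'.inv_mult_group G'.m_assoc)
        also have "\<dots> = f (inv\<^bsub>G\<^esub> m)" unfolding m using m NG[OF M(1)] by (simp add: subset_iff)
        finally show "g \<otimes>\<^bsub>G'\<^esub> inv\<^bsub>G'\<^esub> x \<otimes>\<^bsub>G'\<^esub> inv\<^bsub>G'\<^esub> g \<in> f ` N"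
          using M m by auto
      qed
      then show ?thesis using * M unfolding \<B>_def by (intro bexI[of _ "B J M"]) auto
    qed
    show "\<exists>A'\<in>\<B>. \<forall>x\<in>A'. h \<otimes>\<^bsub>G'\<^esub> x \<otimes>\<^bsub>G'\<^esub> inv\<^bsub>G'\<^esub> h \<in> A" if A: "A \<in> \<B>" and h: "h \<in> carrier G'" for A h
    proof -
      obtain J N where *: "A = B J N" "finite J" "J \<subseteq> carrier G'" "N \<in> \<N>" using A unfolding \<B>_def by blast
      \<comment> \<open>Conjugating by \<open>h\<close> first and then by \<open>g\<close> is
        conjugating by the product, so \<open>J\<close> is translated by \<open>h\<close>.\<close>
      let ?J = "(\<lambda>g. g \<otimes>\<^bsub>G'\<^esub> h) ` J"
      have "h \<otimes>\<^bsub>G'\<^esub> x \<otimes>\<^bsub>G'\<^esub> inv\<^bsub>G'\<^esub> h \<in> B J N" if x: "x \<in> B ?J N" for x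
        unfolding B_def
      proof (intro CollectI conjI ballI)
        have xG: "x \<in> carrier G'" using x by (auto simp: B_def)
        then show "h \<otimes>\<^bsub>G'\<^esub> x \<otimes>\<^bsub>G'\<^esub> inv\<^bsub>G'\<^esub> h \<in> carrier G'" using h by simp
        fix g assume g: "g \<in> J"
        then have gG: "g \<in> carrier G'" using * by auto
        have "g \<otimes>\<^bsub>G'\<^esub> (h \<otimes>\<^bsub>G'\<^esub> x \<otimes>\<^bsub>G'\<^esub> inv\<^bsub>G'\<^esub> h) \<otimes>\<^bsub>G'\<^esub> inv\<^bsub>G'\<^esub> g =
            (g \<otimes>\<^bsub>G'\<^esub> h) \<otimes>\<^bsub>G'\<^esub> x \<otimes>\<^bsub>G'\<^esub> inv\<^bsub>G'\<^esub> (g \<otimes>\<^bsub>G'\<^esub> h)"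
          using gG xG h by (simp add: G'.inv_mult_group G'.m_assoc)
        then show "g \<otimes>\<^bsub>G'\<^esub> (h \<otimes>\<^bsub>G'\<^esub> x \<otimes>\<^bsub>G'\<^esub> inv\<^bsub>G'\<^esub> h) \<otimes>\<^bsub>G'\<^esub> inv\<^bsub>G'\<^esub> g \<in> f ` N"
          using x g by (auto simp: B_def)
      qed
      moreover have "B ?J N \<in> \<B>" using * h unfolding \<B>_def by (intro CollectI exI[of _ ?J] exI[of _ N]) auto
      ultimately show ?thesis using * by blast
    qed
    fix S
    assume "topological_group G' S"
      "\<And>U. openin S U \<longleftrightarrow> U \<subseteq> carrier G' \<and> (\<forall>u\<in>U. \<exists>A\<in>\<B>. \<forall>x\<in>A. u \<otimes>\<^bsub>G'\<^esub> x \<in> U)"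
      "\<And>u A. \<lbrakk>u \<in> carrier G'; A \<in> \<B>\<rbrakk> \<Longrightarrow> \<exists>W. openin S W \<and> u \<in> W \<and> W \<subseteq> (\<lambda>x. u \<otimes>\<^bsub>G'\<^esub> x) ` A"
    then show thesis by (rule that)
  qed
  \<comment> \<open>A \<open>tau\<close>-open \<open>N\<close> is already open in \<open>T\<close>,
    its image is open because \<open>f\<close> is an open map, and conjugation is continuous on
    \<open>G'\<close> since it is composed of two translations.\<close>
  have BT: "openin T' (B J N)" if J: "finite J" "J \<subseteq> carrier G'" and N: "N \<in> \<N>" for J N
  proof -
    have "openin T N"
    proof -
      have "openin T {x \<in> topspace T. x \<in> N}"
        by (rule openin_continuous_map_preimage[OF continuous_map_tau_unit[OF G T]])
          (use N in \<open>simp add: \<N>_def\<close>)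
      moreover have "{x \<in> topspace T. x \<in> N} = N" using NG[OF N] T by auto
      ultimately show ?thesis by simp
    qed
    then have fN: "openin T' (f ` N)" using o by (simp add: open_map_def)
    have "openin T' {x \<in> topspace T'. g \<otimes>\<^bsub>G'\<^esub> x \<otimes>\<^bsub>G'\<^esub> inv\<^bsub>G'\<^esub> g \<in> f ` N}" if "g \<in> J" for g
    proof (rule openin_continuous_map_preimage[OF _ fN])
      have "g \<in> carrier G'" using that J by auto
      then show "continuous_map T' T' (\<lambda>x. g \<otimes>\<^bsub>G'\<^esub> x \<otimes>\<^bsub>G'\<^esub> inv\<^bsub>G'\<^esub> g)"
        using continuous_map_compose[OF l[of g] r[of "inv\<^bsub>G'\<^esub> g"]] by (simp add: o_def)
    qed
    then have "openin T' (topspace T' \<inter> (\<Inter>g\<in>J. {x \<in> topspace T'. g \<otimes>\<^bsub>G'\<^esub> x \<otimes>\<^bsub>G'\<^esub> inv\<^bsub>G'\<^esub> g \<in> f ` N}))"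
      using J(1) by (cases "J = {}") (auto intro!: openin_Int openin_INT2)
    moreover have "topspace T' \<inter> (\<Inter>g\<in>J. {x \<in> topspace T'. g \<otimes>\<^bsub>G'\<^esub> x \<otimes>\<^bsub>G'\<^esub> inv\<^bsub>G'\<^esub> g \<in> f ` N}) = B J N"
      by (auto simp: B_def T')
    ultimately show ?thesis by simp
  qed
  have RT: "continuous_map T' R (\<lambda>x. x)"
    unfolding continuous_map_alt
  proof (intro conjI allI impI)
    fix U assume U: "openin R U"
    have "\<exists>V. openin T' V \<and> u \<in> V \<and> V \<subseteq> U" if u: "u \<in> U" for u
    proof -
      have uG: "u \<in> carrier G'" using U u oR by blast
      obtain J N where JN: "finite J" "J \<subseteq> carrier G'" "N \<in> \<N>" "\<forall>x\<in>B J N. u \<otimes>\<^bsub>G'\<^esub> x \<in> U"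
        using U u unfolding oR \<B>_def by blast
      have "openin T' ((\<lambda>x. u \<otimes>\<^bsub>G'\<^esub> x) ` B J N)"
        by (rule translation_open[OF G' T' l BT[OF JN(1-3)] uG])
      moreover have "u \<in> (\<lambda>x. u \<otimes>\<^bsub>G'\<^esub> x) ` B J N"
        using one_B[OF JN(2,3)] uG by (intro image_eqI[of _ _ "\<one>\<^bsub>G'\<^esub>"]) auto
      ultimately show ?thesis using JN(4) by (intro exI[of _ "(\<lambda>x. u \<otimes>\<^bsub>G'\<^esub> x) ` B J N"]) auto
    qed
    then have "openin T' U" by (subst openin_subopen) blast
    moreover have "(\<lambda>x. x) -` U \<inter> topspace T' = U" using U T' by (auto simp: oR)
    ultimately show "openin T' ((\<lambda>x. x) -` U \<inter> topspace T')" by simp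
  qed (use R T' in \<open>simp add: topological_group_def\<close>)
  \<comment> \<open>The new topology is a group topology coarser than \<open>T'\<close>, so by the
    universal property of the reflection it is coarser than the topology of \<open>tau\<close> as
    well.\<close>
  have RS: "continuous_map ?S' R (\<lambda>x. x)"
    by (rule continuous_map_from_tau[OF G' T' R _ RT]) (simp add: hom_def)
  have topR: "topspace R = carrier G'" using R by (simp add: topological_group_def)
  show ?thesis
    unfolding open_map_def
  proof (intro allI impI)
    fix U assume U: "openin ?S U"
    have UG: "U \<subseteq> carrier G" using openin_subset[OF U] S by simp
    have "\<exists>V. openin ?S' V \<and> f u \<in> V \<and> V \<subseteq> f ` U" if u: "u \<in> U" for u
    proof -
      have uG: "u \<in> carrier G" using u UG by auto
      have "openin ?S ((\<lambda>x. inv\<^bsub>G\<^esub> u \<otimes>\<^bsub>G\<^esub> x) ` U)"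
        by (rule translation_open[OF G S continuous_map_translations(1)[OF tS] U]) (use uG in auto)
      \<comment> \<open>Translating \<open>U\<close> back by \<open>u\<close> gives a neighbourhood
        of the identity. For openness of the image at \<open>f u\<close>, the trivial conjugation
        alone suffices.\<close>
      then have N: "(\<lambda>x. inv\<^bsub>G\<^esub> u \<otimes>\<^bsub>G\<^esub> x) ` U \<in> \<N>" (is "?N \<in> _")
        using u uG by (auto simp: \<N>_def image_iff intro!: bexI[of _ u])
      have "B {\<one>\<^bsub>G'\<^esub>} ?N \<in> \<B>"
        unfolding \<B>_def using N by (intro CollectI exI[of _ "{\<one>\<^bsub>G'\<^esub>}"] exI[of _ ?N]) simp
      from nR[OF f.hom_closed[OF uG] this]
      obtain W where W: "openin R W" "f u \<in> W" "W \<subseteq> (\<lambda>x. f u \<otimes>\<^bsub>G'\<^esub> x) ` B {\<one>\<^bsub>G'\<^esub>} ?N"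
        by (elim exE conjE)
      have "f u \<otimes>\<^bsub>G'\<^esub> x \<in> f ` U" if x: "x \<in> B {\<one>\<^bsub>G'\<^esub>} ?N" for x
      proof -
        obtain v where v: "v \<in> U" "x = f (inv\<^bsub>G\<^esub> u \<otimes>\<^bsub>G\<^esub> v)" using x by (auto simp: B_def)
        then have "v \<in> carrier G" using UG by auto
        then have "f u \<otimes>\<^bsub>G'\<^esub> x = f v" using uG by (simp add: v G'.m_assoc[symmetric])
        then show ?thesis using v by auto
      qed
      then have "W \<subseteq> f ` U" using W(3) by blast
      moreover have "openin ?S' W"
      proof -
        have "openin ?S' {x \<in> topspace ?S'. x \<in> W}"
          by (rule openin_continuous_map_preimage[OF RS W(1)])
        moreover have "{x \<in> topspace ?S'. x \<in> W} = W" using openin_subset[OF W(1)] topR S' by auto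
        ultimately show ?thesis by simp
      qed
      ultimately show ?thesis using W by blast
    qed
    then show "openin ?S' (f ` U)" by (subst openin_subopen) blast
  qed
qed

section \<open>Groupoids\<close>

lemma category_Comp:
  "\<lbrakk>category H; f \<in> homset H x y; g \<in> homset H y z\<rbrakk> \<Longrightarrow> Comp H f g \<in> homset H x z"
  by (auto simp: category_def homset_def)

lemma category_Ident: "\<lbrakk>category H; x \<in> Obj H\<rbrakk> \<Longrightarrow> Ident H x \<in> homset H x x"
  by (simp add: category_def)

lemma category_assoc:
  "\<lbrakk>category H; f \<in> homset H w x; g \<in> homset H x y; h \<in> homset H y z\<rbrakk>
    \<Longrightarrow> Comp H (Comp H f g) h = Comp H f (Comp H g h)"
  by (auto simp: category_def homset_def)

lemma category_unit:
  "\<lbrakk>category H; f \<in> homset H x y\<rbrakk> \<Longrightarrow> Comp H (Ident H x) f = f"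
  "\<lbrakk>category H; f \<in> homset H x y\<rbrakk> \<Longrightarrow> Comp H f (Ident H y) = f"
  by (auto simp: category_def homset_def)

lemma category_homset_Obj: "\<lbrakk>category H; f \<in> homset H x y\<rbrakk> \<Longrightarrow> x \<in> Obj H \<and> y \<in> Obj H"
  by (auto simp: category_def homset_def)

lemma groupoid_category: "groupoid H \<Longrightarrow> category H" by (simp add: groupoid_def)

lemma inverse_arrow_unique:
  assumes H: "category H" and f: "f \<in> homset H x y" and g: "g \<in> homset H y x" "Comp H f g = Ident H x" "Comp H g f = Ident H y"
  shows "inverse_arrow H f = g"
  unfolding inverse_arrow_def
proof (rule the_equality)
  show "inverse_arrows H f g" using f g by (auto simp: inverse_arrows_def homset_def)
  fix h assume "inverse_arrows H f h"
  then have h: "h \<in> homset H y x" "Comp H h f = Ident H y" using f by (auto simp: inverse_arrows_def homset_def)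
  have "h = Comp H h (Comp H f g)" using h g category_unit(2)[OF H h(1)] by simp
  also have "\<dots> = Comp H (Comp H h f) g" using category_assoc[OF H h(1) f g(1)] by simp
  also have "\<dots> = g" using h category_unit(1)[OF H g(1)] by simp
  finally show "h = g" .
qed

lemma inverse_arrow:
  assumes H: "groupoid H" and f: "f \<in> homset H x y"
  shows "inverse_arrow H f \<in> homset H y x" "Comp H f (inverse_arrow H f) = Ident H x"
    "Comp H (inverse_arrow H f) f = Ident H y"
proof -
  have c: "category H" using H by (rule groupoid_category)
  obtain g where "inverse_arrows H f g"
    using H f by (auto simp: groupoid_def isomorphism_def homset_def)
  then have g: "g \<in> homset H y x" "Comp H f g = Ident H x" "Comp H g f = Ident H y"
    using f by (auto simp: inverse_arrows_def homset_def)
  then have "inverse_arrow H f = g" by (rule inverse_arrow_unique[OF c f])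
  then show "inverse_arrow H f \<in> homset H y x" "Comp H f (inverse_arrow H f) = Ident H x"
    "Comp H (inverse_arrow H f) f = Ident H y" using g by auto
qed

lemma groupoid_cancel:
  assumes H: "groupoid H" and g: "g \<in> homset H y z"
  shows "f \<in> homset H x y \<Longrightarrow> Comp H (Comp H f g) (inverse_arrow H g) = f"
    and "f \<in> homset H x z \<Longrightarrow> Comp H (Comp H f (inverse_arrow H g)) g = f"
    and "f \<in> homset H y x \<Longrightarrow> Comp H g (Comp H (inverse_arrow H g) f) = f"
    and "f \<in> homset H z x \<Longrightarrow> Comp H (inverse_arrow H g) (Comp H g f) = f"
proof -
  have c: "category H" using H by (rule groupoid_category)
  note i = inverse_arrow[OF H g]
  show "Comp H (Comp H f g) (inverse_arrow H g) = f" if "f \<in> homset H x y"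
    using category_assoc[OF c that g i(1)] i category_unit(2)[OF c that] by simp
  show "Comp H (Comp H f (inverse_arrow H g)) g = f" if "f \<in> homset H x z"
    using category_assoc[OF c that i(1) g] i category_unit(2)[OF c that] by simp
  show "Comp H g (Comp H (inverse_arrow H g) f) = f" if "f \<in> homset H y x"
    using category_assoc[OF c g i(1) that] i category_unit(1)[OF c that] by simp
  show "Comp H (inverse_arrow H g) (Comp H g f) = f" if "f \<in> homset H z x"
    using category_assoc[OF c i(1) g that] i category_unit(1)[OF c that] by simp
qed

lemma group_vertex_group:
  assumes H: "groupoid H" and x: "x \<in> Obj H"
  shows "group (vertex_group H x)"
proof (rule groupI)
  have c: "category H" using H by (rule groupoid_category)
  show "y \<otimes>\<^bsub>vertex_group H x\<^esub> z \<in> carrier (vertex_group H x)"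
    if "y \<in> carrier (vertex_group H x)" "z \<in> carrier (vertex_group H x)" for y z
    using that category_Comp[OF c] by (simp add: vertex_group_def)
  show "\<one>\<^bsub>vertex_group H x\<^esub> \<in> carrier (vertex_group H x)"
    using category_Ident[OF c x] by (simp add: vertex_group_def)
  show "w \<otimes>\<^bsub>vertex_group H x\<^esub> y \<otimes>\<^bsub>vertex_group H x\<^esub> z = w \<otimes>\<^bsub>vertex_group H x\<^esub> (y \<otimes>\<^bsub>vertex_group H x\<^esub> z)"
    if "w \<in> carrier (vertex_group H x)" "y \<in> carrier (vertex_group H x)" "z \<in> carrier (vertex_group H x)" for w y z
    using that category_assoc[OF c] by (simp add: vertex_group_def)
  show "\<one>\<^bsub>vertex_group H x\<^esub> \<otimes>\<^bsub>vertex_group H x\<^esub> y = y" if "y \<in> carrier (vertex_group H x)" for y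
    using that category_unit[OF c] by (simp add: vertex_group_def)
  show "\<exists>z\<in>carrier (vertex_group H x). z \<otimes>\<^bsub>vertex_group H x\<^esub> y = \<one>\<^bsub>vertex_group H x\<^esub>"
    if "y \<in> carrier (vertex_group H x)" for y
    using that inverse_arrow[OF H, of y x x] by (auto simp: vertex_group_def)
qed

lemma vertex_group_simps [simp]:
  "carrier (vertex_group H x) = homset H x x" "f \<otimes>\<^bsub>vertex_group H x\<^esub> g = Comp H f g"
  "\<one>\<^bsub>vertex_group H x\<^esub> = Ident H x"
  by (simp_all add: vertex_group_def)

lemma inv_vertex_group:
  assumes H: "groupoid H" and f: "f \<in> homset H x x"
  shows "inv\<^bsub>vertex_group H x\<^esub> f = inverse_arrow H f"
proof -
  have "x \<in> Obj H" using category_homset_Obj[OF groupoid_category[OF H] f] by simp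
  then interpret group "vertex_group H x" by (rule group_vertex_group[OF H])
  show ?thesis using inverse_arrow[OF H f] f by (intro inv_equality) simp_all
qed

lemma functor_homset: "\<lbrakk>is_functor H G Fo Fa; f \<in> homset H x y\<rbrakk> \<Longrightarrow> Fa f \<in> homset G (Fo x) (Fo y)"
  by (auto simp: is_functor_def homset_def)

lemma functor_Comp:
  "\<lbrakk>is_functor H G Fo Fa; f \<in> homset H x y; g \<in> homset H y z\<rbrakk> \<Longrightarrow> Fa (Comp H f g) = Comp G (Fa f) (Fa g)"
  by (auto simp: is_functor_def homset_def)

lemma functor_Ident: "\<lbrakk>is_functor H G Fo Fa; x \<in> Obj H\<rbrakk> \<Longrightarrow> Fa (Ident H x) = Ident G (Fo x)"
  by (auto simp: is_functor_def)

section \<open>The topology of the fundamental groupoid\<close>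

abbreviation VG where "VG X x \<equiv> vertex_group (FG X) x"
abbreviation PQ where "PQ X x y \<equiv> quotient_topology (path_space_between X x y) (path_class X)"
abbreviation PV where "PV X x \<equiv> tau_topology (VG X x) (PQ X x x)"

lemma topspace_PQ: "topspace (PQ X x y) = homset (FG X) x y"
  using quotient_imp_surjective_map[OF quotient_map_quotient_topology[of "path_space_between X x y" "path_class X"]]
  by (simp add: FG_homset)

lemma continuous_map_PQ_class:
  assumes "continuous_map Z (path_space X) a" "\<And>z. z \<in> topspace Z \<Longrightarrow> a z 0 = x" "\<And>z. z \<in> topspace Z \<Longrightarrow> a z 1 = y"
  shows "continuous_map Z (PQ X x y) (\<lambda>z. path_class X (a z))"
  using continuous_map_compose[of Z "path_space_between X x y" a "PQ X x y" "path_class X"] assms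
    quotient_imp_continuous_map[OF quotient_map_quotient_topology[of "path_space_between X x y" "path_class X"]]
  by (simp add: continuous_map_path_space_between o_def)

lemma continuous_map_from_PQ:
  assumes "continuous_map (path_space_between X x y) S (\<lambda>\<alpha>. f (path_class X \<alpha>))"
  shows "continuous_map (PQ X x y) S f"
  using assms continuous_compose_quotient_map_eq[OF quotient_map_quotient_topology[of "path_space_between X x y" "path_class X"], of S f]
  by (simp add: o_def)

lemma homset_FG_E:
  assumes "c \<in> homset (FG X) x y"
  obtains \<alpha> where "\<alpha> \<in> paths X" "\<alpha> 0 = x" "\<alpha> 1 = y" "c = path_class X \<alpha>"
  using assms by (auto simp: FG_homset topspace_path_space_between)

text \<open>With one factor fixed, continuity of concatenation passes to the quotient. Joint
  continuity would require the product of two quotient maps to be a quotient map, which is why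
  \<open>tau\<close> is applied later.\<close>

lemma PQ_right_translation:
  assumes "g \<in> homset (FG X) y z"
  shows "continuous_map (PQ X x y) (PQ X x z) (\<lambda>c. Comp (FG X) c g)"
proof -
  obtain \<gamma> where g: "\<gamma> \<in> paths X" "\<gamma> 0 = y" "\<gamma> 1 = z" "g = path_class X \<gamma>"
    using assms by (rule homset_FG_E)
  have "continuous_map (path_space_between X x y) (PQ X x z) (\<lambda>\<alpha>. path_class X (path_concat \<alpha> \<gamma>))"
    by (intro continuous_map_PQ_class continuous_map_path_concat continuous_map_id_path_space_between)
      (use g in \<open>auto simp: topspace_path_space_between\<close>)
  then show ?thesis
    by (intro continuous_map_from_PQ, elim continuous_map_eq)
      (use g in \<open>auto simp: topspace_path_space_between FG_Comp\<close>)
qed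

lemma PQ_left_translation:
  assumes "g \<in> homset (FG X) w x"
  shows "continuous_map (PQ X x y) (PQ X w y) (\<lambda>c. Comp (FG X) g c)"
proof -
  obtain \<gamma> where g: "\<gamma> \<in> paths X" "\<gamma> 0 = w" "\<gamma> 1 = x" "g = path_class X \<gamma>"
    using assms by (rule homset_FG_E)
  have "continuous_map (path_space_between X x y) (PQ X w y) (\<lambda>\<alpha>. path_class X (path_concat \<gamma> \<alpha>))"
    by (intro continuous_map_PQ_class continuous_map_path_concat continuous_map_id_path_space_between)
      (use g in \<open>auto simp: topspace_path_space_between\<close>)
  then show ?thesis
    by (intro continuous_map_from_PQ, elim continuous_map_eq)
      (use g in \<open>auto simp: topspace_path_space_between FG_Comp\<close>)
qed

lemma PQ_induced:
  assumes p: "continuous_map Y X p"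
  shows "continuous_map (PQ Y x y) (PQ X (p x) (p y)) (induced_class_map Y X p)"
proof -
  have "continuous_map (path_space_between Y x y) (PQ X (p x) (p y)) (\<lambda>\<alpha>. path_class X (compose {0..1} p \<alpha>))"
    by (rule continuous_map_PQ_class)
      (use continuous_map_compose[OF continuous_map_id_path_space_between continuous_map_path_compose[OF p]]
        in \<open>auto simp: o_def topspace_path_space_between\<close>)
  then show ?thesis
    by (intro continuous_map_from_PQ, elim continuous_map_eq)
      (use p in \<open>auto simp: topspace_path_space_between induced_class_map_class\<close>)
qed

lemma group_VG: "x \<in> topspace X \<Longrightarrow> group (VG X x)"
  by (rule group_vertex_group[OF groupoid_FG]) (simp add: FG_Obj)

lemma topspace_PQ_VG: "topspace (PQ X x x) = carrier (VG X x)"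
  by (simp add: topspace_PQ)

lemma topological_group_PV: "x \<in> topspace X \<Longrightarrow> topological_group (VG X x) (PV X x)"
  by (intro topological_group_tau group_VG topspace_PQ_VG)

lemma topspace_PV: "x \<in> topspace X \<Longrightarrow> topspace (PV X x) = homset (FG X) x x"
  using topological_group_PV[of x X] by (simp add: topological_group_def)

lemma homset_FG_topspace: "g \<in> homset (FG X) x y \<Longrightarrow> x \<in> topspace X \<and> y \<in> topspace X"
  using category_homset_Obj[OF groupoid_category[OF groupoid_FG]] by (simp add: FG_Obj)

lemmas FG_cat = groupoid_category[OF groupoid_FG]
lemmas FG_Comp_in = category_Comp[OF FG_cat]
  and FG_assoc = category_assoc[OF FG_cat]
  and FG_inv = inverse_arrow[OF groupoid_FG]
  and FG_cancel = groupoid_cancel[OF groupoid_FG]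

lemma FG_right_translation_image:
  assumes g: "g \<in> homset (FG X) x y"
  shows "(\<lambda>u. Comp (FG X) u g) ` homset (FG X) x x = homset (FG X) x y"
proof (intro equalityI subsetI)
  fix h assume h: "h \<in> homset (FG X) x y"
  then have "h = Comp (FG X) (Comp (FG X) h (inverse_arrow (FG X) g)) g" using FG_cancel(2)[OF g h] by simp
  then show "h \<in> (\<lambda>u. Comp (FG X) u g) ` homset (FG X) x x" using FG_Comp_in[OF h FG_inv(1)[OF g]] by blast
qed (use FG_Comp_in[OF _ g] in auto)

text \<open>Change of base point. Conjugation is a homomorphism between vertex groups that is
  continuous for the quotient topologies, hence also after applying \<open>tau\<close>; it compares
  hom-spaces with different sources.\<close>

lemma PV_conj:
  assumes g: "g \<in> homset (FG X) x y"
  shows "continuous_map (PV X y) (PV X x) (\<lambda>u. Comp (FG X) (Comp (FG X) g u) (inverse_arrow (FG X) g))"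
proof (rule continuous_map_tau_hom)
  note i = FG_inv[OF g]
  show "group (VG X y)" "group (VG X x)" using homset_FG_topspace[OF g] by (simp_all add: group_VG)
  show "continuous_map (PQ X y y) (PQ X x x) (\<lambda>u. Comp (FG X) (Comp (FG X) g u) (inverse_arrow (FG X) g))"
    using continuous_map_compose[OF PQ_left_translation[OF g] PQ_right_translation[OF i(1)]] by (simp add: o_def)
  show "(\<lambda>u. Comp (FG X) (Comp (FG X) g u) (inverse_arrow (FG X) g)) \<in> hom (VG X y) (VG X x)"
  proof (rule homI)
    fix u v assume "u \<in> carrier (VG X y)" "v \<in> carrier (VG X y)"
    then have uv: "u \<in> homset (FG X) y y" "v \<in> homset (FG X) y y" by simp_all
    note gu = FG_Comp_in[OF g uv(1)]
    let ?C = "Comp (FG X)" and ?g = "inverse_arrow (FG X) g"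
    \<comment> \<open>The inner product of the inverse of \<open>g\<close> with \<open>g\<close>
      cancels.\<close>
    have "?C (?C (?C g u) ?g) (?C (?C g v) ?g) = ?C (?C g u) (?C v ?g)"
      using FG_assoc[OF gu i(1) FG_Comp_in[OF FG_Comp_in[OF g uv(2)] i(1)]] FG_assoc[OF g uv(2) i(1)]
        FG_cancel(4)[OF g FG_Comp_in[OF uv(2) i(1)]] by simp
    also have "\<dots> = ?C (?C g (?C u v)) ?g"
      using FG_assoc[OF gu uv(2) i(1)] FG_assoc[OF g uv] by simp
    finally show "Comp (FG X) (Comp (FG X) g (u \<otimes>\<^bsub>VG X y\<^esub> v)) (inverse_arrow (FG X) g) =
       Comp (FG X) (Comp (FG X) g u) (inverse_arrow (FG X) g) \<otimes>\<^bsub>VG X x\<^esub>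
       Comp (FG X) (Comp (FG X) g v) (inverse_arrow (FG X) g)" by simp
  qed (use FG_Comp_in[OF FG_Comp_in[OF g] i(1)] in simp)
qed (simp_all add: topspace_PQ)

section \<open>Hom-spaces of \<open>pi_tau\<close> as translates of vertex groups\<close>

lemma pi_tau_simps [simp]:
  "Obj (pi_tau X) = topspace X" "Arr (pi_tau X) = Arr (FG X)" "Dom (pi_tau X) = Dom (FG X)"
  "Cod (pi_tau X) = Cod (FG X)" "Ident (pi_tau X) = Ident (FG X)" "Comp (pi_tau X) = Comp (FG X)"
  by (simp_all add: pi_tau_def cat.defs topcat.defs FG_Obj)

lemma pi_qtop_simps [simp]:
  "Arr (pi_qtop X) = Arr (FG X)" "Dom (pi_qtop X) = Dom (FG X)"
  "Cod (pi_qtop X) = Cod (FG X)" "Ident (pi_qtop X) = Ident (FG X)" "Comp (pi_qtop X) = Comp (FG X)"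
  "hom_top (pi_qtop X) x y = PQ X x y"
  by (simp_all add: pi_qtop_def cat.defs topcat.defs)

lemma homset_pi_tau [simp]: "homset (pi_tau X) x y = homset (FG X) x y"
  by (simp add: homset_def)

lemma pi_tau_vertex: "pi_tau_vertex_topology X x = PV X x"
  by (simp add: pi_tau_vertex_topology_def vertex_group_def homset_def)

lemma hom_top_pi_tau:
  "hom_top (pi_tau X) x y = (if x = y then PV X x
     else topology_generated_by {(\<lambda>u. Comp (FG X) u g) ` U | U g. openin (PV X x) U \<and> g \<in> homset (FG X) x y})"
  by (simp add: pi_tau_def cat.defs topcat.defs pi_tau_vertex)

lemma inverse_arrow_pi_tau [simp]: "inverse_arrow (pi_tau X) = inverse_arrow (FG X)"
  by (simp add: inverse_arrow_def fun_eq_iff inverse_arrows_def)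

lemma groupoid_pi_tau: "groupoid (pi_tau X)"
  using groupoid_FG[of X]
  by (simp add: groupoid_def category_def isomorphism_def inverse_arrows_def FG_Obj)

lemma PV_right_translation:
  assumes g: "g \<in> homset (FG X) x x"
  shows "homeomorphic_map (PV X x) (PV X x) (\<lambda>u. Comp (FG X) u g)"
proof -
  have x: "x \<in> topspace X" using homset_FG_topspace[OF g] by simp
  have "continuous_map (PV X x) (PV X x) (\<lambda>u. Comp (FG X) u h)" if "h \<in> homset (FG X) x x" for h
    using continuous_map_translations(2)[OF topological_group_PV[OF x], of h] that by simp
  then have "homeomorphic_maps (PV X x) (PV X x) (\<lambda>u. Comp (FG X) u g) (\<lambda>u. Comp (FG X) u (inverse_arrow (FG X) g))"
    using g FG_inv[OF g] FG_cancel(1,2)[OF g] by (auto simp: homeomorphic_maps_def topspace_PV[OF x])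
  then show ?thesis by (rule homeomorphic_maps_map[THEN iffD1, THEN conjunct1])
qed

text \<open>Two arrows with the same ends differ by a loop at \<open>x\<close>, and translation by a
  loop is a homeomorphism of the vertex group. Hence the translates by one fixed \<open>g\<close>
  already give every generating set, and in fact every open set.\<close>

lemma pi_tau_right_translation:
  assumes g: "g \<in> homset (FG X) x y"
  shows "homeomorphic_map (PV X x) (hom_top (pi_tau X) x y) (\<lambda>u. Comp (FG X) u g)"
proof (cases "x = y")
  case True
  then show ?thesis using PV_right_translation[of g X x] g by (simp add: hom_top_pi_tau)
next
  case False
  have x: "x \<in> topspace X" using homset_FG_topspace[OF g] by simp
  let ?R = "\<lambda>g u. Comp (FG X) u g"
  let ?S = "{?R g ` U | U g. openin (PV X x) U \<and> g \<in> homset (FG X) x y}"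
  have T: "hom_top (pi_tau X) x y = topology_generated_by ?S" using False by (simp add: hom_top_pi_tau)
  have inj: "inj_on (?R g) (homset (FG X) x x)"
    by (rule inj_on_inverseI[of _ "\<lambda>c. Comp (FG X) c (inverse_arrow (FG X) g)"]) (rule FG_cancel(1)[OF g])
  have sub: "U \<subseteq> homset (FG X) x x" if "openin (PV X x) U" for U
    using openin_subset[OF that] topspace_PV[OF x] by simp
  have o: "\<exists>U. openin (PV X x) U \<and> W = ?R g ` U" if "openin (topology_generated_by ?S) W" for W
  proof -
    have "generate_topology_on ?S W" using that by (simp add: openin_topology_generated_by)
    then show ?thesis
    proof induction
      case Empty
      then show ?case by (intro exI[of _ "{}"]) simp
    next
      case (Int A B)
      then obtain U V where UV: "openin (PV X x) U" "A = ?R g ` U" "openin (PV X x) V" "B = ?R g ` V" by blast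
      then have "A \<inter> B = ?R g ` (U \<inter> V)"
        using inj_on_image_Int[OF inj sub sub, of U V] by simp
      then show ?case using UV by blast
    next
      case (UN K)
      have "\<forall>k\<in>K. \<exists>U. openin (PV X x) U \<and> ?R g ` U = k"
      proof
        fix k assume "k \<in> K"
        from UN(2)[OF this] obtain U where "openin (PV X x) U" "k = ?R g ` U" by (elim exE conjE)
        then show "\<exists>U. openin (PV X x) U \<and> ?R g ` U = k" by (intro exI[of _ U]) simp
      qed
      then obtain F where F: "\<forall>k\<in>K. openin (PV X x) (F k) \<and> ?R g ` F k = k" by (rule bchoice[THEN exE])
      then have "(\<Union>k\<in>K. ?R g ` F k) = (\<Union>k\<in>K. k)" by (intro SUP_cong) simp_all
      then have "openin (PV X x) (\<Union>k\<in>K. F k)" "\<Union>K = ?R g ` (\<Union>k\<in>K. F k)"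
        using F by (auto simp only: image_UN image_ident)
      then show ?case by blast
    next
      case (Basis s)
      then obtain U h where U: "openin (PV X x) U" and h: "h \<in> homset (FG X) x y" and s: "s = ?R h ` U" by blast
      \<comment> \<open>The loop by which \<open>h\<close> differs from \<open>g\<close>;
        translating \<open>U\<close> by it replaces \<open>h\<close> by the reference arrow
        \<open>g\<close>.\<close>
      let ?k = "Comp (FG X) h (inverse_arrow (FG X) g)"
      have k: "?k \<in> homset (FG X) x x" by (rule FG_Comp_in[OF h FG_inv(1)[OF g]])
      have "openin (PV X x) (?R ?k ` U)"
        using homeomorphic_imp_open_map[OF PV_right_translation[OF k]] U by (simp add: open_map_def)
      moreover have "?R g (?R ?k u) = ?R h u" if "u \<in> U" for u
        using that sub[OF U] FG_assoc[OF _ k g, of u x] FG_cancel(2)[OF g h] by auto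
      then have "s = ?R g ` (?R ?k ` U)" by (auto simp: s image_image)
      ultimately show ?case by blast
    qed
  qed
  have b: "openin (topology_generated_by ?S) (?R g ` U)" if "openin (PV X x) U" for U
    using that g by (intro topology_generated_by_Basis) blast
  have img: "?R g ` homset (FG X) x x = homset (FG X) x y" by (rule FG_right_translation_image[OF g])
  have top: "topspace (topology_generated_by ?S) = homset (FG X) x y"
  proof
    show "topspace (topology_generated_by ?S) \<subseteq> homset (FG X) x y"
    proof -
      obtain U where "openin (PV X x) U" "topspace (topology_generated_by ?S) = ?R g ` U"
        using o[OF openin_topspace] by (elim exE conjE)
      then show ?thesis using image_mono[OF sub, of U "?R g"] img by simp
    qed
    show "homset (FG X) x y \<subseteq> topspace (topology_generated_by ?S)"
      using openin_subset[OF b[OF openin_topspace]] topspace_PV[OF x] img by simp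
  qed
  show ?thesis
    unfolding T
  proof (rule bijective_open_imp_homeomorphic_map)
    show "open_map (PV X x) (topology_generated_by ?S) (?R g)" using b by (simp add: open_map_def)
    show "?R g ` topspace (PV X x) = topspace (topology_generated_by ?S)"
      by (simp only: topspace_PV[OF x] img top)
    show "inj_on (?R g) (topspace (PV X x))" by (simp add: topspace_PV[OF x] inj)
    show "continuous_map (PV X x) (topology_generated_by ?S) (?R g)"
      unfolding continuous_map_def
    proof (intro conjI allI impI)
      fix W assume "openin (topology_generated_by ?S) W"
      then obtain U where U: "openin (PV X x) U" "W = ?R g ` U" using o by blast
      have "{u \<in> topspace (PV X x). ?R g u \<in> W} = U"
        using sub[OF U(1)] inj by (auto simp: topspace_PV[OF x] U(2) inj_on_def subset_iff)
      then show "openin (PV X x) {u \<in> topspace (PV X x). ?R g u \<in> W}" using U by simp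
    next
      show "?R g \<in> topspace (PV X x) \<rightarrow> topspace (topology_generated_by ?S)"
        unfolding top topspace_PV[OF x] using img by blast
    qed
  qed
qed

lemma topspace_hom_top_pi_tau:
  assumes x: "x \<in> topspace X"
  shows "topspace (hom_top (pi_tau X) x y) = homset (FG X) x y"
proof (cases "homset (FG X) x y = {}")
  case True
  then have "x \<noteq> y" using category_Ident[OF FG_cat, of x X] x by (auto simp: FG_Obj)
  then show ?thesis using True by (simp add: hom_top_pi_tau topology_generated_by_topspace)
next
  case False
  then obtain g where g: "g \<in> homset (FG X) x y" by blast
  show ?thesis
    using FG_right_translation_image[OF g] homeomorphic_imp_surjective_map[OF pi_tau_right_translation[OF g]] topspace_PV[OF x] by simp
qed

lemma pi_tau_right_translation_inverse:
  assumes g: "g \<in> homset (FG X) x y"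
  shows "homeomorphic_map (hom_top (pi_tau X) x y) (PV X x) (\<lambda>c. Comp (FG X) c (inverse_arrow (FG X) g))"
proof -
  have x: "x \<in> topspace X" using homset_FG_topspace[OF g] by simp
  obtain k where k: "homeomorphic_maps (PV X x) (hom_top (pi_tau X) x y) (\<lambda>u. Comp (FG X) u g) k"
    using pi_tau_right_translation[OF g] homeomorphic_map_maps by blast
  then have "homeomorphic_map (hom_top (pi_tau X) x y) (PV X x) k"
    using homeomorphic_maps_map by blast
  moreover have "k c = Comp (FG X) c (inverse_arrow (FG X) g)" if c: "c \<in> topspace (hom_top (pi_tau X) x y)" for c
  proof -
    have "k c \<in> homset (FG X) x x" "Comp (FG X) (k c) g = c"
      using k c by (auto simp: homeomorphic_maps_def continuous_map_def topspace_PV[OF x])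
    then show ?thesis using FG_cancel(1)[OF g, of "k c"] by simp
  qed
  ultimately show ?thesis by (simp add: homeomorphic_map_eq)
qed

text \<open>Reference arrows move both operations into the vertex group at \<open>x\<close>, where
  they become group operations combined with conjugations. Empty hom-sets are treated separately,
  since they provide no reference arrow.\<close>

lemma top_groupoid_pi_tau: "top_groupoid (pi_tau X)"
  unfolding top_groupoid_def
proof (intro conjI ballI)
  show "groupoid (pi_tau X)" by (rule groupoid_pi_tau)
  let ?T = "hom_top (pi_tau X)" and ?C = "Comp (FG X)" and ?i = "inverse_arrow (FG X)"
  fix x y assume "x \<in> Obj (pi_tau X)" "y \<in> Obj (pi_tau X)"
  then have x: "x \<in> topspace X" and y: "y \<in> topspace X" by auto
  show "topspace (?T x y) = homset (pi_tau X) x y" using topspace_hom_top_pi_tau[OF x] by simp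
  show "continuous_map (?T x y) (?T y x) (inverse_arrow (pi_tau X))"
  proof (cases "homset (FG X) x y = {}")
    case True
    then show ?thesis by (simp add: continuous_map_def topspace_hom_top_pi_tau[OF x])
  next
    case False
    then obtain g where g: "g \<in> homset (FG X) x y" by blast
    note i = FG_inv[OF g] and hom = homeomorphic_imp_continuous_map
    have "continuous_map (PV X x) (PV X x) (\<lambda>u. inv\<^bsub>VG X x\<^esub> u)"
      using topological_group_PV[OF x] by (simp add: topological_group_def)
    \<comment> \<open>Inversion is factored as c \<mapsto> (c g^-1)^-1, followed by conjugation into
      the vertex group at \<open>y\<close> and right translation by g^-1; the result is g^-1 (c
      g^-1)^-1.\<close>
    from continuous_map_compose[OF continuous_map_compose[OF continuous_map_compose[OF
          hom[OF pi_tau_right_translation_inverse[OF g]] this] PV_conj[OF i(1)]] hom[OF pi_tau_right_translation[OF i(1)]]]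
    have "continuous_map (?T x y) (?T y x)
        (\<lambda>c. ?C (?C (?C (?i g) (inv\<^bsub>VG X x\<^esub> (?C c (?i g)))) (?i (?i g))) (?i g))" (is "continuous_map _ _ ?f")
      by (simp add: o_def)
    then show ?thesis
    proof (rule continuous_map_eq)
      fix c assume "c \<in> topspace (?T x y)"
      then have c: "c \<in> homset (FG X) x y" using topspace_hom_top_pi_tau[OF x] by simp
      note ci = FG_Comp_in[OF c i(1)]
      note k = FG_inv[OF ci]
      have "?f c = ?C (?i g) (?i (?C c (?i g)))"
        using FG_cancel(2)[OF i(1) FG_Comp_in[OF i(1) k(1)]] inv_vertex_group[OF groupoid_FG ci] by simp
      also have "\<dots> = ?i c"
      proof (rule inverse_arrow_unique[symmetric, OF FG_cat c])
        show "?C (?i g) (?i (?C c (?i g))) \<in> homset (FG X) y x" by (rule FG_Comp_in[OF i(1) k(1)])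
        show "?C c (?C (?i g) (?i (?C c (?i g)))) = Ident (FG X) x"
          using FG_assoc[OF c i(1) k(1)] k by simp
        have "?C (?C (?i g) (?i (?C c (?i g)))) c = ?C (?C (?i g) (?i (?C c (?i g)))) (?C (?C c (?i g)) g)"
          using FG_cancel(2)[OF g c] by simp
        also have "\<dots> = ?C (?i g) (?C (?i (?C c (?i g))) (?C (?C c (?i g)) g))"
          by (rule FG_assoc[OF i(1) k(1) FG_Comp_in[OF ci g]])
        also have "?C (?i (?C c (?i g))) (?C (?C c (?i g)) g) = g" by (rule FG_cancel(4)[OF ci g])
        also have "?C (?i g) g = Ident (FG X) y" by (rule i(3))
        finally show "?C (?C (?i g) (?i (?C c (?i g)))) c = Ident (FG X) y" .
      qed
      finally show "?f c = inverse_arrow (pi_tau X) c" by simp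
    qed
  qed
  fix z assume "z \<in> Obj (pi_tau X)"
  then have z: "z \<in> topspace X" by simp
  show "continuous_map (prod_topology (?T x y) (?T y z)) (?T x z) (\<lambda>(g, h). Comp (pi_tau X) g h)"
  proof (cases "homset (FG X) x y = {} \<or> homset (FG X) y z = {}")
    case True
    then have "?T x y = trivial_topology \<or> ?T y z = trivial_topology"
      using topspace_hom_top_pi_tau[OF x, of y] topspace_hom_top_pi_tau[OF y, of z] by (metis null_topspace_iff_trivial)
    then show ?thesis by auto
  next
    case False
    then obtain g h where g: "g \<in> homset (FG X) x y" and h: "h \<in> homset (FG X) y z" by blast
    note i = FG_inv[OF g] and j = FG_inv[OF h] and hom = homeomorphic_imp_continuous_map and gh = FG_Comp_in[OF g h]
    have m: "continuous_map (prod_topology (PV X x) (PV X x)) (PV X x) (\<lambda>(u, v). ?C u v)"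
      using topological_group_PV[OF x] by (simp add: topological_group_def)
    have a: "continuous_map (prod_topology (?T x y) (?T y z)) (PV X x) (\<lambda>w. ?C (fst w) (?i g))"
      using continuous_map_compose[OF continuous_map_fst hom[OF pi_tau_right_translation_inverse[OF g]]] by (simp add: o_def)
    have b: "continuous_map (prod_topology (?T x y) (?T y z)) (PV X x) (\<lambda>w. ?C (?C g (?C (snd w) (?i h))) (?i g))"
      using continuous_map_compose[OF continuous_map_compose[OF continuous_map_snd
          hom[OF pi_tau_right_translation_inverse[OF h]]] PV_conj[OF g]] by (simp add: o_def)
    \<comment> \<open>Composition of \<open>c\<close> and \<open>d\<close> is factored as the
      product of the two loops c g^-1 and g (d h^-1) g^-1 at \<open>x\<close>, followed by right
      translation by g h.\<close>
    from continuous_map_compose[OF continuous_map_compose[OF continuous_map_pairedI[OF a b] m] hom[OF pi_tau_right_translation[OF gh]]]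
    have "continuous_map (prod_topology (?T x y) (?T y z)) (?T x z)
        (\<lambda>w. ?C (?C (?C (fst w) (?i g)) (?C (?C g (?C (snd w) (?i h))) (?i g))) (?C g h))" (is "continuous_map _ _ ?f")
      by (simp add: o_def)
    then show ?thesis
    proof (rule continuous_map_eq)
      fix w assume "w \<in> topspace (prod_topology (?T x y) (?T y z))"
      then obtain c d where w: "w = (c, d)" and c: "c \<in> homset (FG X) x y" and d: "d \<in> homset (FG X) y z"
        using topspace_hom_top_pi_tau[OF x] topspace_hom_top_pi_tau[OF y] by auto
      note dh = FG_Comp_in[OF d j(1)]
      have "?C (?C g (?C d (?i h))) (?i g) = ?C g (?C (?C d (?i h)) (?i g))"
        by (rule FG_assoc[OF g dh i(1)])
      then have "?C (?C c (?i g)) (?C (?C g (?C d (?i h))) (?i g)) = ?C c (?C (?C d (?i h)) (?i g))"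
        using FG_assoc[OF c i(1) FG_Comp_in[OF g FG_Comp_in[OF dh i(1)]]] FG_cancel(4)[OF g FG_Comp_in[OF dh i(1)]] by simp
      then have "?f w = ?C (?C c (?C (?C d (?i h)) (?i g))) (?C g h)" by (simp add: w)
      also have "\<dots> = ?C c (?C (?C (?C d (?i h)) (?i g)) (?C g h))"
        by (rule FG_assoc[OF c FG_Comp_in[OF dh i(1)] gh])
      also have "?C (?C (?C d (?i h)) (?i g)) (?C g h) = ?C (?C d (?i h)) (?C (?i g) (?C g h))"
        by (rule FG_assoc[OF dh i(1) gh])
      also have "?C (?i g) (?C g h) = h" by (rule FG_cancel(4)[OF g h])
      also have "?C (?C d (?i h)) h = d" by (rule FG_cancel(2)[OF h d])
      finally show "?f w = (\<lambda>(g, h). Comp (pi_tau X) g h) w" by (simp add: w)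
    qed
  qed
qed

section \<open>Continuity and openness of induced functors\<close>

lemma is_functor_pi_tau:
  assumes p: "continuous_map Y X p"
  shows "is_functor (pi_tau Y) (pi_tau X) p (induced_class_map Y X p)"
  using is_functor_FG[OF p] groupoid_pi_tau[of X] groupoid_pi_tau[of Y]
  by (simp add: is_functor_def groupoid_def FG_Obj)

lemma VG_hom_induced:
  assumes p: "continuous_map Y X p" and y: "y \<in> topspace Y"
  shows "induced_class_map Y X p \<in> hom (VG Y y) (VG X (p y))"
  using functor_homset[OF is_functor_FG[OF p]] functor_Comp[OF is_functor_FG[OF p]]
  by (intro homI) simp_all

text \<open>Continuity and openness on all hom-spaces are tested on the vertex groups by means of right
  translations.\<close>

lemma induced_factorization:
  assumes p: "continuous_map Y X p" and g: "g \<in> homset (FG Y) x y" and c: "c \<in> homset (FG Y) x y"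
  shows "Comp (FG X) (induced_class_map Y X p (Comp (FG Y) c (inverse_arrow (FG Y) g))) (induced_class_map Y X p g)
    = induced_class_map Y X p c"
  using functor_Comp[OF is_functor_FG[OF p] FG_Comp_in[OF c FG_inv(1)[OF g]] g] FG_cancel(2)[OF g c] by simp

lemma top_functor_pi_tau:
  assumes p: "continuous_map Y X p"
  shows "top_functor (pi_tau Y) (pi_tau X) p (induced_class_map Y X p)"
  unfolding top_functor_def
proof (intro conjI ballI)
  show "is_functor (pi_tau Y) (pi_tau X) p (induced_class_map Y X p)" by (rule is_functor_pi_tau[OF p])
  fix x y assume "x \<in> Obj (pi_tau Y)" "y \<in> Obj (pi_tau Y)"
  then have x: "x \<in> topspace Y" and px: "p x \<in> topspace X" using continuous_map_in_topspace[OF p] by auto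
  show "continuous_map (hom_top (pi_tau Y) x y) (hom_top (pi_tau X) (p x) (p y)) (induced_class_map Y X p)"
  proof (cases "homset (FG Y) x y = {}")
    case True
    then show ?thesis by (simp add: continuous_map_def topspace_hom_top_pi_tau[OF x])
  next
    case False
    then obtain g where g: "g \<in> homset (FG Y) x y" by blast
    have v: "continuous_map (PV Y x) (PV X (p x)) (induced_class_map Y X p)"
      by (intro continuous_map_tau_hom group_VG topspace_PQ_VG VG_hom_induced PQ_induced p x px)
    have pg: "induced_class_map Y X p g \<in> homset (FG X) (p x) (p y)"
      by (rule functor_homset[OF is_functor_FG[OF p] g])
    show ?thesis
      by (rule continuous_map_eq[OF continuous_map_compose[OF continuous_map_compose[OF
            homeomorphic_imp_continuous_map[OF pi_tau_right_translation_inverse[OF g]] v]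
            homeomorphic_imp_continuous_map[OF pi_tau_right_translation[OF pg]]]])
        (use induced_factorization[OF p g] in \<open>simp add: topspace_hom_top_pi_tau[OF x]\<close>)
  qed
qed

text \<open>The hypotheses concern vertex groups with their quotient topologies only;
  \<open>open_map_tau_hom\<close> carries openness through \<open>tau\<close>, and translation
  spreads it to the other hom-spaces.\<close>

lemma open_top_functor_pi_tau:
  assumes p: "continuous_map Y X p"
    and o: "\<And>y. y \<in> topspace Y \<Longrightarrow> open_map (PQ Y y y) (PQ X (p y) (p y)) (induced_class_map Y X p)"
    and i: "\<And>y. y \<in> topspace Y \<Longrightarrow> inj_on (induced_class_map Y X p) (homset (FG Y) y y)"
  shows "open_top_functor (pi_tau Y) (pi_tau X) p (induced_class_map Y X p)"
  unfolding open_top_functor_def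
proof (intro conjI ballI)
  show "top_functor (pi_tau Y) (pi_tau X) p (induced_class_map Y X p)" by (rule top_functor_pi_tau[OF p])
  fix x y assume "x \<in> Obj (pi_tau Y)" "y \<in> Obj (pi_tau Y)"
  then have x: "x \<in> topspace Y" and px: "p x \<in> topspace X" using continuous_map_in_topspace[OF p] by auto
  show "open_map (hom_top (pi_tau Y) x y) (hom_top (pi_tau X) (p x) (p y)) (induced_class_map Y X p)"
  proof (cases "homset (FG Y) x y = {}")
    case True
    then have "U = {}" if "openin (hom_top (pi_tau Y) x y) U" for U
      using openin_subset[OF that] by (simp add: topspace_hom_top_pi_tau[OF x])
    then show ?thesis by (force simp: open_map_def)
  next
    case False
    then obtain g where g: "g \<in> homset (FG Y) x y" by blast
    have v: "open_map (PV Y x) (PV X (p x)) (induced_class_map Y X p)"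
      by (rule open_map_tau_hom)
        (use x px o[OF x] i[OF x] VG_hom_induced[OF p x] PQ_left_translation PQ_right_translation
          in \<open>simp_all add: group_VG topspace_PQ\<close>)
    have pg: "induced_class_map Y X p g \<in> homset (FG X) (p x) (p y)"
      by (rule functor_homset[OF is_functor_FG[OF p] g])
    have "open_map (hom_top (pi_tau Y) x y) (hom_top (pi_tau X) (p x) (p y))
       ((\<lambda>u. Comp (FG X) u (induced_class_map Y X p g)) \<circ> (induced_class_map Y X p \<circ> (\<lambda>c. Comp (FG Y) c (inverse_arrow (FG Y) g))))"
      (is "open_map _ _ ?f")
      by (rule open_map_compose[OF open_map_compose[OF
            homeomorphic_imp_open_map[OF pi_tau_right_translation_inverse[OF g]] v]
            homeomorphic_imp_open_map[OF pi_tau_right_translation[OF pg]]])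
    moreover have "?f ` U = induced_class_map Y X p ` U" if "openin (hom_top (pi_tau Y) x y) U" for U
      by (rule image_cong[OF refl])
        (use induced_factorization[OF p g] openin_subset[OF that] in \<open>auto simp: topspace_hom_top_pi_tau[OF x]\<close>)
    ultimately show ?thesis by (simp add: open_map_def)
  qed
qed

section \<open>Lifting along semicoverings\<close>

text \<open>A total function picking preimages under projection; its values are meaningful only for
  paths that start at \<open>p y\<close>.\<close>

definition path_lift :: "'b topology \<Rightarrow> ('b \<Rightarrow> 'a) \<Rightarrow> 'b \<Rightarrow> (real \<Rightarrow> 'a) \<Rightarrow> real \<Rightarrow> 'b" where
  "path_lift Y p y = inv_into (topspace (path_space_from Y y)) (compose {0..1} p)"

lemma semicovering_continuous: "semicovering_map Y X p \<Longrightarrow> continuous_map Y X p"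
  by (simp add: semicovering_map_def local_homeomorphism_def)

lemma semicovering_path_homeo:
  "\<lbrakk>semicovering_map Y X p; y \<in> topspace Y\<rbrakk> \<Longrightarrow>
    homeomorphic_map (path_space_from Y y) (path_space_from X (p y)) (compose {0..1} p)"
  by (simp add: semicovering_map_def continuous_lifting_of_paths_def)

lemma path_lift:
  assumes s: "semicovering_map Y X p" and y: "y \<in> topspace Y"
    and a: "\<alpha> \<in> paths X" "\<alpha> 0 = p y"
  shows "path_lift Y p y \<alpha> \<in> paths Y" "path_lift Y p y \<alpha> 0 = y"
    "compose {0..1} p (path_lift Y p y \<alpha>) = \<alpha>"
proof -
  have i: "\<alpha> \<in> compose {0..1} p ` topspace (path_space_from Y y)"
    using homeomorphic_imp_surjective_map[OF semicovering_path_homeo[OF s y]] a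
    by (simp add: topspace_path_space_from)
  show "path_lift Y p y \<alpha> \<in> paths Y" "path_lift Y p y \<alpha> 0 = y"
    using inv_into_into[OF i] by (simp_all add: path_lift_def topspace_path_space_from)
  show "compose {0..1} p (path_lift Y p y \<alpha>) = \<alpha>"
    unfolding path_lift_def by (rule f_inv_into_f[OF i])
qed

lemma path_lift_unique:
  assumes s: "semicovering_map Y X p" and g: "\<gamma> \<in> paths Y"
  shows "path_lift Y p (\<gamma> 0) (compose {0..1} p \<gamma>) = \<gamma>"
proof -
  have y: "\<gamma> 0 \<in> topspace Y" using path_in_topspace[OF g] by simp
  show ?thesis
    unfolding path_lift_def
    by (rule inv_into_f_f[OF homeomorphic_imp_injective_map[OF semicovering_path_homeo[OF s y]]])
      (use g in \<open>simp add: topspace_path_space_from\<close>)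
qed

lemma continuous_map_path_lift:
  assumes s: "semicovering_map Y X p" and y: "y \<in> topspace Y"
  shows "continuous_map (path_space_from X (p y)) (path_space_from Y y) (path_lift Y p y)"
proof -
  obtain k where k: "homeomorphic_maps (path_space_from Y y) (path_space_from X (p y)) (compose {0..1} p) k"
    using semicovering_path_homeo[OF s y] homeomorphic_map_maps by blast
  then have kc: "continuous_map (path_space_from X (p y)) (path_space_from Y y) k"
    by (simp add: homeomorphic_maps_def)
  show ?thesis
  proof (rule continuous_map_eq[OF kc])
    fix \<alpha> assume a: "\<alpha> \<in> topspace (path_space_from X (p y))"
    have "k \<alpha> \<in> topspace (path_space_from Y y)" by (rule continuous_map_in_topspace[OF kc a])
    moreover have "compose {0..1} p (k \<alpha>) = \<alpha>" using k a by (simp add: homeomorphic_maps_def)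
    ultimately show "k \<alpha> = path_lift Y p y \<alpha>"
      using path_lift_unique[OF s, of "k \<alpha>"] by (simp add: topspace_path_space_from)
  qed
qed

text \<open>The homotopy between the projections is a path in the space of paths from
  \<open>p (\<gamma> 0)\<close>, so it lifts continuously to a path of paths with fixed start. It
  remains to see that the lifted ends do not move.\<close>

lemma semicovering_path_class_inj:
  assumes s: "semicovering_map Y X p" and g: "\<gamma> \<in> paths Y" and d: "\<delta> \<in> paths Y"
    and e: "\<gamma> 0 = \<delta> 0" and c: "path_class X (compose {0..1} p \<gamma>) = path_class X (compose {0..1} p \<delta>)"
  shows "path_class Y \<gamma> = path_class Y \<delta>"
proof -
  let ?y = "\<gamma> 0"
  have y: "?y \<in> topspace Y" using path_in_topspace[OF g] by simp
  have p: "continuous_map Y X p" using s by (rule semicovering_continuous)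
  obtain h where h: "continuous_map unit_interval (path_space X) h"
    "h 0 = compose {0..1} p \<gamma>" "h 1 = compose {0..1} p \<delta>"
    "\<And>t. t \<in> {0..1} \<Longrightarrow> h t 0 = compose {0..1} p \<gamma> 0" "\<And>t. t \<in> {0..1} \<Longrightarrow> h t 1 = compose {0..1} p \<gamma> 1"
    using path_class_eqE[OF c path_compose_in[OF p g] path_compose_in[OF p d]] by metis
  have h': "continuous_map unit_interval (path_space_from X (p ?y)) h"
    using h(1,4) by (simp add: continuous_map_path_space_from)
  let ?l = "\<lambda>t. path_lift Y p ?y (h t)"
  have l: "continuous_map unit_interval (path_space_from Y ?y) ?l"
    using continuous_map_compose[OF h' continuous_map_path_lift[OF s y]] by (simp add: o_def)
  then have lc: "continuous_map unit_interval (path_space Y) ?l"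
    by (simp add: continuous_map_path_space_from)
  have l0: "?l 0 = \<gamma>" and l1: "?l 1 = \<delta>"
    using h(2,3) path_lift_unique[OF s g] path_lift_unique[OF s d] e by simp_all
  \<comment> \<open>The track of the ends of the lifted paths. It lies over a constant path, hence
    equals the constant path in \<open>Y\<close> by uniqueness of lifts.\<close>
  define \<epsilon> where "\<epsilon> = (\<lambda>t\<in>{0..1}. ?l t 1)"
  have "continuous_map unit_interval Y (\<lambda>t. ?l t 1)"
    by (rule continuous_map_eval_path[OF lc]) simp
  then have ec: "\<epsilon> \<in> paths Y"
    unfolding \<epsilon>_def topspace_path_space maps_def by (auto elim: continuous_map_eq)
  have le: "compose {0..1} p (?l t) = h t" if "t \<in> {0..1}" for t
    using path_lift(3)[OF s y, of "h t"] h(4)[OF that] continuous_map_in_topspace[OF h(1)] that by simp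
  have "p (?l t 1) = p (\<gamma> 1)" if "t \<in> {0..1}" for t
    using fun_cong[OF le[OF that], of 1] h(5)[OF that] by simp
  then have "compose {0..1} p \<epsilon> = compose {0..1} p (path_const (\<gamma> 1))"
    by (auto simp: \<epsilon>_def compose_def path_const_def fun_eq_iff)
  moreover have "\<epsilon> 0 = \<gamma> 1" by (simp add: \<epsilon>_def l0)
  moreover have "path_const (\<gamma> 1) \<in> paths Y"
    by (rule path_const_in) (use path_in_topspace[OF g] in simp)
  ultimately have "\<epsilon> = path_const (\<gamma> 1)"
    using path_lift_unique[OF s ec] path_lift_unique[OF s, of "path_const (\<gamma> 1)"] by simp
  then have e1: "?l t 1 = \<gamma> 1" if "t \<in> {0..1}" for t
    using that by (auto simp: \<epsilon>_def path_const_def fun_eq_iff dest: spec[of _ t])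
  have "path_class Y (?l 0) = path_class Y (?l 1)"
  proof (rule path_class_eqI[OF lc])
    show "?l t 0 = ?y" if "t \<in> {0..1}" for t
      using l that by (simp add: continuous_map_path_space_from)
  qed (rule e1)
  then show ?thesis unfolding l0 l1 .
qed

text \<open>Injectivity on arrows with a given source is homotopy lifting in the form of
  \<open>semicovering_path_class_inj\<close>; surjectivity is path lifting.\<close>

lemma covering_morphism_pi_tau:
  assumes s: "semicovering_map Y X p"
  shows "covering_morphism (pi_tau Y) (pi_tau X) p (induced_class_map Y X p)"
  unfolding covering_morphism_def
proof (intro conjI ballI)
  have p: "continuous_map Y X p" using s by (rule semicovering_continuous)
  show "is_functor (pi_tau Y) (pi_tau X) p (induced_class_map Y X p)" by (rule is_functor_pi_tau[OF p])
  fix y assume "y \<in> Obj (pi_tau Y)"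
  then have y: "y \<in> topspace Y" by simp
  show "bij_betw (induced_class_map Y X p) {h \<in> Arr (pi_tau Y). Dom (pi_tau Y) h = y}
      {g \<in> Arr (pi_tau X). Dom (pi_tau X) g = p y}"
    unfolding bij_betw_def
  proof
    show "inj_on (induced_class_map Y X p) {h \<in> Arr (pi_tau Y). Dom (pi_tau Y) h = y}"
    proof (rule inj_onI)
      fix c d assume c: "c \<in> {h \<in> Arr (pi_tau Y). Dom (pi_tau Y) h = y}"
        and d: "d \<in> {h \<in> Arr (pi_tau Y). Dom (pi_tau Y) h = y}"
        and cd: "induced_class_map Y X p c = induced_class_map Y X p d"
      obtain \<gamma> where g: "\<gamma> \<in> paths Y" "c = path_class Y \<gamma>" using c FG_ArrE[of c Y] by auto
      obtain \<delta> where d': "\<delta> \<in> paths Y" "d = path_class Y \<delta>" using d FG_ArrE[of d Y] by auto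
      show "c = d"
        using semicovering_path_class_inj[OF s g(1) d'(1)] c d cd g d' p
        by (simp add: FG_ends induced_class_map_class)
    qed
    show "induced_class_map Y X p ` {h \<in> Arr (pi_tau Y). Dom (pi_tau Y) h = y} = {g \<in> Arr (pi_tau X). Dom (pi_tau X) g = p y}"
    proof (intro equalityI subsetI)
      fix c assume "c \<in> induced_class_map Y X p ` {h \<in> Arr (pi_tau Y). Dom (pi_tau Y) h = y}"
      then obtain h where h: "c = induced_class_map Y X p h" "h \<in> Arr (FG Y)" "Dom (FG Y) h = y" by auto
      obtain \<gamma> where g: "\<gamma> \<in> paths Y" "h = path_class Y \<gamma>" using h(2) by (rule FG_ArrE)
      show "c \<in> {g \<in> Arr (pi_tau X). Dom (pi_tau X) g = p y}"
        using h g p by (simp add: induced_class_map_class FG_ends FG_path_in_Arr path_compose_in)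
    next
      fix c assume c: "c \<in> {g \<in> Arr (pi_tau X). Dom (pi_tau X) g = p y}"
      obtain \<alpha> where a: "\<alpha> \<in> paths X" "c = path_class X \<alpha>" using c FG_ArrE[of c X] by auto
      have "\<alpha> 0 = p y" using c a by (simp add: FG_ends)
      note l = path_lift[OF s y a(1) this]
      show "c \<in> induced_class_map Y X p ` {h \<in> Arr (pi_tau Y). Dom (pi_tau Y) h = y}"
        by (rule image_eqI[of _ _ "path_class Y (path_lift Y p y \<alpha>)"])
          (use l a p in \<open>simp_all add: induced_class_map_class FG_ends FG_path_in_Arr\<close>)
    qed
  qed
qed (simp_all add: groupoid_pi_tau)

lemma semicovering_nbhd:
  assumes s: "semicovering_map Y X p" and y: "y \<in> topspace Y"
  obtains W where "openin Y W" "y \<in> W" "inj_on p W"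
    "\<And>U. openin Y U \<Longrightarrow> U \<subseteq> W \<Longrightarrow> openin X (p ` U)"
proof -
  obtain W where W: "openin Y W" "y \<in> W" "openin X (p ` W)"
    "homeomorphic_map (subtopology Y W) (subtopology X (p ` W)) p"
    using s y unfolding semicovering_map_def local_homeomorphism_def by blast
  have "topspace (subtopology Y W) = W" using openin_subset[OF W(1)] by (auto simp: topspace_subtopology)
  then have "inj_on p W" using homeomorphic_imp_injective_map[OF W(4)] by simp
  moreover have "openin X (p ` U)" if U: "openin Y U" "U \<subseteq> W" for U
  proof -
    have "openin (subtopology Y W) U" using openin_subset_topspace_eq U by (metis openin_subtopology_Int2 inf.absorb_iff2)
    then have "openin (subtopology X (p ` W)) (p ` U)"
      using homeomorphic_imp_open_map[OF W(4)] by (simp add: open_map_def)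
    then show ?thesis using openin_trans_full[OF _ W(3)] by simp
  qed
  ultimately show thesis using that W(1,2) by blast
qed

text \<open>The lifting homeomorphism concerns paths with free end, whereas loops are wanted on both
  sides. A loop near the projection of a loop might lift to a path that does not close up; a
  neighbourhood on which \<open>p\<close> is injective excludes this.\<close>

lemma open_map_PQ_semicovering:
  assumes s: "semicovering_map Y X p" and y: "y \<in> topspace Y"
  shows "open_map (PQ Y y y) (PQ X (p y) (p y)) (induced_class_map Y X p)"
  unfolding open_map_def
proof (intro allI impI)
  have p: "continuous_map Y X p" using s by (rule semicovering_continuous)
  let ?f = "induced_class_map Y X p" and ?B = "path_space_between X (p y) (p y)"
  fix U assume "openin (PQ Y y y) U"
  then have U: "U \<subseteq> homset (FG Y) y y" "openin (path_space_between Y y y) {\<gamma> \<in> topspace (path_space_between Y y y). path_class Y \<gamma> \<in> U}"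
    by (simp_all add: openin_quotient_topology FG_homset)
  define V where "V = {\<gamma> \<in> topspace (path_space_between Y y y). path_class Y \<gamma> \<in> U}"
  have "path_space_between Y y y = subtopology (path_space_from Y y) {\<gamma>. \<gamma> 1 = y}"
    by (simp add: path_space_between_def path_space_from_def subtopology_subtopology Int_def)
  with U(2) have "openin (subtopology (path_space_from Y y) {\<gamma>. \<gamma> 1 = y}) V" unfolding V_def by (simp only:)
  then obtain N where N: "openin (path_space_from Y y) N" "V = N \<inter> {\<gamma>. \<gamma> 1 = y}"
    unfolding openin_subtopology by (elim exE conjE)
  \<comment> \<open>A path from \<open>y\<close> whose end lies in \<open>W\<close> and over
    \<open>p y\<close> must end at \<open>y\<close>.\<close>
  obtain W where W: "openin Y W" "y \<in> W" "inj_on p W" using semicovering_nbhd[OF s y] by metis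
  have "continuous_map (path_space_from Y y) Y (\<lambda>\<gamma>. \<gamma> 1)"
    by (rule continuous_map_eval_path[OF continuous_map_id_path_space_from]) simp
  then have "openin (path_space_from Y y) (N \<inter> {\<gamma> \<in> topspace (path_space_from Y y). \<gamma> 1 \<in> W})"
    by (intro openin_Int N openin_continuous_map_preimage[OF _ W(1)])
  then have o: "openin (path_space_from X (p y)) (compose {0..1} p ` (N \<inter> {\<gamma> \<in> topspace (path_space_from Y y). \<gamma> 1 \<in> W}))"
    using homeomorphic_imp_open_map[OF semicovering_path_homeo[OF s y]] by (simp add: open_map_def)
  have "{\<alpha> \<in> topspace ?B. path_class X \<alpha> \<in> ?f ` U} =
      compose {0..1} p ` (N \<inter> {\<gamma> \<in> topspace (path_space_from Y y). \<gamma> 1 \<in> W}) \<inter> {\<alpha>. \<alpha> 1 = p y}" (is "?L = ?R")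
  proof (intro equalityI subsetI)
    fix \<alpha> assume "\<alpha> \<in> ?L"
    then have a: "\<alpha> \<in> paths X" "\<alpha> 0 = p y" "\<alpha> 1 = p y" "path_class X \<alpha> \<in> ?f ` U"
      by (auto simp: topspace_path_space_between)
    then obtain \<gamma> where g: "\<gamma> \<in> paths Y" "\<gamma> 0 = y" "\<gamma> 1 = y" "path_class Y \<gamma> \<in> U"
      "path_class X \<alpha> = ?f (path_class Y \<gamma>)"
      using U(1) by (auto simp: FG_homset topspace_path_space_between)
    note l = path_lift[OF s y a(1,2)]
    have c: "path_class Y (path_lift Y p y \<alpha>) = path_class Y \<gamma>"
      by (rule semicovering_path_class_inj[OF s l(1) g(1)])
        (use l g p in \<open>simp_all add: induced_class_map_class\<close>)
    then have "path_lift Y p y \<alpha> \<in> V"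
      using path_class_eq_ends(2)[OF c l(1)] c l g by (simp add: V_def topspace_path_space_between)
    then have "path_lift Y p y \<alpha> \<in> N \<inter> {\<gamma> \<in> topspace (path_space_from Y y). \<gamma> 1 \<in> W}"
      using N W(2) l by (auto simp: topspace_path_space_from)
    then have "compose {0..1} p (path_lift Y p y \<alpha>) \<in> compose {0..1} p ` (N \<inter> {\<gamma> \<in> topspace (path_space_from Y y). \<gamma> 1 \<in> W})"
      by (rule imageI)
    then show "\<alpha> \<in> ?R" using a(3) unfolding l(3) by simp
  next
    fix \<alpha> assume "\<alpha> \<in> ?R"
    then obtain \<gamma> where g: "\<gamma> \<in> N" "\<gamma> \<in> paths Y" "\<gamma> 0 = y" "\<gamma> 1 \<in> W" "\<alpha> = compose {0..1} p \<gamma>" "p (\<gamma> 1) = p y"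
      by (auto simp: topspace_path_space_from)
    then have "\<gamma> 1 = y" using W by (meson inj_onD)
    then have "\<gamma> \<in> V" using g N by simp
    then have "path_class Y \<gamma> \<in> U" by (simp add: V_def)
    then have "path_class X \<alpha> \<in> ?f ` U" using g p induced_class_map_class by (metis imageI)
    then show "\<alpha> \<in> ?L" using g p by (simp add: topspace_path_space_between path_compose_in)
  qed
  moreover have "?B = subtopology (path_space_from X (p y)) {\<alpha>. \<alpha> 1 = p y}"
    by (simp add: path_space_between_def path_space_from_def subtopology_subtopology Int_def)
  ultimately have "openin ?B {\<alpha> \<in> topspace ?B. path_class X \<alpha> \<in> ?f ` U}"
    using o by (auto simp: openin_subtopology)
  moreover have "?f ` U \<subseteq> path_class X ` topspace ?B"
    using U(1) functor_homset[OF is_functor_FG[OF p], of _ y y] FG_homset[of X "p y" "p y"] by blast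
  ultimately show "openin (PQ X (p y) (p y)) (?f ` U)"
    by (simp add: openin_quotient_topology)
qed

lemma pi_tau_shriek_obj_in:
  assumes "(Y, p) \<in> semicoverings X"
  shows "pi_tau_shriek_obj X (Y, p) \<in> open_covering_morphisms (pi_tau X)"
proof -
  have s: "semicovering_map Y X p" and e: "p \<in> extensional (topspace Y)"
    using assms by (simp_all add: semicoverings_def)
  have c: "covering_morphism (pi_tau Y) (pi_tau X) p (induced_class_map Y X p)"
    by (rule covering_morphism_pi_tau[OF s])
  have "open_top_functor (pi_tau Y) (pi_tau X) p (induced_class_map Y X p)"
  proof (rule open_top_functor_pi_tau)
    show "inj_on (induced_class_map Y X p) (homset (FG Y) y y)" if "y \<in> topspace Y" for y
    proof (rule inj_on_subset)
      show "inj_on (induced_class_map Y X p) {h \<in> Arr (pi_tau Y). Dom (pi_tau Y) h = y}"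
        using c that by (simp add: covering_morphism_def bij_betw_def)
    qed (auto simp: homset_def)
  qed (use open_map_PQ_semicovering[OF s] semicovering_continuous[OF s] in auto)
  then show ?thesis
    using c e by (simp add: pi_tau_shriek_obj_def open_covering_morphisms_def top_groupoid_pi_tau induced_class_map_def)
qed

text \<open>The topology of \<open>Y\<close> is recovered from ends of paths. A point
  \<open>w\<close> near \<open>y\<close> is the end of a lift, from one fixed start, of a path close
  to a locally well-ended one; continuity of lifting then puts \<open>w\<close> into
  \<open>U\<close>.\<close>

lemma semicovering_openinI:
  assumes X: "locally_wep_connected X" and s: "semicovering_map Y X p" and U: "U \<subseteq> topspace Y"
    and o: "\<And>y. y \<in> topspace Y \<Longrightarrow> openin (path_space_from Y y) {\<gamma> \<in> topspace (path_space_from Y y). \<gamma> 1 \<in> U}"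
  shows "openin Y U"
proof (subst openin_subopen, rule ballI)
  fix y assume yU: "y \<in> U"
  then have y: "y \<in> topspace Y" using U by auto
  have p: "continuous_map Y X p" using s by (rule semicovering_continuous)
  have x: "p y \<in> topspace X" by (rule continuous_map_in_topspace[OF p y])
  obtain \<alpha> where we: "locally_well_ended X \<alpha>" and a: "\<alpha> 0 = p y" "\<alpha> 1 = p y"
    using X x unfolding locally_wep_connected_def by blast
  have aX: "\<alpha> \<in> paths X" using we by (simp add: locally_well_ended_def)
  note ra = path_reverse_in[OF aX]
  \<comment> \<open>Backing up along the loop \<alpha> places the start at \<open>z\<close>, so that
    lifting \<alpha> itself from \<open>z\<close> ends at \<open>y\<close>.\<close>
  define z where "z = path_lift Y p y (path_reverse \<alpha>) 1"
  note l = path_lift[OF s y ra, simplified, OF a(2)]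
  have z: "z \<in> topspace Y" unfolding z_def by (rule path_in_topspace[OF l(1)]) simp
  have pz: "p z = p y" using fun_cong[OF l(3), of 1] a by (simp add: z_def)
  have zy: "path_lift Y p z \<alpha> = path_reverse (path_lift Y p y (path_reverse \<alpha>))"
  proof -
    have "compose {0..1} p (path_reverse (path_lift Y p y (path_reverse \<alpha>))) = \<alpha>"
      using l(3) path_reverse_reverse[OF aX] by (simp add: compose_path_reverse)
    then show ?thesis using path_lift_unique[OF s path_reverse_in[OF l(1)]] by (simp add: z_def)
  qed
  obtain W where W: "openin Y W" "y \<in> W" "inj_on p W" using semicovering_nbhd[OF s y] by metis
  have ev: "continuous_map (path_space_from Y z) Y (\<lambda>\<gamma>. \<gamma> 1)"
    by (rule continuous_map_eval_path[OF continuous_map_id_path_space_from]) simp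
  have "openin (path_space_from Y z) ({\<gamma> \<in> topspace (path_space_from Y z). \<gamma> 1 \<in> U} \<inter> {\<gamma> \<in> topspace (path_space_from Y z). \<gamma> 1 \<in> W})"
    by (intro openin_Int o z openin_continuous_map_preimage[OF ev W(1)])
  from openin_continuous_map_preimage[OF continuous_map_path_lift[OF s z] this]
  obtain N where N: "openin (path_space X) N"
    and N': "{\<beta> \<in> topspace (path_space_from X (p z)). path_lift Y p z \<beta> \<in> {\<gamma> \<in> topspace (path_space_from Y z). \<gamma> 1 \<in> U} \<inter> {\<gamma> \<in> topspace (path_space_from Y z). \<gamma> 1 \<in> W}}
      = N \<inter> {\<beta>. \<beta> 0 = p z}" (is "?L = _")
    unfolding path_space_from_def[of X] openin_subtopology by auto
  have "\<alpha> \<in> ?L"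
    using aX a pz zy l W(2) yU by (simp add: topspace_path_space_from path_reverse_in z_def[symmetric])
  then have aN: "\<alpha> \<in> N" unfolding N' by simp
  obtain V0 V1 where V: "openin X V0" "\<alpha> 0 \<in> V0" "openin X V1" "\<alpha> 1 \<in> V1"
    "\<forall>a\<in>V0. \<forall>b\<in>V1. \<exists>\<beta>\<in>N. well_ended X \<beta> \<and> \<beta> 0 = a \<and> \<beta> 1 = b"
    using we[unfolded locally_well_ended_def, THEN conjunct2, rule_format, OF conjI[OF N aN]] by (elim exE conjE)
  \<comment> \<open>For \<open>w\<close> in this set, a path in \<open>N\<close> from
    \<open>p z\<close> to \<open>p w\<close> lifts to a path whose end lies in \<open>W\<close> and
    over \<open>p w\<close>; injectivity of \<open>p\<close> on \<open>W\<close> makes this end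
    equal to \<open>w\<close>.\<close>
  define T where "T = W \<inter> {w \<in> topspace Y. p w \<in> V1}"
  have "openin Y T" unfolding T_def by (intro openin_Int W openin_continuous_map_preimage[OF p V(3)])
  moreover have "y \<in> T" using W y V a by (simp add: T_def)
  moreover have "T \<subseteq> U"
  proof
    fix w assume w: "w \<in> T"
    then obtain \<beta> where b: "\<beta> \<in> N" "\<beta> 0 = p z" "\<beta> 1 = p w" using V a pz unfolding T_def by auto
    then have L: "\<beta> \<in> ?L" unfolding N' by simp
    then have bX: "\<beta> \<in> paths X" by (simp add: topspace_path_space_from)
    have "p (path_lift Y p z \<beta> 1) = p w"
      using fun_cong[OF path_lift(3)[OF s z bX b(2)], of 1] b by simp
    then have "path_lift Y p z \<beta> 1 = w" using L w W(3) unfolding T_def by (auto dest: inj_onD)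
    then show "w \<in> U" using L by auto
  qed
  ultimately show "\<exists>T. openin Y T \<and> y \<in> T \<and> T \<subseteq> U" by blast
qed

text \<open>A functor over the base has no freedom: the image of a class has a prescribed start and
  projection, and \<open>semicovering_path_class_inj\<close> identifies it with the class of the
  lift. The ends give the action on objects.\<close>

lemma over_morphism_path_lift:
  assumes s: "semicovering_map Y X p" and s': "semicovering_map Y' X p'"
    and K: "over_morphism (pi_tau_shriek_obj X (Y, p)) (pi_tau_shriek_obj X (Y', p')) (Ko, Ka)"
    and g: "\<gamma> \<in> paths Y"
  shows "Ka (path_class Y \<gamma>) = path_class Y' (path_lift Y' p' (Ko (\<gamma> 0)) (compose {0..1} p \<gamma>))"
    and "Ko (\<gamma> 1) = path_lift Y' p' (Ko (\<gamma> 0)) (compose {0..1} p \<gamma>) 1"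
    and "Ko (\<gamma> 0) \<in> topspace Y'" "p' (Ko (\<gamma> 0)) = p (\<gamma> 0)"
proof -
  have p: "continuous_map Y X p" and p': "continuous_map Y' X p'"
    using s s' by (auto intro: semicovering_continuous)
  have F: "is_functor (pi_tau Y) (pi_tau Y') Ko Ka" and ko: "\<And>y. y \<in> topspace Y \<Longrightarrow> p' (Ko y) = p y"
    and ka: "\<And>h. h \<in> Arr (FG Y) \<Longrightarrow> induced_class_map Y' X p' (Ka h) = induced_class_map Y X p h"
    using K by (auto simp: over_morphism_def pi_tau_shriek_obj_def top_functor_def)
  have y: "\<gamma> 0 \<in> topspace Y" using path_in_topspace[OF g] by simp
  show y': "Ko (\<gamma> 0) \<in> topspace Y'" using F y by (simp add: is_functor_def)
  show e: "p' (Ko (\<gamma> 0)) = p (\<gamma> 0)" by (rule ko[OF y])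
  have "path_class Y \<gamma> \<in> homset (pi_tau Y) (\<gamma> 0) (\<gamma> 1)"
    using g by (simp add: FG_homset topspace_path_space_between)
  from functor_homset[OF F this] have "Ka (path_class Y \<gamma>) \<in> homset (FG Y') (Ko (\<gamma> 0)) (Ko (\<gamma> 1))" by simp
  then obtain \<delta> where d: "\<delta> \<in> paths Y'" "\<delta> 0 = Ko (\<gamma> 0)" "\<delta> 1 = Ko (\<gamma> 1)" "Ka (path_class Y \<gamma>) = path_class Y' \<delta>"
    by (rule homset_FG_E)
  note l = path_lift[OF s' y' path_compose_in[OF p g], simplified, OF e[symmetric]]
  have "path_class X (compose {0..1} p' \<delta>) = path_class X (compose {0..1} p \<gamma>)"
    using ka[OF FG_path_in_Arr[OF g]] d g p p' by (simp add: induced_class_map_class)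
  then have c: "path_class Y' \<delta> = path_class Y' (path_lift Y' p' (Ko (\<gamma> 0)) (compose {0..1} p \<gamma>))"
    by (intro semicovering_path_class_inj[OF s' d(1) l(1)]) (simp_all add: l d)
  show "Ka (path_class Y \<gamma>) = path_class Y' (path_lift Y' p' (Ko (\<gamma> 0)) (compose {0..1} p \<gamma>))"
    and "Ko (\<gamma> 1) = path_lift Y' p' (Ko (\<gamma> 0)) (compose {0..1} p \<gamma>) 1"
    using d c path_class_eq_ends(2)[OF c d(1)] by simp_all
qed

text \<open>Continuity is tested on ends of paths by \<open>semicovering_openinI\<close>. Along
  paths from \<open>y\<close> the object map is: project, lift to \<open>Y'\<close> from
  \<open>Ko y\<close>, evaluate at 1, and each of these steps is continuous.\<close>

lemma over_morphism_induced:
  assumes X: "locally_wep_connected X" and s: "semicovering_map Y X p" and s': "semicovering_map Y' X p'"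
    and K: "over_morphism (pi_tau_shriek_obj X (Y, p)) (pi_tau_shriek_obj X (Y', p')) (Ko, Ka)"
  shows "continuous_map Y Y' Ko" "Ka = induced_class_map Y Y' Ko"
proof -
  have p: "continuous_map Y X p" and p': "continuous_map Y' X p'"
    using s s' by (auto intro: semicovering_continuous)
  note L = over_morphism_path_lift[OF s s' K]
  have in_Y': "Ko y \<in> topspace Y'" "p' (Ko y) = p y" if "y \<in> topspace Y" for y
    using L(3,4)[OF path_const_in[OF that]] by simp_all
  show c: "continuous_map Y Y' Ko"
    unfolding continuous_map_def
  proof (intro conjI allI impI)
    show "Ko \<in> topspace Y \<rightarrow> topspace Y'" using in_Y' by blast
    fix U assume U: "openin Y' U"
    show "openin Y {y \<in> topspace Y. Ko y \<in> U}"
    proof (rule semicovering_openinI[OF X s])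
      fix y assume y: "y \<in> topspace Y"
      have "continuous_map (path_space_from Y y) (path_space_from X (p' (Ko y))) (compose {0..1} p)"
        using homeomorphic_imp_continuous_map[OF semicovering_path_homeo[OF s y]] in_Y'[OF y] by simp
      from continuous_map_compose[OF this continuous_map_path_lift[OF s' in_Y'(1)[OF y]]]
      have "continuous_map (path_space_from Y y) (path_space Y') (\<lambda>\<gamma>. path_lift Y' p' (Ko y) (compose {0..1} p \<gamma>))"
        by (simp add: continuous_map_path_space_from o_def)
      then have "continuous_map (path_space_from Y y) Y' (\<lambda>\<gamma>. path_lift Y' p' (Ko y) (compose {0..1} p \<gamma>) 1)"
        by (rule continuous_map_eval_path) simp
      then have "openin (path_space_from Y y) {\<gamma> \<in> topspace (path_space_from Y y). path_lift Y' p' (Ko y) (compose {0..1} p \<gamma>) 1 \<in> U}"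
        using U by (rule openin_continuous_map_preimage)
      also have "{\<gamma> \<in> topspace (path_space_from Y y). path_lift Y' p' (Ko y) (compose {0..1} p \<gamma>) 1 \<in> U}
        = {\<gamma> \<in> topspace (path_space_from Y y). \<gamma> 1 \<in> {y \<in> topspace Y. Ko y \<in> U}}"
        using L(2) path_in_topspace[of _ Y 1] by (auto simp: topspace_path_space_from)
      finally show "openin (path_space_from Y y) {\<gamma> \<in> topspace (path_space_from Y y). \<gamma> 1 \<in> {y \<in> topspace Y. Ko y \<in> U}}" .
    qed blast
  qed
  have "Ka h = induced_class_map Y Y' Ko h" if "h \<in> Arr (FG Y)" for h
  proof -
    obtain \<gamma> where g: "\<gamma> \<in> paths Y" "h = path_class Y \<gamma>" using \<open>h \<in> Arr (FG Y)\<close> by (rule FG_ArrE)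
    have "compose {0..1} p' (compose {0..1} Ko \<gamma>) = compose {0..1} p \<gamma>"
      using in_Y'(2) path_in_topspace[OF g(1)] by (auto simp: compose_def fun_eq_iff)
    then have "path_lift Y' p' (Ko (\<gamma> 0)) (compose {0..1} p \<gamma>) = compose {0..1} Ko \<gamma>"
      using path_lift_unique[OF s' path_compose_in[OF c g(1)]] by simp
    then show ?thesis using L(1)[OF g(1)] g c by (simp add: induced_class_map_class)
  qed
  moreover have "Ka \<in> extensional (Arr (FG Y))"
    using K by (simp add: over_morphism_def pi_tau_shriek_obj_def)
  ultimately show "Ka = induced_class_map Y Y' Ko"
    by (intro extensionalityI[of _ "Arr (FG Y)"]) (auto simp: induced_class_map_def)
qed

section \<open>The semicovering associated with a transport of points along paths\<close>

text \<open>What remains of an open covering morphism once its arrows are forgotten: an action of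
  paths on fibres, constrained only when a path starts under the given point. The topology of the
  groupoid survives solely in \<open>stabilizer_open\<close>.\<close>

locale path_transport =
  fixes X :: "'a topology" and E :: "'b set" and p :: "'b \<Rightarrow> 'a" and tr :: "'b \<Rightarrow> (real \<Rightarrow> 'a) \<Rightarrow> 'b"
  assumes wep: "locally_wep_connected X"
    and p_in: "y \<in> E \<Longrightarrow> p y \<in> topspace X"
    and tr_in: "\<lbrakk>y \<in> E; \<alpha> \<in> paths X; \<alpha> 0 = p y\<rbrakk> \<Longrightarrow> tr y \<alpha> \<in> E"
    and p_tr: "\<lbrakk>y \<in> E; \<alpha> \<in> paths X; \<alpha> 0 = p y\<rbrakk> \<Longrightarrow> p (tr y \<alpha>) = \<alpha> 1"
    and tr_const: "y \<in> E \<Longrightarrow> tr y (path_const (p y)) = y"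
    and tr_concat: "\<lbrakk>y \<in> E; \<alpha> \<in> paths X; \<beta> \<in> paths X; \<alpha> 0 = p y; \<alpha> 1 = \<beta> 0\<rbrakk>
      \<Longrightarrow> tr y (path_concat \<alpha> \<beta>) = tr (tr y \<alpha>) \<beta>"
    and tr_class: "\<lbrakk>y \<in> E; \<alpha> \<in> paths X; \<beta> \<in> paths X; \<alpha> 0 = p y;
      path_class X \<alpha> = path_class X \<beta>\<rbrakk> \<Longrightarrow> tr y \<alpha> = tr y \<beta>"
    and stabilizer_open: "y \<in> E \<Longrightarrow> openin (path_space_between X (p y) (p y))
      {\<alpha> \<in> topspace (path_space_between X (p y) (p y)). tr y \<alpha> = y}"
begin

lemma tr_reverse:
  assumes y: "y \<in> E" and a: "\<alpha> \<in> paths X" "\<alpha> 0 = p y"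
  shows "tr (tr y \<alpha>) (path_reverse \<alpha>) = y"
proof -
  have "tr (tr y \<alpha>) (path_reverse \<alpha>) = tr y (path_concat \<alpha> (path_reverse \<alpha>))"
    using tr_concat[OF y a(1) path_reverse_in[OF a(1)] a(2)] by simp
  also have "\<dots> = tr y (path_const (p y))"
    using path_class_concat_reverse[OF a(1)] a
    by (intro tr_class y path_concat_in path_reverse_in path_const_in p_in) simp_all
  finally show ?thesis using tr_const[OF y] by simp
qed

lemma tr_inj:
  assumes y: "y \<in> E" "z \<in> E" and a: "\<alpha> \<in> paths X" "\<alpha> 0 = p y" "\<alpha> 0 = p z"
    and e: "tr y \<alpha> = tr z \<alpha>"
  shows "y = z"
  using tr_reverse[OF y(1) a(1,2)] tr_reverse[OF y(2) a(1,3)] e by metis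

lemma tr_reverse':
  assumes y: "y \<in> E" and a: "\<alpha> \<in> paths X" "\<alpha> 1 = p y"
  shows "tr (tr y (path_reverse \<alpha>)) \<alpha> = y"
  using tr_reverse[OF y path_reverse_in[OF a(1)]] a path_reverse_reverse[OF a(1)] by simp

text \<open>The finest topology on \<open>E\<close> for which every \<open>tr y\<close> is
  continuous on the paths starting at \<open>p y\<close>.\<close>

definition total where
  "total = topology (\<lambda>U. U \<subseteq> E \<and> (\<forall>y\<in>E. openin (path_space_from X (p y))
     {\<alpha> \<in> topspace (path_space_from X (p y)). tr y \<alpha> \<in> U}))"

lemma openin_total:
  "openin total U \<longleftrightarrow> U \<subseteq> E \<and> (\<forall>y\<in>E. openin (path_space_from X (p y))
     {\<alpha> \<in> topspace (path_space_from X (p y)). tr y \<alpha> \<in> U})" (is "_ \<longleftrightarrow> ?P U")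
proof -
  have "istopology ?P"
    unfolding istopology_def
  proof (rule conjI; intro allI impI)
    fix S T assume S: "?P S" and T: "?P T"
    have "{\<alpha> \<in> topspace (path_space_from X (p y)). tr y \<alpha> \<in> S \<inter> T} =
      {\<alpha> \<in> topspace (path_space_from X (p y)). tr y \<alpha> \<in> S} \<inter> {\<alpha> \<in> topspace (path_space_from X (p y)). tr y \<alpha> \<in> T}" for y
      by auto
    then show "?P (S \<inter> T)" using S T by (auto intro: openin_Int)
  next
    fix K assume K: "\<forall>S\<in>K. ?P S"
    have "{\<alpha> \<in> topspace (path_space_from X (p y)). tr y \<alpha> \<in> \<Union>K} =
      (\<Union>S\<in>K. {\<alpha> \<in> topspace (path_space_from X (p y)). tr y \<alpha> \<in> S})" for y by auto
    then show "?P (\<Union>K)" using K by auto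
  qed
  then show ?thesis by (simp add: total_def topology_inverse')
qed

lemma topspace_total: "topspace total = E"
proof -
  have "{\<alpha> \<in> topspace (path_space_from X (p y)). tr y \<alpha> \<in> E} = topspace (path_space_from X (p y))"
    if "y \<in> E" for y
    using tr_in[OF that] by (auto simp: topspace_path_space_from)
  then have "openin total E" by (simp add: openin_total)
  then show ?thesis using openin_total[of "topspace total"] openin_subset by blast
qed

lemma continuous_map_tr: "y \<in> E \<Longrightarrow> continuous_map (path_space_from X (p y)) total (tr y)"
  using tr_in by (auto simp: continuous_map_def topspace_total openin_total topspace_path_space_from)

lemma continuous_map_end: "continuous_map (path_space_from X x) X (\<lambda>\<alpha>. \<alpha> 1)"
  by (rule continuous_map_eval_path[OF continuous_map_id_path_space_from]) simp

lemma continuous_map_p: "continuous_map total X p"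
  unfolding continuous_map_def
proof (intro conjI allI impI)
  fix U assume U: "openin X U"
  show "openin total {y \<in> topspace total. p y \<in> U}"
    unfolding openin_total
  proof (intro conjI ballI)
    fix y assume y: "y \<in> E"
    have "{\<alpha> \<in> topspace (path_space_from X (p y)). tr y \<alpha> \<in> {y \<in> topspace total. p y \<in> U}} =
      {\<alpha> \<in> topspace (path_space_from X (p y)). \<alpha> 1 \<in> U}"
      using tr_in[OF y] p_tr[OF y] by (auto simp: topspace_total topspace_path_space_from)
    then show "openin (path_space_from X (p y))
        {\<alpha> \<in> topspace (path_space_from X (p y)). tr y \<alpha> \<in> {y \<in> topspace total. p y \<in> U}}"
      using openin_continuous_map_preimage[OF continuous_map_end U] by simp
  qed (auto simp: topspace_total)
qed (use p_in in \<open>simp add: topspace_total\<close>)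

text \<open>Back up from \<open>y\<close> along a locally well-ended loop to \<open>z\<close>.
  Transports from \<open>z\<close> along paths near the loop stay in \<open>U\<close>, and such
  paths reach every point of a neighbourhood of \<open>p y\<close>.\<close>

lemma open_map_p: "open_map total X p"
  unfolding open_map_def
proof (intro allI impI)
  fix U assume U: "openin total U"
  show "openin X (p ` U)"
  proof (subst openin_subopen, rule ballI)
    fix x assume "x \<in> p ` U"
    then obtain y where y: "y \<in> U" "x = p y" by blast
    then have yE: "y \<in> E" using U by (auto simp: openin_total)
    obtain \<alpha> where we: "locally_well_ended X \<alpha>" and a: "\<alpha> 0 = p y" "\<alpha> 1 = p y"
      using wep p_in[OF yE] unfolding locally_wep_connected_def by blast
    have aX: "\<alpha> \<in> paths X" using we by (simp add: locally_well_ended_def)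
    define z where "z = tr y (path_reverse \<alpha>)"
    have zE: "z \<in> E" and pz: "p z = p y" and zy: "tr z \<alpha> = y"
      using tr_in[OF yE path_reverse_in[OF aX]] p_tr[OF yE path_reverse_in[OF aX]] tr_reverse'[OF yE aX] a
      by (simp_all add: z_def)
    have "openin (subtopology (path_space X) {\<alpha>. \<alpha> 0 = p z}) {\<alpha> \<in> topspace (path_space_from X (p z)). tr z \<alpha> \<in> U}"
      using U zE by (simp add: openin_total path_space_from_def)
    then obtain N where N: "openin (path_space X) N"
      "{\<alpha> \<in> topspace (path_space_from X (p z)). tr z \<alpha> \<in> U} = N \<inter> {\<alpha>. \<alpha> 0 = p z}"
      unfolding openin_subtopology by (elim exE conjE)
    have aN: "\<alpha> \<in> N" using N(2) aX a pz zy y by (auto simp: topspace_path_space_from)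
    obtain V0 V1 where V: "openin X V0" "\<alpha> 0 \<in> V0" "openin X V1" "\<alpha> 1 \<in> V1"
      "\<forall>a\<in>V0. \<forall>b\<in>V1. \<exists>\<beta>\<in>N. well_ended X \<beta> \<and> \<beta> 0 = a \<and> \<beta> 1 = b"
      using we[unfolded locally_well_ended_def, THEN conjunct2, rule_format, OF conjI[OF N(1) aN]] by (elim exE conjE)
    have "V1 \<subseteq> p ` U"
    proof
      fix b assume "b \<in> V1"
      then obtain \<beta> where b: "\<beta> \<in> N" "\<beta> 0 = p z" "\<beta> 1 = b" using V a pz by auto
      then have "\<beta> \<in> {\<alpha> \<in> topspace (path_space_from X (p z)). tr z \<alpha> \<in> U}" unfolding N(2) by simp
      then show "b \<in> p ` U" using p_tr[OF zE, of \<beta>] b by (auto simp: topspace_path_space_from intro!: image_eqI[of b p "tr z \<beta>"])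
    qed
    then show "\<exists>T. openin X T \<and> x \<in> T \<and> T \<subseteq> p ` U" using V a y by (intro exI[of _ V1]) simp
  qed
qed

text \<open>Two transports with the same end stay equal under perturbations with common ends, because the
  stabilizer is open: consider the loop \<open>\<delta>' \<beta>'\<^sup>-\<^sup>1 \<beta> \<delta>\<^sup>-\<^sup>1\<close>.\<close>

lemma tr_locally_equal:
  assumes y: "y \<in> E" and b: "\<beta> \<in> paths X" "\<beta> 0 = p y"
    and z: "z \<in> E" and d: "\<delta> \<in> paths X" "\<delta> 0 = p z" and e: "tr z \<delta> = tr y \<beta>"
  obtains M N where "openin (path_space X) M" "\<delta> \<in> M" "openin (path_space X) N" "\<beta> \<in> N"
    "\<And>\<delta>' \<beta>'. \<lbrakk>\<delta>' \<in> M; \<beta>' \<in> N; \<delta>' 0 = p z; \<beta>' 0 = p y; \<delta>' 1 = \<beta>' 1\<rbrakk> \<Longrightarrow> tr z \<delta>' = tr y \<beta>'"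
proof -
  have bd1: "\<delta> 1 = \<beta> 1" using p_tr[OF y b] p_tr[OF z d] e by simp
  \<comment> \<open>The pairs for which the four concatenations match; on this subspace the loop
    depends continuously on both paths.\<close>
  let ?C = "{w. fst w 0 = p z \<and> snd w 0 = p y \<and> fst w 1 = snd w 1}"
  define Z where "Z = subtopology (prod_topology (path_space X) (path_space X)) ?C"
  let ?f = "\<lambda>w. path_concat (path_concat (fst w) (path_reverse (snd w))) (path_concat \<beta> (path_reverse \<delta>))"
  have fs: "continuous_map Z (path_space X) fst" "continuous_map Z (path_space X) snd"
    unfolding Z_def by (intro continuous_map_from_subtopology continuous_map_fst continuous_map_snd)+
  have ZC: "topspace Z = {w. fst w \<in> paths X \<and> snd w \<in> paths X \<and> w \<in> ?C}"
    by (auto simp: Z_def)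
  have bd: "path_concat \<beta> (path_reverse \<delta>) \<in> paths X"
    by (intro path_concat_in path_reverse_in b d) (simp add: bd1)
  have f: "continuous_map Z (path_space_between X (p z) (p z)) ?f"
    unfolding continuous_map_path_space_between
  proof
    show "continuous_map Z (path_space X) ?f"
      by (intro continuous_map_path_concat continuous_map_path_reverse fs continuous_map_constant bd)
        (auto simp: ZC b)
  qed (simp add: ZC d)
  have "openin Z {w \<in> topspace Z. ?f w \<in> {\<alpha> \<in> topspace (path_space_between X (p z) (p z)). tr z \<alpha> = z}}"
    by (rule openin_continuous_map_preimage[OF f stabilizer_open[OF z]])
  then obtain S where S: "openin (prod_topology (path_space X) (path_space X)) S"
    "{w \<in> topspace Z. ?f w \<in> {\<alpha> \<in> topspace (path_space_between X (p z) (p z)). tr z \<alpha> = z}} = S \<inter> ?C"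
    unfolding Z_def openin_subtopology by (elim exE conjE)
  have tr_f: "tr z (?f (\<delta>', \<beta>')) = tr (tr (tr (tr z \<delta>') (path_reverse \<beta>')) \<beta>) (path_reverse \<delta>)"
    and tr_E: "tr z \<delta>' \<in> E" "tr (tr z \<delta>') (path_reverse \<beta>') \<in> E" "p (tr (tr z \<delta>') (path_reverse \<beta>')) = p y"
      "p (tr z \<delta>') = \<delta>' 1"
    if "\<delta>' \<in> paths X" "\<beta>' \<in> paths X" "\<delta>' 0 = p z" "\<beta>' 0 = p y" "\<delta>' 1 = \<beta>' 1" for \<delta>' \<beta>'
  proof -
    note rb = path_reverse_in[OF that(2)]
    show 1: "tr z \<delta>' \<in> E" "p (tr z \<delta>') = \<delta>' 1" using tr_in[OF z that(1,3)] p_tr[OF z that(1,3)] by auto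
    show 2: "tr (tr z \<delta>') (path_reverse \<beta>') \<in> E" "p (tr (tr z \<delta>') (path_reverse \<beta>')) = p y"
      using tr_in[OF 1(1) rb] p_tr[OF 1(1) rb] 1 that by simp_all
    have "tr z (?f (\<delta>', \<beta>')) = tr (tr z (path_concat \<delta>' (path_reverse \<beta>'))) (path_concat \<beta> (path_reverse \<delta>))"
      using tr_concat[OF z path_concat_in[OF that(1) rb] bd] that b by simp
    also have "tr z (path_concat \<delta>' (path_reverse \<beta>')) = tr (tr z \<delta>') (path_reverse \<beta>')"
      using tr_concat[OF z that(1) rb] that by simp
    also have "tr (tr (tr z \<delta>') (path_reverse \<beta>')) (path_concat \<beta> (path_reverse \<delta>))
      = tr (tr (tr (tr z \<delta>') (path_reverse \<beta>')) \<beta>) (path_reverse \<delta>)"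
      using tr_concat[OF 2(1) b(1) path_reverse_in[OF d(1)]] 2 b bd1 by simp
    finally show "tr z (?f (\<delta>', \<beta>')) = tr (tr (tr (tr z \<delta>') (path_reverse \<beta>')) \<beta>) (path_reverse \<delta>)" .
  qed
  \<comment> \<open>At the unperturbed pair, the outward and return transports cancel because both
    paths lead to the same point, so this pair lies in the open set.\<close>
  have "tr z (?f (\<delta>, \<beta>)) = z"
    unfolding tr_f[OF d(1) b(1) d(2) b(2) bd1] using e tr_reverse[OF y b] tr_reverse[OF z d] by simp
  moreover have "(\<delta>, \<beta>) \<in> topspace Z" using b d bd1 by (simp add: ZC)
  ultimately have "(\<delta>, \<beta>) \<in> S"
    using S(2) continuous_map_in_topspace[OF f] by auto
  from S(1) this show thesis
  proof (rule openin_prod_topologyE)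
    fix M N assume M: "openin (path_space X) M" "openin (path_space X) N" "\<delta> \<in> M" "\<beta> \<in> N"
      and MN: "\<And>u v. u \<in> M \<Longrightarrow> v \<in> N \<Longrightarrow> (u, v) \<in> S"
    show thesis
    proof (rule that[OF M(1,3,2,4)])
      fix \<delta>' \<beta>' assume *: "\<delta>' \<in> M" "\<beta>' \<in> N" "\<delta>' 0 = p z" "\<beta>' 0 = p y" "\<delta>' 1 = \<beta>' 1"
      then have X: "\<delta>' \<in> paths X" "\<beta>' \<in> paths X"
        using openin_subset[OF M(1)] openin_subset[OF M(2)] by auto
      have "(\<delta>', \<beta>') \<in> S \<inter> ?C" using MN * by simp
      then have f: "tr z (?f (\<delta>', \<beta>')) = z" unfolding S(2)[symmetric] by simp
      note E = tr_E[OF X *(3,4,5)]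
      \<comment> \<open>The point reached halfway around the loop. Injectivity of transport strips
        off first the inverse of \<delta> and then \<beta>, giving \<open>?u = y\<close>; running
        the remaining half backwards yields the claim.\<close>
      let ?u = "tr (tr z \<delta>') (path_reverse \<beta>')"
      have ub: "tr ?u \<beta> \<in> E" "p (tr ?u \<beta>) = \<beta> 1" using tr_in[OF E(2) b(1)] p_tr[OF E(2) b(1)] E b by simp_all
      have "tr (tr ?u \<beta>) (path_reverse \<delta>) = tr (tr y \<beta>) (path_reverse \<delta>)"
        using f tr_reverse[OF z d] e unfolding tr_f[OF X *(3,4,5)] by simp
      then have "tr ?u \<beta> = tr y \<beta>"
        using ub bd1 p_tr[OF y b]
        by (intro tr_inj[OF ub(1) tr_in[OF y b] path_reverse_in[OF d(1)]]) simp_all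
      then have u: "?u = y" using E b by (intro tr_inj[OF E(2) y b(1)]) simp_all
      then show "tr z \<delta>' = tr y \<beta>'"
        using tr_reverse'[OF E(1) X(2)] E *(5) by simp
    qed
  qed
qed

section \<open>Sheets over open sets of X\<close>

definition sheet where
  "sheet y N V = {tr y \<beta> | \<beta>. \<beta> \<in> N \<and> \<beta> 0 = p y \<and> \<beta> 1 \<in> V}"

lemma sheet_inj:
  assumes N: "openin (path_space X) N" and y: "y \<in> E"
    and inj: "\<And>\<beta> \<beta>'. \<lbrakk>\<beta> \<in> N; \<beta>' \<in> N; \<beta> 0 = p y; \<beta>' 0 = p y; \<beta> 1 = \<beta>' 1\<rbrakk> \<Longrightarrow> tr y \<beta> = tr y \<beta>'"
  shows "inj_on p (sheet y N V)"
proof (rule inj_onI)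
  fix u v assume "u \<in> sheet y N V" "v \<in> sheet y N V" and uv: "p u = p v"
  then obtain \<beta> \<beta>' where *: "u = tr y \<beta>" "\<beta> \<in> N" "\<beta> 0 = p y" "v = tr y \<beta>'" "\<beta>' \<in> N" "\<beta>' 0 = p y"
    unfolding sheet_def by blast
  moreover have "\<beta> \<in> paths X" "\<beta>' \<in> paths X"
    using * openin_subset[OF N] by auto
  ultimately have "\<beta> 1 = \<beta>' 1" using uv p_tr[OF y, of \<beta>] p_tr[OF y, of \<beta>'] by simp
  then show "u = v" using inj[OF *(2,5,3,6)] *(1,4) by simp
qed

text \<open>Openness has to be tested for every \<open>z\<close> and every path \<delta> whose
  transport ends in the sheet. For \<delta>' near \<delta> one needs a path in \<open>N\<close> near
  \<beta>, from \<open>p y\<close> to the end of \<delta>'. Well-endedness of \<beta> provides it,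
  and \<open>tr_locally_equal\<close> identifies the transports.\<close>

lemma openin_sheet:
  assumes N: "openin (path_space X) N" and y: "y \<in> E" and V: "openin X V"
    and inj: "\<And>\<beta> \<beta>'. \<lbrakk>\<beta> \<in> N; \<beta>' \<in> N; \<beta> 0 = p y; \<beta>' 0 = p y; \<beta> 1 = \<beta>' 1\<rbrakk> \<Longrightarrow> tr y \<beta> = tr y \<beta>'"
    and we: "\<And>b. b \<in> V \<Longrightarrow> \<exists>\<beta>\<in>N. well_ended X \<beta> \<and> \<beta> 0 = p y \<and> \<beta> 1 = b"
  shows "openin total (sheet y N V)"
  unfolding openin_total
proof (intro conjI ballI)
  have NX: "N \<subseteq> paths X" by (rule openin_subset[OF N])
  then show "sheet y N V \<subseteq> E" using tr_in[OF y] by (auto simp: sheet_def)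
  fix z assume z: "z \<in> E"
  show "openin (path_space_from X (p z)) {\<alpha> \<in> topspace (path_space_from X (p z)). tr z \<alpha> \<in> sheet y N V}"
  proof (subst openin_subopen, rule ballI)
    fix \<delta> assume "\<delta> \<in> {\<alpha> \<in> topspace (path_space_from X (p z)). tr z \<alpha> \<in> sheet y N V}"
    then have d: "\<delta> \<in> paths X" "\<delta> 0 = p z" and "tr z \<delta> \<in> sheet y N V"
      by (auto simp: topspace_path_space_from)
    then obtain \<beta>0 where b0: "tr z \<delta> = tr y \<beta>0" "\<beta>0 \<in> N" "\<beta>0 0 = p y" "\<beta>0 1 \<in> V" unfolding sheet_def by blast
    \<comment> \<open>The path witnessing membership need not be well-ended, so it is exchanged for
      a well-ended one with the same end; by \<open>inj\<close> this does not change the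
      transport.\<close>
    obtain \<beta> where b: "\<beta> \<in> N" "well_ended X \<beta>" "\<beta> 0 = p y" "\<beta> 1 = \<beta>0 1" using we[OF b0(4)] by blast
    have bX: "\<beta> \<in> paths X" using NX b(1) by auto
    have e: "tr z \<delta> = tr y \<beta>" using inj[OF b0(2) b(1) b0(3) b(3)] b b0 by simp
    then have d1: "\<delta> 1 = \<beta> 1" using p_tr[OF z d] p_tr[OF y bX b(3)] by simp
    show "\<exists>T. openin (path_space_from X (p z)) T \<and> \<delta> \<in> T \<and> T \<subseteq> {\<alpha> \<in> topspace (path_space_from X (p z)). tr z \<alpha> \<in> sheet y N V}"
    proof (rule tr_locally_equal[OF y bX b(3) z d e])
      fix M N' assume M: "openin (path_space X) M" "\<delta> \<in> M" "openin (path_space X) N'" "\<beta> \<in> N'"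
        and MN: "\<And>\<delta>' \<beta>'. \<lbrakk>\<delta>' \<in> M; \<beta>' \<in> N'; \<delta>' 0 = p z; \<beta>' 0 = p y; \<delta>' 1 = \<beta>' 1\<rbrakk> \<Longrightarrow> tr z \<delta>' = tr y \<beta>'"
      have "openin (path_space X) (N' \<inter> N) \<and> \<beta> \<in> N' \<inter> N" using M N b by (auto intro: openin_Int)
      from b(2)[unfolded well_ended_def, THEN conjunct2, rule_format, OF this]
      obtain V0 V1 where VV: "openin X V0" "\<beta> 0 \<in> V0" "openin X V1" "\<beta> 1 \<in> V1"
        "\<forall>a\<in>V0. \<forall>c\<in>V1. \<exists>\<gamma>\<in>N' \<inter> N. \<gamma> 0 = a \<and> \<gamma> 1 = c" by (elim exE conjE)
      have "openin (path_space_from X (p z)) {\<alpha> \<in> topspace (path_space_from X (p z)). \<alpha> 1 \<in> V1 \<inter> V}"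
        by (rule openin_continuous_map_preimage[OF continuous_map_end openin_Int[OF VV(3) V]])
      moreover have "openin (path_space_from X (p z)) ({\<alpha>. \<alpha> 0 = p z} \<inter> M)"
        unfolding path_space_from_def by (rule openin_subtopology_Int2[OF M(1)])
      ultimately have "openin (path_space_from X (p z))
          ({\<alpha> \<in> topspace (path_space_from X (p z)). \<alpha> 1 \<in> V1 \<inter> V} \<inter> ({\<alpha>. \<alpha> 0 = p z} \<inter> M))" (is "openin _ ?T")
        by (rule openin_Int)
      moreover have "\<delta> \<in> ?T" using d M VV d1 b b0 by (simp add: topspace_path_space_from)
      moreover have "tr z \<delta>' \<in> sheet y N V" if "\<delta>' \<in> ?T" for \<delta>'
      proof -
        have *: "\<delta>' \<in> M" "\<delta>' 0 = p z" "\<delta>' 1 \<in> V1" "\<delta>' 1 \<in> V" using that by auto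
        obtain \<gamma> where g: "\<gamma> \<in> N'" "\<gamma> \<in> N" "\<gamma> 0 = p y" "\<gamma> 1 = \<delta>' 1" using VV(5) VV(2) *(3) b(3) by auto
        have "tr z \<delta>' = tr y \<gamma>" by (rule MN) (use * g in simp_all)
        then show ?thesis unfolding sheet_def using g * by (intro CollectI exI[of _ \<gamma>]) simp
      qed
      ultimately show ?thesis by (intro exI[of _ ?T]) blast
    qed
  qed
qed

text \<open>For equal points this gives local injectivity of \<open>p\<close>; for distinct points
  of a fibre it gives disjoint sheets over the same base set. The latter separation within fibres is
  what unique lifting requires, \<open>X\<close> not being assumed Hausdorff.\<close>

lemma sheets:
  assumes y: "y1 \<in> E" "y2 \<in> E" and e: "p y1 = p y2"
  obtains W1 W2 where "openin total W1" "y1 \<in> W1" "inj_on p W1" "openin total W2" "y2 \<in> W2" "inj_on p W2"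
    "p ` W1 = p ` W2" "y1 \<noteq> y2 \<Longrightarrow> W1 \<inter> W2 = {}"
proof -
  obtain \<alpha> where we: "locally_well_ended X \<alpha>" and a: "\<alpha> 0 = p y1" "\<alpha> 1 = p y1"
    using wep p_in[OF y(1)] unfolding locally_wep_connected_def by blast
  have aX: "\<alpha> \<in> paths X" using we by (simp add: locally_well_ended_def)
  have "\<exists>z N. z \<in> E \<and> p z = p y1 \<and> tr z \<alpha> = y \<and> openin (path_space X) N \<and> \<alpha> \<in> N \<and>
     (\<forall>\<beta>\<in>N. \<forall>\<beta>'\<in>N. \<beta> 0 = p y1 \<and> \<beta>' 0 = p y1 \<and> \<beta> 1 = \<beta>' 1 \<longrightarrow> tr z \<beta> = tr z \<beta>')"
    if yE: "y \<in> E" and py: "p y = p y1" for y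
  proof -
    define z where "z = tr y (path_reverse \<alpha>)"
    have zE: "z \<in> E" and pz: "p z = p y1" and zy: "tr z \<alpha> = y"
      using tr_in[OF yE path_reverse_in[OF aX]] p_tr[OF yE path_reverse_in[OF aX]] tr_reverse'[OF yE aX] a py
      by (simp_all add: z_def)
    have az: "\<alpha> 0 = p z" using a pz by simp
    show ?thesis
    \<comment> \<open>Taking \<alpha> for both paths shows that, close to \<alpha>, the transport of
      \<open>z\<close> depends on the end of the path only.\<close>
    proof (rule tr_locally_equal[OF zE aX az zE aX az refl])
      fix M N assume MN: "openin (path_space X) M" "\<alpha> \<in> M" "openin (path_space X) N" "\<alpha> \<in> N"
        "\<And>\<delta>' \<beta>'. \<lbrakk>\<delta>' \<in> M; \<beta>' \<in> N; \<delta>' 0 = p z; \<beta>' 0 = p z; \<delta>' 1 = \<beta>' 1\<rbrakk> \<Longrightarrow> tr z \<delta>' = tr z \<beta>'"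
      have "\<forall>\<beta>\<in>M \<inter> N. \<forall>\<beta>'\<in>M \<inter> N. \<beta> 0 = p y1 \<and> \<beta>' 0 = p y1 \<and> \<beta> 1 = \<beta>' 1 \<longrightarrow> tr z \<beta> = tr z \<beta>'"
        by (intro ballI impI, rule MN(5)) (simp_all add: pz)
      then show ?thesis using zE pz zy MN openin_Int by (intro exI[of _ z] exI[of _ "M \<inter> N"]) blast
    qed
  qed
  note * = this
  obtain z1 N1 where z1: "z1 \<in> E" "p z1 = p y1" "tr z1 \<alpha> = y1" "openin (path_space X) N1" "\<alpha> \<in> N1"
    "\<forall>\<beta>\<in>N1. \<forall>\<beta>'\<in>N1. \<beta> 0 = p y1 \<and> \<beta>' 0 = p y1 \<and> \<beta> 1 = \<beta>' 1 \<longrightarrow> tr z1 \<beta> = tr z1 \<beta>'"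
    using *[OF y(1) refl] by (elim exE conjE)
  obtain z2 N2 where z2: "z2 \<in> E" "p z2 = p y1" "tr z2 \<alpha> = y2" "openin (path_space X) N2" "\<alpha> \<in> N2"
    "\<forall>\<beta>\<in>N2. \<forall>\<beta>'\<in>N2. \<beta> 0 = p y1 \<and> \<beta>' 0 = p y1 \<and> \<beta> 1 = \<beta>' 1 \<longrightarrow> tr z2 \<beta> = tr z2 \<beta>'"
    using *[OF y(2) e[symmetric]] by (elim exE conjE)
  \<comment> \<open>A common neighbourhood for both points, so that one \<open>V1\<close> is the
    image of both sheets.\<close>
  let ?N = "N1 \<inter> N2"
  have N: "openin (path_space X) ?N" "\<alpha> \<in> ?N" using z1 z2 by (auto intro: openin_Int)
  obtain V0 V1 where V: "openin X V0" "\<alpha> 0 \<in> V0" "openin X V1" "\<alpha> 1 \<in> V1"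
      "\<forall>a\<in>V0. \<forall>b\<in>V1. \<exists>\<beta>\<in>?N. well_ended X \<beta> \<and> \<beta> 0 = a \<and> \<beta> 1 = b"
    using we[unfolded locally_well_ended_def, THEN conjunct2, rule_format, OF conjI[OF N]] by (elim exE conjE)
  have sh: "openin total (sheet z ?N V1) \<and> tr z \<alpha> \<in> sheet z ?N V1 \<and> inj_on p (sheet z ?N V1) \<and> p ` sheet z ?N V1 = V1"
    if z: "z \<in> E" "p z = p y1" and inj: "\<And>\<beta> \<beta>'. \<lbrakk>\<beta> \<in> ?N; \<beta>' \<in> ?N; \<beta> 0 = p z; \<beta>' 0 = p z; \<beta> 1 = \<beta>' 1\<rbrakk> \<Longrightarrow> tr z \<beta> = tr z \<beta>'"
    for z
  proof (intro conjI)
    have w: "\<exists>\<beta>\<in>?N. well_ended X \<beta> \<and> \<beta> 0 = p z \<and> \<beta> 1 = b" if "b \<in> V1" for b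
      using V(5) V(2) that a z by auto
    show "openin total (sheet z ?N V1)" by (rule openin_sheet[OF N(1) z(1) V(3) inj w])
    show "inj_on p (sheet z ?N V1)" by (rule sheet_inj[OF N(1) z(1) inj])
    show "tr z \<alpha> \<in> sheet z ?N V1" unfolding sheet_def using N V a z by (intro CollectI exI[of _ \<alpha>]) simp
    show "p ` sheet z ?N V1 = V1"
    proof (intro equalityI subsetI)
      fix b assume "b \<in> p ` sheet z ?N V1"
      then obtain \<beta> where "b = p (tr z \<beta>)" "\<beta> \<in> ?N" "\<beta> 0 = p z" "\<beta> 1 \<in> V1" unfolding sheet_def by blast
      then show "b \<in> V1" using p_tr[OF z(1), of \<beta>] openin_subset[OF N(1)] by auto
    next
      fix b assume "b \<in> V1"
      then obtain \<beta> where b: "\<beta> \<in> ?N" "\<beta> 0 = p z" "\<beta> 1 = b" using w by blast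
      then have "b = p (tr z \<beta>)" using p_tr[OF z(1), of \<beta>] openin_subset[OF N(1)] by auto
      moreover have "tr z \<beta> \<in> sheet z ?N V1"
        unfolding sheet_def using b \<open>b \<in> V1\<close> by (intro CollectI exI[of _ \<beta>]) simp
      ultimately show "b \<in> p ` sheet z ?N V1" by (rule image_eqI)
    qed
  qed
  have s1: "openin total (sheet z1 ?N V1) \<and> tr z1 \<alpha> \<in> sheet z1 ?N V1 \<and> inj_on p (sheet z1 ?N V1) \<and> p ` sheet z1 ?N V1 = V1"
    by (rule sh[OF z1(1,2)]) (use z1(6) in \<open>unfold z1(2), blast\<close>)
  have s2: "openin total (sheet z2 ?N V1) \<and> tr z2 \<alpha> \<in> sheet z2 ?N V1 \<and> inj_on p (sheet z2 ?N V1) \<and> p ` sheet z2 ?N V1 = V1"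
    by (rule sh[OF z2(1,2)]) (use z2(6) in \<open>unfold z2(2), blast\<close>)
  show thesis
  proof (rule that)
    show "openin total (sheet z1 ?N V1)" "y1 \<in> sheet z1 ?N V1" "inj_on p (sheet z1 ?N V1)"
      "openin total (sheet z2 ?N V1)" "y2 \<in> sheet z2 ?N V1" "inj_on p (sheet z2 ?N V1)"
      "p ` sheet z1 ?N V1 = p ` sheet z2 ?N V1"
      using s1 s2 z1(3) z2(3) by auto
    assume ne: "y1 \<noteq> y2"
    show "sheet z1 ?N V1 \<inter> sheet z2 ?N V1 = {}"
    proof (rule ccontr)
      assume "sheet z1 ?N V1 \<inter> sheet z2 ?N V1 \<noteq> {}"
      then obtain w where "w \<in> sheet z1 ?N V1" "w \<in> sheet z2 ?N V1" by blast
      then obtain \<beta> \<beta>' where b: "w = tr z1 \<beta>" "\<beta> \<in> ?N" "\<beta> 0 = p z1" "w = tr z2 \<beta>'" "\<beta>' \<in> ?N" "\<beta>' 0 = p z2"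
        unfolding sheet_def by blast
      then have bX: "\<beta> \<in> paths X" "\<beta>' \<in> paths X" using openin_subset[OF N(1)] by auto
      have "\<beta> 1 = \<beta>' 1" using p_tr[OF z1(1) bX(1) b(3)] p_tr[OF z2(1) bX(2) b(6)] b(1,4) by simp
      \<comment> \<open>Paths in \<open>?N\<close> with the same end transport \<open>z2\<close>
        equally, so a common point is reached from \<open>z1\<close> and \<open>z2\<close> along the
        same path, and injectivity of transport forces the starts to agree.\<close>
      then have "tr z2 \<beta> = tr z2 \<beta>'" using z2(6)[rule_format, of \<beta> \<beta>'] b z1(2) z2(2) by simp
      then have "z1 = z2" using b z1(2) z2(2) by (intro tr_inj[OF z1(1) z2(1) bX(1)]) simp_all
      then show False using z1(3) z2(3) ne by simp
    qed
  qed
qed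

section \<open>Local homeomorphism and lifting of maps\<close>

lemma local_homeomorphism_p: "local_homeomorphism total X p"
  unfolding local_homeomorphism_def
proof (intro conjI ballI)
  fix y assume "y \<in> topspace total"
  then have y: "y \<in> E" by (simp add: topspace_total)
  obtain W where W: "openin total W" "y \<in> W" "inj_on p W" using sheets[OF y y refl] by metis
  have pW: "openin X (p ` W)" using open_map_p W(1) by (simp add: open_map_def)
  have tW: "topspace (subtopology total W) = W" "topspace (subtopology X (p ` W)) = p ` W"
    using openin_subset[OF W(1)] openin_subset[OF pW] by (auto simp: topspace_subtopology)
  have "homeomorphic_map (subtopology total W) (subtopology X (p ` W)) p"
  proof (rule bijective_open_imp_homeomorphic_map)
    show "continuous_map (subtopology total W) (subtopology X (p ` W)) p"
      using tW by (intro continuous_map_into_subtopology continuous_map_from_subtopology continuous_map_p) auto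
    show "open_map (subtopology total W) (subtopology X (p ` W)) p"
      unfolding open_map_def openin_open_subtopology[OF W(1)] openin_open_subtopology[OF pW]
      using open_map_p by (auto simp: open_map_def)
  qed (simp_all only: tW W)
  then show "\<exists>V. openin total V \<and> y \<in> V \<and> openin X (p ` V) \<and> homeomorphic_map (subtopology total V) (subtopology X (p ` V)) p"
    using W pW by blast
qed (rule continuous_map_p)

text \<open>The set of agreement is both open and closed: equal values share a sheet on which
  \<open>p\<close> is injective, and distinct values over one point lie in disjoint sheets.
  Connectedness of the interval does the rest.\<close>

lemma unique_lift:
  assumes f: "continuous_map unit_interval total f" and g: "continuous_map unit_interval total g"
    and e: "\<And>t. t \<in> {0..1} \<Longrightarrow> p (f t) = p (g t)" and start: "f 0 = g 0" and t: "t \<in> {0..1}"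
  shows "f t = g t"
proof -
  let ?S = "{t \<in> topspace unit_interval. f t = g t}"
  have fg: "f s \<in> E" "g s \<in> E" if "s \<in> {0..1}" for s
    using continuous_map_in_topspace[OF f] continuous_map_in_topspace[OF g] that by (simp_all add: topspace_total)
  \<comment> \<open>Both halves are treated at once: the truth value of agreement is locally
    constant.\<close>
  have "\<exists>T. openin unit_interval T \<and> s \<in> T \<and> T \<subseteq> {t \<in> topspace unit_interval. (f t = g t) = (f s = g s)}"
    if s: "s \<in> {0..1}" for s
  proof (rule sheets[OF fg[OF s] e[OF s]])
    fix W1 W2 assume W: "openin total W1" "f s \<in> W1" "inj_on p W1" "openin total W2" "g s \<in> W2" "inj_on p W2"
      "p ` W1 = p ` W2" "f s \<noteq> g s \<Longrightarrow> W1 \<inter> W2 = {}"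
    let ?T = "{t \<in> topspace unit_interval. f t \<in> W1} \<inter> {t \<in> topspace unit_interval. g t \<in> (if f s = g s then W1 else W2)}"
    have "openin unit_interval ?T"
      using W by (intro openin_Int openin_continuous_map_preimage[OF f] openin_continuous_map_preimage[OF g]) auto
    moreover have "s \<in> ?T" using W s by auto
    moreover have fgt: "(f t = g t) = (f s = g s)" if "t \<in> ?T" for t
    proof (cases "f s = g s")
      case True
      then have "f t \<in> W1" "g t \<in> W1" "t \<in> {0..1}" using that by auto
      then have "f t = g t" using inj_onD[OF W(3) e] by blast
      then show ?thesis using True by simp
    next
      case False
      then have "f t \<in> W1" "g t \<in> W2" using that by auto
      then show ?thesis using W(8)[OF False] False by auto
    qed
    moreover have "?T \<subseteq> {t \<in> topspace unit_interval. (f t = g t) = (f s = g s)}"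
    proof
      fix t assume t: "t \<in> ?T"
      then show "t \<in> {t \<in> topspace unit_interval. (f t = g t) = (f s = g s)}"
        by (intro CollectI conjI fgt) auto
    qed
    ultimately show ?thesis by (intro exI[of _ ?T] conjI)
  qed
  note loc = this
  have "openin unit_interval ?S"
  proof (subst openin_subopen, rule ballI)
    fix s assume "s \<in> ?S"
    then show "\<exists>T. openin unit_interval T \<and> s \<in> T \<and> T \<subseteq> ?S" using loc[of s] by auto
  qed
  moreover have "openin unit_interval (topspace unit_interval - ?S)"
  proof (subst openin_subopen, rule ballI)
    fix s assume s: "s \<in> topspace unit_interval - ?S"
    then obtain T where "openin unit_interval T" "s \<in> T" "T \<subseteq> {t \<in> topspace unit_interval. (f t = g t) = (f s = g s)}"
      using loc[of s] by auto
    then show "\<exists>T. openin unit_interval T \<and> s \<in> T \<and> T \<subseteq> topspace unit_interval - ?S" using s by blast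
  qed
  then have "closedin unit_interval ?S" by (auto simp: closedin_def)
  moreover have con: "connected_space unit_interval"
    using connected_Icc[of 0 "1::real"] by (simp add: connected_space_subtopology flip: connectedin_iff_connected)
  ultimately have "openin unit_interval ?S \<and> closedin unit_interval ?S" by (intro conjI)
  then have "?S = {} \<or> ?S = topspace unit_interval"
    by (rule mp[OF spec[OF iffD1[OF connected_space_clopen_in con]]])
  moreover have "0 \<in> ?S" by (rule CollectI, rule conjI) (simp, rule start)
  ultimately have "?S = topspace unit_interval" by (metis empty_iff)
  then have "t \<in> ?S" using t by (metis topspace_subtopology_subset topspace_euclidean subset_UNIV)
  then show ?thesis by (elim CollectE conjE)
qed

text \<open>The value at \<open>k\<close> is the transport of \<open>y\<close> along the segment
  from 0 to \<open>k\<close>, which is meaningful for \<open>S\<close> star-shaped about 0 and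
  \<open>\<phi> 0 = p y\<close>. A whole map is thus lifted in one formula, continuous in the map
  and the point together.\<close>

definition ray_lift :: "'k::real_vector set \<Rightarrow> 'b \<Rightarrow> ('k \<Rightarrow> 'a) \<Rightarrow> 'k \<Rightarrow> 'b" where
  "ray_lift S y \<phi> = (\<lambda>k\<in>S. tr y (\<lambda>u\<in>{0..1}. \<phi> (u *\<^sub>R k)))"

text \<open>One statement for both kinds of lifting: \<open>S\<close> is the interval with
  \<open>B\<close> the origin, or the triangle with \<open>B\<close> its edge on the second axis.
  Compactness of \<open>S\<close> makes evaluation continuous, so the rays depend continuously on
  \<open>\<phi>\<close> and \<open>k\<close>; uniqueness is checked along each ray.\<close>

lemma lifting_homeomorphic_map:
  fixes S :: "'k::real_normed_vector set"
  assumes S: "compact S" and star: "\<And>k u. \<lbrakk>k \<in> S; 0 \<le> u; u \<le> 1\<rbrakk> \<Longrightarrow> u *\<^sub>R k \<in> S"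
    and B: "0 \<in> B" "B \<subseteq> S" "\<And>k u. \<lbrakk>k \<in> B; 0 \<le> u; u \<le> 1\<rbrakk> \<Longrightarrow> u *\<^sub>R k \<in> B" and y: "y \<in> E"
  shows "homeomorphic_map (subtopology (compact_open_topology (top_of_set S) total) {\<psi>. \<psi> ` B = {y}})
    (subtopology (compact_open_topology (top_of_set S) X) {\<phi>. \<phi> ` B = {p y}}) (compose S p)"
proof -
  let ?K = "top_of_set S"
  let ?A = "subtopology (compact_open_topology ?K X) {\<phi>. \<phi> ` B = {p y}}"
  let ?Y = "subtopology (compact_open_topology ?K total) {\<psi>. \<psi> ` B = {y}}"
  have S0: "0 \<in> S" using B by auto
  have tA: "topspace ?A = {\<phi> \<in> maps ?K X. \<phi> ` B = {p y}}" and tY: "topspace ?Y = {\<psi> \<in> maps ?K total. \<psi> ` B = {y}}"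
    by auto
  have A0: "\<phi> 0 = p y" if "\<phi> \<in> topspace ?A" for \<phi> using that B(1) by (auto simp: tA)
  have sc: "continuous_map (prod_topology (prod_topology Z ?K) unit_interval) ?K (\<lambda>w. snd w *\<^sub>R snd (fst w))"
    for Z :: "'z topology"
  proof -
    have c1: "continuous_map (prod_topology (prod_topology Z ?K) unit_interval) (prod_topology ?K unit_interval)
        (\<lambda>w. (snd (fst w), snd w))"
      by (rule continuous_map_pairedI[OF continuous_map_compose[OF continuous_map_fst continuous_map_snd, unfolded o_def]
          continuous_map_snd])
    have c2: "continuous_map (prod_topology ?K unit_interval) ?K (\<lambda>v. snd v *\<^sub>R fst v)"
      using star by (auto simp: continuous_map_in_subtopology subtopology_Times intro!: continuous_intros)
    show ?thesis using continuous_map_compose[OF c1 c2] by (simp add: o_def)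
  qed
  have ray: "continuous_map (prod_topology ?A ?K) (path_space_from X (p y)) (\<lambda>w. \<lambda>u\<in>{0..1}. fst w (u *\<^sub>R snd w))"
    unfolding continuous_map_path_space_from
  proof
    show "continuous_map (prod_topology ?A ?K) (path_space X) (\<lambda>w. \<lambda>u\<in>{0..1}. fst w (u *\<^sub>R snd w))"
    proof (rule continuous_map_curry_path)
      have c: "continuous_map (prod_topology (prod_topology ?A ?K) unit_interval) (compact_open_topology ?K X) (\<lambda>w. fst (fst w))"
        using continuous_map_compose[OF continuous_map_compose[OF continuous_map_fst continuous_map_fst]
            continuous_map_from_subtopology[OF continuous_map_id]] by (simp add: o_def)
      have "continuous_map (prod_topology (prod_topology ?A ?K) unit_interval) X (\<lambda>w. (fst (fst w)) (snd w *\<^sub>R snd (fst w)))"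
        by (rule continuous_map_eval_compose[OF S c sc])
      then show "continuous_map (prod_topology (prod_topology ?A ?K) unit_interval) X (\<lambda>(w, u). fst w (u *\<^sub>R snd w))"
        by (simp add: case_prod_unfold)
    qed
  qed (use A0 in auto)
  have lift: "continuous_map ?A (compact_open_topology ?K total) (ray_lift S y)"
    using continuous_map_curry[of ?A ?K total "\<lambda>\<phi> k. tr y (\<lambda>u\<in>{0..1}. \<phi> (u *\<^sub>R k))"]
      continuous_map_compose[OF ray continuous_map_tr[OF y]]
    by (simp add: ray_lift_def[abs_def] o_def case_prod_unfold)
  have ray_in: "(\<lambda>u\<in>{0..1}. \<phi> (u *\<^sub>R k)) \<in> paths X" if "\<phi> \<in> topspace ?A" "k \<in> S" for \<phi> k
    using continuous_map_in_topspace[OF ray, of "(\<phi>, k)"] that by (simp add: topspace_path_space_from)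
  have pl: "compose S p (ray_lift S y \<phi>) = \<phi>" if f: "\<phi> \<in> topspace ?A" for \<phi>
  proof (rule extensionalityI[of _ S])
    show "\<phi> \<in> extensional S" using f by (simp add: tA maps_def)
    show "compose S p (ray_lift S y \<phi>) k = \<phi> k" if "k \<in> S" for k
      using p_tr[OF y ray_in[OF f that]] A0[OF f] that by (simp add: compose_def ray_lift_def)
  qed (simp add: compose_def)
  have lB: "ray_lift S y \<phi> ` B = {y}" if f: "\<phi> \<in> topspace ?A" for \<phi>
  proof -
    have "ray_lift S y \<phi> k = y" if k: "k \<in> B" for k
    proof -
      \<comment> \<open>Rays to points of \<open>B\<close> stay in \<open>B\<close>, where \<phi> is
        constant, so transport along them does nothing.\<close>
      have "(\<lambda>u\<in>{0..1}. \<phi> (u *\<^sub>R k)) = path_const (p y)"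
        using f B(3)[OF k] by (auto simp: path_const_def tA fun_eq_iff)
      then show ?thesis using k B(2) tr_const[OF y] by (auto simp: ray_lift_def)
    qed
    then show ?thesis using B(1) by auto
  qed
  have "homeomorphic_maps ?Y ?A (compose S p) (ray_lift S y)"
    unfolding homeomorphic_maps_def
  proof (intro conjI ballI)
    show cp: "continuous_map ?Y ?A (compose S p)"
    proof (intro continuous_map_into_subtopology continuous_map_from_subtopology)
      show "continuous_map (compact_open_topology ?K total) (compact_open_topology ?K X) (compose S p)"
        using continuous_map_compact_open_compose[OF continuous_map_p, of ?K] by simp
      have "compose S p \<psi> ` B = p ` \<psi> ` B" for \<psi> using B(2) by (auto simp: compose_def)
      then show "compose S p \<in> topspace ?Y \<rightarrow> {\<phi>. \<phi> ` B = {p y}}" by (simp add: tY)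
    qed
    show "continuous_map ?A ?Y (ray_lift S y)"
      using lift lB by (simp add: continuous_map_in_subtopology)
    show "compose S p (ray_lift S y \<phi>) = \<phi>" if "\<phi> \<in> topspace ?A" for \<phi> by (rule pl[OF that])
    fix \<psi> assume s: "\<psi> \<in> topspace ?Y"
    then have sm: "\<psi> \<in> maps ?K total" by (simp add: tY)
    have f: "compose S p \<psi> \<in> topspace ?A" by (rule continuous_map_in_topspace[OF cp s])
    have lm: "ray_lift S y (compose S p \<psi>) \<in> maps ?K total"
      using continuous_map_in_topspace[OF lift f] by simp
    have restr: "continuous_map unit_interval total (\<lambda>t. \<theta> (t *\<^sub>R k))" if "\<theta> \<in> maps ?K total" "k \<in> S" for \<theta> k
    proof -
      have "continuous_map unit_interval ?K (\<lambda>t. t *\<^sub>R k)"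
        using star[OF that(2)] by (auto simp: continuous_map_in_subtopology intro!: continuous_intros)
      from continuous_map_compose[OF this, of total \<theta>] that(1) show ?thesis by (simp add: maps_def o_def)
    qed
    show "ray_lift S y (compose S p \<psi>) = \<psi>"
    proof (rule extensionalityI[of _ S])
      show "\<psi> \<in> extensional S" "ray_lift S y (compose S p \<psi>) \<in> extensional S" using sm by (auto simp: maps_def ray_lift_def)
      fix k assume k: "k \<in> S"
      \<comment> \<open>The factor 1 presents \<open>k\<close> as the end of the ray t \<mapsto> t
        k, on which both lifts start at \<open>y\<close>, since 0 belongs to
        \<open>B\<close>.\<close>
      have "ray_lift S y (compose S p \<psi>) (1 *\<^sub>R k) = \<psi> (1 *\<^sub>R k)"
      proof (rule unique_lift[OF restr[OF lm k] restr[OF sm k]])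
        show "p (ray_lift S y (compose S p \<psi>) (t *\<^sub>R k)) = p (\<psi> (t *\<^sub>R k))" if "t \<in> {0..1}" for t
          using fun_cong[OF pl[OF f], of "t *\<^sub>R k"] star[OF k, of t] that by (simp add: compose_def)
        show "ray_lift S y (compose S p \<psi>) (0 *\<^sub>R k) = \<psi> (0 *\<^sub>R k)"
          using imageI[OF B(1), of \<psi>] imageI[OF B(1), of "ray_lift S y (compose S p \<psi>)"] lB[OF f] s by (simp add: tY)
      qed simp
      then show "ray_lift S y (compose S p \<psi>) k = \<psi> k" by simp
    qed
  qed
  then show ?thesis using homeomorphic_maps_map by blast
qed

lemma semicovering_total: "semicovering_map total X p"
  unfolding semicovering_map_def continuous_lifting_of_paths_def continuous_lifting_of_homotopies_def
proof (intro conjI ballI)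
  show "local_homeomorphism total X p" by (rule local_homeomorphism_p)
  fix y assume "y \<in> topspace total"
  then have y: "y \<in> E" by (simp add: topspace_total)
  have "homeomorphic_map (subtopology (compact_open_topology unit_interval total) {\<psi>. \<psi> ` {0} = {y}})
    (subtopology (compact_open_topology unit_interval X) {\<phi>. \<phi> ` {0} = {p y}}) (compose {0..1} p)"
    by (rule lifting_homeomorphic_map[OF _ _ _ _ _ y]) (auto simp: mult_le_one)
  then show "homeomorphic_map (path_space_from total y) (path_space_from X (p y)) (\<lambda>\<alpha>. compose {0..1} p \<alpha>)"
    by (simp add: path_space_from_def path_space_def)
  have "compact triangle"
  proof -
    have "triangle = {0..1} \<times> {0..1} \<inter> {w. fst w + snd w \<le> 1}" by (auto simp: triangle_def)
    moreover have "compact ({0..1} \<times> {0..1} \<inter> {w :: real \<times> real. fst w + snd w \<le> 1})"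
      by (intro compact_Int_closed compact_Times compact_Icc closed_Collect_le continuous_intros)
    ultimately show ?thesis by (simp only:)
  qed
  moreover have "u *\<^sub>R k \<in> triangle" if kT: "k \<in> triangle" and u: "0 \<le> u" "u \<le> 1" for k u
  proof -
    obtain s t where k: "k = (s, t)" "0 \<le> s" "s \<le> 1" "0 \<le> t" "t \<le> 1" "s + t \<le> 1" using kT by (auto simp: triangle_def)
    have "u * (s + t) \<le> 1" using mult_le_one[OF u(2), of "s + t"] k by simp
    then show ?thesis using k u by (auto simp: triangle_def mult_le_one distrib_left)
  qed
  moreover have "0 \<in> {(0::real, t) | t. t \<in> {0..1::real}}" by (auto simp: zero_prod_def)
  moreover have "{(0::real, t) | t. t \<in> {0..1::real}} \<subseteq> triangle" by (auto simp: triangle_def)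
  moreover have "u *\<^sub>R k \<in> {(0::real, t) | t. t \<in> {0..1::real}}"
    if "k \<in> {(0::real, t) | t. t \<in> {0..1::real}}" "0 \<le> u" "u \<le> 1" for k u
    using that by (auto simp: mult_le_one)
  ultimately have "homeomorphic_map (subtopology (compact_open_topology (top_of_set triangle) total) {\<psi>. \<psi> ` {(0, t) | t. t \<in> {0..1}} = {y}})
    (subtopology (compact_open_topology (top_of_set triangle) X) {\<phi>. \<phi> ` {(0, t) | t. t \<in> {0..1}} = {p y}}) (compose triangle p)"
    using y by (intro lifting_homeomorphic_map)
  then show "homeomorphic_map (homotopy_space_from total y) (homotopy_space_from X (p y)) (\<lambda>\<phi>. compose triangle p \<phi>)"
    by (simp add: homotopy_space_from_def)
qed

text \<open>Transporting along initial segments of the projected path and \<gamma> itself are two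
  lifts with the same start, hence equal. So path lifting in \<open>total\<close> is the given
  transport, which lets the targets of arrows be compared.\<close>

lemma tr_projection:
  assumes g: "\<gamma> \<in> paths total"
  shows "tr (\<gamma> 0) (compose {0..1} p \<gamma>) = \<gamma> 1"
proof -
  have y: "\<gamma> 0 \<in> E" using path_in_topspace[OF g, of 0] by (simp add: topspace_total)
  let ?l = "path_lift total p (\<gamma> 0)"
  let ?a = "compose {0..1} p \<gamma>"
  have aX: "?a \<in> paths X" by (rule path_compose_in[OF continuous_map_p g])
  have f: "continuous_map unit_interval (path_space_from X (p (\<gamma> 0))) (\<lambda>t. \<lambda>u\<in>{0..1}. ?a (t * u))"
    unfolding continuous_map_path_space_from
  proof
    show "continuous_map unit_interval (path_space X) (\<lambda>t. \<lambda>u\<in>{0..1}. ?a (t * u))"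
    proof (rule continuous_map_reparam)
      show "continuous_map (prod_topology unit_interval unit_interval) unit_interval (\<lambda>(t, u). t * u)"
        by (auto simp: continuous_map_in_subtopology subtopology_Times case_prod_unfold mult_le_one intro!: continuous_intros)
    qed (use aX in simp)
  qed simp
  have c: "continuous_map unit_interval total (\<lambda>t. tr (\<gamma> 0) (\<lambda>u\<in>{0..1}. ?a (t * u)))"
    using continuous_map_compose[OF f continuous_map_tr[OF y]] by (simp add: o_def)
  have gc: "continuous_map unit_interval total \<gamma>" using g by (simp add: topspace_path_space maps_def)
  have in_X: "(\<lambda>u\<in>{0..1}. ?a (t * u)) \<in> paths X" if "t \<in> {0..1}" for t
    using continuous_map_in_topspace[OF f] that by (simp add: topspace_path_space_from)
  have "tr (\<gamma> 0) (\<lambda>u\<in>{0..1}. ?a (1 * u)) = \<gamma> 1"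
  proof (rule unique_lift[OF c gc])
    show "p (tr (\<gamma> 0) (\<lambda>u\<in>{0..1}. ?a (t * u))) = p (\<gamma> t)" if "t \<in> {0..1}" for t
      using p_tr[OF y in_X[OF that]] that by (simp add: compose_def)
    have "(\<lambda>u\<in>{0..1}. ?a (0 * u)) = path_const (p (\<gamma> 0))" by (simp add: path_const_def)
    then show "tr (\<gamma> 0) (\<lambda>u\<in>{0..1}. ?a (0 * u)) = \<gamma> 0" using tr_const[OF y] by simp
  qed simp
  then show ?thesis using path_restrict[OF aX] by simp
qed

end

section \<open>Realizing open covering morphisms by semicoverings\<close>

definition cov_lift :: "('o, 'm, 'z) cat_scheme \<Rightarrow> ('m \<Rightarrow> 'n) \<Rightarrow> 'o \<Rightarrow> 'n \<Rightarrow> 'm" where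
  "cov_lift H Fa y g = (THE h. h \<in> Arr H \<and> Dom H h = y \<and> Fa h = g)"

lemma cov_lift_unique:
  assumes c: "covering_morphism H G Fo Fa" and h: "h \<in> Arr H" "Dom H h = y" "Fa h = g"
  shows "cov_lift H Fa y g = h"
  unfolding cov_lift_def
proof (rule the_equality)
  have "y \<in> Obj H" using c h by (auto simp: covering_morphism_def is_functor_def category_def)
  then have "inj_on Fa {h \<in> Arr H. Dom H h = y}" using c by (simp add: covering_morphism_def bij_betw_def)
  then show "k = h" if "k \<in> Arr H \<and> Dom H k = y \<and> Fa k = g" for k
    using that h by (intro inj_onD[of Fa "{h \<in> Arr H. Dom H h = y}"]) simp_all
qed (use h in simp)

lemma cov_lift:
  assumes c: "covering_morphism H G Fo Fa" and y: "y \<in> Obj H" and g: "g \<in> Arr G" "Dom G g = Fo y"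
  shows "cov_lift H Fa y g \<in> Arr H" "Dom H (cov_lift H Fa y g) = y" "Fa (cov_lift H Fa y g) = g"
proof -
  have "g \<in> Fa ` {h \<in> Arr H. Dom H h = y}" using c y g by (simp add: covering_morphism_def bij_betw_def)
  then obtain h where h: "h \<in> Arr H" "Dom H h = y" "Fa h = g" by blast
  show "cov_lift H Fa y g \<in> Arr H" "Dom H (cov_lift H Fa y g) = y" "Fa (cov_lift H Fa y g) = g"
    unfolding cov_lift_unique[OF c h] using h by simp_all
qed

text \<open>In a covering morphism an arrow is determined by its source and its image, so arrows of
  \<open>H\<close> have unique counterparts in \<open>H'\<close>. The hypothesis on targets makes
  this assignment a functor; its continuity comes from the openness of \<open>Fa'\<close> and the
  continuity of \<open>Fa\<close>.\<close>

lemma over_morphism_cov_lift: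
  assumes A: "(H, Fo, Fa) \<in> open_covering_morphisms G" and B: "(H', Fo', Fa') \<in> open_covering_morphisms G"
    and O: "Obj H' = Obj H" "\<And>x. x \<in> Obj H \<Longrightarrow> Fo' x = Fo x"
    and C: "\<And>h h'. \<lbrakk>h \<in> Arr H; h' \<in> Arr H'; Dom H' h' = Dom H h; Fa' h' = Fa h\<rbrakk> \<Longrightarrow> Cod H' h' = Cod H h"
  shows "over_morphism (H, Fo, Fa) (H', Fo', Fa')
    (restrict (\<lambda>x. x) (Obj H), \<lambda>h\<in>Arr H. cov_lift H' Fa' (Dom H h) (Fa h))"
proof -
  let ?K = "\<lambda>h\<in>Arr H. cov_lift H' Fa' (Dom H h) (Fa h)"
  have c: "covering_morphism H' G Fo' Fa'" and F: "is_functor H G Fo Fa" and F': "is_functor H' G Fo' Fa'"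
    and cH: "category H" "category H'" and o: "open_top_functor H' G Fo' Fa'" "top_functor H G Fo Fa"
    and tH: "top_groupoid H" "top_groupoid H'"
    using A B by (auto simp: open_covering_morphisms_def covering_morphism_def is_functor_def open_top_functor_def)
  have K: "?K h \<in> Arr H'" "Dom H' (?K h) = Dom H h" "Fa' (?K h) = Fa h" "Cod H' (?K h) = Cod H h" if h: "h \<in> Arr H" for h
  proof -
    have d: "Dom H h \<in> Obj H" using cH h by (simp add: category_def)
    have g: "Fa h \<in> Arr G" "Dom G (Fa h) = Fo' (Dom H h)" using F h O d by (auto simp: is_functor_def homset_def)
    note l = cov_lift[OF c _ g, unfolded O(1), OF d]
    show "?K h \<in> Arr H'" "Dom H' (?K h) = Dom H h" "Fa' (?K h) = Fa h" using l h by simp_all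
    then show "Cod H' (?K h) = Cod H h" by (rule C[OF h])
  qed
  have uniq: "?K h = k" if "h \<in> Arr H" "k \<in> Arr H'" "Dom H' k = Dom H h" "Fa' k = Fa h" for h k
    using cov_lift_unique[OF c that(2-4)] that(1) by simp
  have "is_functor H H' (restrict (\<lambda>x. x) (Obj H)) ?K"
    unfolding is_functor_def
  proof (intro conjI ballI impI)
    show "category H" "category H'" by (fact cH)+
    show "restrict (\<lambda>x. x) (Obj H) x \<in> Obj H'" if "x \<in> Obj H" for x using that O by simp
    show "?K f \<in> homset H' (restrict (\<lambda>x. x) (Obj H) (Dom H f)) (restrict (\<lambda>x. x) (Obj H) (Cod H f))"
      if "f \<in> Arr H" for f
      using K[OF that] that cH(1) by (simp add: homset_def category_def)
    show "?K (Ident H x) = Ident H' (restrict (\<lambda>x. x) (Obj H) x)" if x: "x \<in> Obj H" for x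
    proof -
      have "Ident H x \<in> homset H x x" "Ident H' x \<in> homset H' x x"
        using category_Ident[OF cH(1) x] category_Ident[OF cH(2)] x O by auto
      moreover have "Fa' (Ident H' x) = Fa (Ident H x)"
        using functor_Ident[OF F x] functor_Ident[OF F'] x O by simp
      ultimately have "?K (Ident H x) = Ident H' x" by (intro uniq) (simp_all add: homset_def)
      then show ?thesis using x by (simp only: restrict_apply')
    qed
    fix f g assume f: "f \<in> Arr H" and g: "g \<in> Arr H" and fg: "Cod H f = Dom H g"
    have h: "f \<in> homset H (Dom H f) (Cod H f)" "g \<in> homset H (Cod H f) (Cod H g)" using f g fg by (simp_all add: homset_def)
    have h': "?K f \<in> homset H' (Dom H f) (Cod H f)" "?K g \<in> homset H' (Cod H f) (Cod H g)"
      using K[OF f] K[OF g] fg by (simp_all only: homset_def mem_Collect_eq)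
    have "Fa' (Comp H' (?K f) (?K g)) = Fa (Comp H f g)"
      unfolding functor_Comp[OF F' h'] functor_Comp[OF F h] K(3)[OF f] K(3)[OF g] ..
    then show "?K (Comp H f g) = Comp H' (?K f) (?K g)"
      using category_Comp[OF cH(1) h] category_Comp[OF cH(2) h']
      by (intro uniq) (simp_all only: homset_def mem_Collect_eq)
  qed
  moreover have "continuous_map (hom_top H x y) (hom_top H' x y) ?K" if x: "x \<in> Obj H" and y: "y \<in> Obj H" for x y
    unfolding continuous_map_def
  proof (intro conjI allI impI)
    have t: "topspace (hom_top H x y) = homset H x y" "topspace (hom_top H' x y) = homset H' x y"
      using tH x y O by (simp_all add: top_groupoid_def)
    show "?K \<in> topspace (hom_top H x y) \<rightarrow> topspace (hom_top H' x y)"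
      unfolding t using K by (auto simp only: homset_def)
    fix U assume U: "openin (hom_top H' x y) U"
    have UH: "U \<subseteq> homset H' x y" using openin_subset[OF U] t by simp
    have "openin (hom_top G (Fo x) (Fo y)) (Fa' ` U)"
      using o(1) U x y O by (simp add: open_top_functor_def open_map_def)
    moreover have "continuous_map (hom_top H x y) (hom_top G (Fo x) (Fo y)) Fa"
      using o(2) x y by (simp add: top_functor_def)
    ultimately have "openin (hom_top H x y) {h \<in> topspace (hom_top H x y). Fa h \<in> Fa' ` U}"
      by (intro openin_continuous_map_preimage)
    also have "{h \<in> topspace (hom_top H x y). Fa h \<in> Fa' ` U} = {h \<in> topspace (hom_top H x y). ?K h \<in> U}"
      unfolding t
    proof (intro Collect_cong conj_cong refl iffI)
      fix h assume h: "h \<in> homset H x y"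
      then have hA: "h \<in> Arr H" "Dom H h = x" by (simp_all add: homset_def)
      show "Fa h \<in> Fa' ` U" if "?K h \<in> U" using imageI[OF that, of Fa'] K(3)[OF hA(1)] by simp
      assume "Fa h \<in> Fa' ` U"
      then obtain u where u: "u \<in> U" "Fa h = Fa' u" by blast
      then have "?K h = u" using UH hA by (intro uniq) (auto simp: homset_def)
      then show "?K h \<in> U" using u by simp
    qed
    finally show "openin (hom_top H x y) {h \<in> topspace (hom_top H x y). ?K h \<in> U}" .
  qed
  ultimately have "top_functor H H' (restrict (\<lambda>x. x) (Obj H)) ?K"
    by (simp add: top_functor_def)
  then show ?thesis using K(3) O by (simp add: over_morphism_def)
qed

text \<open>The hypotheses are symmetric in the two covering morphisms, so the correspondence exists
  in both directions; uniqueness of lifts makes the two directions mutually inverse.\<close>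

lemma isomorphic_over_cov_lift:
  assumes A: "(H, Fo, Fa) \<in> open_covering_morphisms G" and B: "(H', Fo', Fa') \<in> open_covering_morphisms G"
    and O: "Obj H' = Obj H" "\<And>x. x \<in> Obj H \<Longrightarrow> Fo' x = Fo x"
    and C: "\<And>h h'. \<lbrakk>h \<in> Arr H; h' \<in> Arr H'; Dom H' h' = Dom H h; Fa' h' = Fa h\<rbrakk> \<Longrightarrow> Cod H' h' = Cod H h"
  shows "isomorphic_over (H, Fo, Fa) (H', Fo', Fa')"
  unfolding isomorphic_over_def
proof (intro exI conjI ballI)
  have c: "covering_morphism H G Fo Fa" and c': "covering_morphism H' G Fo' Fa'"
    using A B by (auto simp: open_covering_morphisms_def)
  have cH: "category H" "category H'" "is_functor H G Fo Fa" "is_functor H' G Fo' Fa'"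
    using c c' by (auto simp: covering_morphism_def is_functor_def)
  let ?K = "\<lambda>h\<in>Arr H. cov_lift H' Fa' (Dom H h) (Fa h)" and ?L = "\<lambda>h\<in>Arr H'. cov_lift H Fa (Dom H' h) (Fa' h)"
  let ?i = "restrict (\<lambda>x. x) (Obj H)" and ?i' = "restrict (\<lambda>x. x) (Obj H')"
  show "over_morphism (H, Fo, Fa) (H', Fo', Fa') (?i, ?K)" by (rule over_morphism_cov_lift[OF A B O C])
  show "over_morphism (H', Fo', Fa') (H, Fo, Fa) (?i', ?L)"
    using O C[symmetric] by (intro over_morphism_cov_lift[OF B A]) simp_all
  have "?L (?K h) = h" if h: "h \<in> Arr H" for h
  proof -
    have "Dom H h \<in> Obj H" using cH h by (simp add: category_def)
    moreover have "Fa h \<in> Arr G" "Dom G (Fa h) = Fo' (Dom H h)" using cH h O calculation by (auto simp: is_functor_def homset_def)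
    ultimately show ?thesis using cov_lift[OF c', of "Dom H h" "Fa h"] O h cov_lift_unique[OF c h refl refl] by simp
  qed
  then show "?L (?K h) = h" if "h \<in> Arr (fst (H, Fo, Fa))" for h using that by simp
  have "?K (?L h) = h" if h: "h \<in> Arr H'" for h
  proof -
    have d: "Dom H' h \<in> Obj H" using cH h O by (simp add: category_def)
    moreover have "Fa' h \<in> Arr G" "Dom G (Fa' h) = Fo (Dom H' h)"
      using cH(4) h O d by (auto simp: is_functor_def homset_def)
    ultimately show ?thesis using cov_lift[OF c, of "Dom H' h" "Fa' h"] h cov_lift_unique[OF c' h refl refl] by simp
  qed
  then show "?K (?L h) = h" if "h \<in> Arr (fst (H', Fo', Fa'))" for h using that by simp
qed (use O in auto)

text \<open>The algebraic laws of transport express that lifts of arrows respect identities and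
  composition; only the openness of stabilizers involves topology.\<close>

lemma open_covering_path_transport:
  assumes X: "locally_wep_connected X" and A: "(H, Fo, Fa) \<in> open_covering_morphisms (pi_tau X)"
  shows "path_transport X (Obj H) Fo (\<lambda>y \<alpha>. Cod H (cov_lift H Fa y (path_class X \<alpha>)))"
proof
  have c: "covering_morphism H (pi_tau X) Fo Fa" and F: "is_functor H (pi_tau X) Fo Fa" and cH: "category H"
    and o: "open_top_functor H (pi_tau X) Fo Fa" and tH: "top_groupoid H"
    using A by (auto simp: open_covering_morphisms_def covering_morphism_def is_functor_def)
  show "locally_wep_connected X" by (rule X)
  show "Fo y \<in> topspace X" if "y \<in> Obj H" for y using F that by (auto simp: is_functor_def)
  have l: "cov_lift H Fa y (path_class X \<alpha>) \<in> Arr H" "Dom H (cov_lift H Fa y (path_class X \<alpha>)) = y"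
    "Fa (cov_lift H Fa y (path_class X \<alpha>)) = path_class X \<alpha>"
    if "y \<in> Obj H" "\<alpha> \<in> paths X" "\<alpha> 0 = Fo y" for y \<alpha>
    using cov_lift[OF c that(1), of "path_class X \<alpha>"] that by (simp_all add: FG_path_in_Arr FG_ends)
  show "Cod H (cov_lift H Fa y (path_class X \<alpha>)) \<in> Obj H"
    if "y \<in> Obj H" "\<alpha> \<in> paths X" "\<alpha> 0 = Fo y" for y \<alpha>
    using l(1)[OF that] cH by (simp add: category_def)
  show "Fo (Cod H (cov_lift H Fa y (path_class X \<alpha>))) = \<alpha> 1"
    if "y \<in> Obj H" "\<alpha> \<in> paths X" "\<alpha> 0 = Fo y" for y \<alpha>
  proof -
    have "Fa (cov_lift H Fa y (path_class X \<alpha>)) \<in>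
        homset (pi_tau X) (Fo y) (Fo (Cod H (cov_lift H Fa y (path_class X \<alpha>))))"
      using F l[OF that] unfolding is_functor_def by metis
    then show ?thesis using l(3)[OF that] that(2) by (simp add: homset_def FG_ends)
  qed
  show "Cod H (cov_lift H Fa y (path_class X (path_const (Fo y)))) = y" if y: "y \<in> Obj H" for y
  proof -
    have "Ident H y \<in> homset H y y" by (rule category_Ident[OF cH y])
    moreover have "Fa (Ident H y) = path_class X (path_const (Fo y))"
      using functor_Ident[OF F y] by (simp add: FG_Ident)
    ultimately show ?thesis using cov_lift_unique[OF c, of "Ident H y"] by (simp add: homset_def)
  qed
  show "Cod H (cov_lift H Fa y (path_class X (path_concat \<alpha> \<beta>))) =
      Cod H (cov_lift H Fa (Cod H (cov_lift H Fa y (path_class X \<alpha>))) (path_class X \<beta>))"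
    if y: "y \<in> Obj H" and a: "\<alpha> \<in> paths X" and b: "\<beta> \<in> paths X"
      and a0: "\<alpha> 0 = Fo y" and ab: "\<alpha> 1 = \<beta> 0" for y \<alpha> \<beta>
  proof -
    let ?h = "cov_lift H Fa y (path_class X \<alpha>)"
    let ?k = "cov_lift H Fa (Cod H ?h) (path_class X \<beta>)"
    note h = l[OF y a a0]
    have cod: "Cod H ?h \<in> Obj H" using h(1) cH by (simp add: category_def)
    have "Fa ?h \<in> homset (pi_tau X) (Fo y) (Fo (Cod H ?h))"
      using F h unfolding is_functor_def by metis
    then have "\<beta> 0 = Fo (Cod H ?h)" using h(3) a ab by (simp add: homset_def FG_ends)
    note k = l[OF cod b this]
    have hh: "?h \<in> homset H y (Cod H ?h)" "?k \<in> homset H (Cod H ?h) (Cod H ?k)" using h k by (simp_all add: homset_def)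
    have hk: "Comp H ?h ?k \<in> homset H y (Cod H ?k)" by (rule category_Comp[OF cH hh])
    have "Fa (Comp H ?h ?k) = path_class X (path_concat \<alpha> \<beta>)"
      using functor_Comp[OF F hh] h(3) k(3) FG_Comp[OF a b ab] by simp
    then have "cov_lift H Fa y (path_class X (path_concat \<alpha> \<beta>)) = Comp H ?h ?k"
      using hk by (intro cov_lift_unique[OF c]) (simp_all add: homset_def)
    then show ?thesis using hk by (simp add: homset_def)
  qed
  show "openin (path_space_between X (Fo y) (Fo y))
      {\<alpha> \<in> topspace (path_space_between X (Fo y) (Fo y)). Cod H (cov_lift H Fa y (path_class X \<alpha>)) = y}"
    if y: "y \<in> Obj H" for y
  proof -
    have Fy: "Fo y \<in> topspace X" using F y by (auto simp: is_functor_def)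
    have t: "topspace (hom_top H y y) = homset H y y" using tH y by (simp add: top_groupoid_def)
    \<comment> \<open>Openness is applied to the entire vertex group at \<open>y\<close>. Its image
      consists of the classes whose lift at \<open>y\<close> closes up, and it is pulled back to
      loops along the class map followed by the unit of the reflection.\<close>
    have "openin (hom_top (pi_tau X) (Fo y) (Fo y)) (Fa ` homset H y y)"
      using o y openin_topspace[of "hom_top H y y"] unfolding t by (simp add: open_top_functor_def open_map_def)
    then have op: "openin (PV X (Fo y)) (Fa ` homset H y y)" by (simp add: hom_top_pi_tau)
    have "continuous_map (path_space_between X (Fo y) (Fo y)) (PV X (Fo y)) (path_class X)"
      using continuous_map_compose[OF quotient_imp_continuous_map[OF quotient_map_quotient_topology]
          continuous_map_tau_unit[OF group_VG[OF Fy] topspace_PQ_VG]] by (simp add: o_def)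
    from openin_continuous_map_preimage[OF this op]
    have "openin (path_space_between X (Fo y) (Fo y))
        {\<alpha> \<in> topspace (path_space_between X (Fo y) (Fo y)). path_class X \<alpha> \<in> Fa ` homset H y y}" .
    moreover have "path_class X \<alpha> \<in> Fa ` homset H y y \<longleftrightarrow> Cod H (cov_lift H Fa y (path_class X \<alpha>)) = y"
      if "\<alpha> \<in> topspace (path_space_between X (Fo y) (Fo y))" for \<alpha>
    proof
      have a: "\<alpha> \<in> paths X" "\<alpha> 0 = Fo y" using that by (auto simp: topspace_path_space_between)
      show "path_class X \<alpha> \<in> Fa ` homset H y y" if "Cod H (cov_lift H Fa y (path_class X \<alpha>)) = y"
        using l[OF y a] that by (intro image_eqI[of _ _ "cov_lift H Fa y (path_class X \<alpha>)"]) (simp_all add: homset_def)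
      assume "path_class X \<alpha> \<in> Fa ` homset H y y"
      then obtain h where "h \<in> homset H y y" "path_class X \<alpha> = Fa h" by blast
      then show "Cod H (cov_lift H Fa y (path_class X \<alpha>)) = y"
        using cov_lift_unique[OF c, of h y "Fa h"] by (simp add: homset_def)
    qed
    ultimately show ?thesis by (simp cong: conj_cong)
  qed
qed simp

text \<open>The semicovering keeps the objects of \<open>H\<close> as its points and
  \<open>Fo\<close> as its projection, so only arrows need comparing. Equal targets follow from
  \<open>tr_projection\<close>; the arrow type is arbitrary.\<close>

lemma open_covering_realized:
  fixes X :: "'a topology" and A :: "('b, 'm, 'a, (real \<Rightarrow> 'a) set) groupoid_over"
  assumes X: "locally_wep_connected X" and A: "A \<in> open_covering_morphisms (pi_tau X)"
  shows "\<exists>S \<in> semicoverings X. isomorphic_over A (pi_tau_shriek_obj X (S :: 'b topology \<times> ('b \<Rightarrow> 'a)))"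
proof -
  obtain H Fo Fa where [simp]: "A = (H, Fo, Fa)" by (cases A)
  have A': "(H, Fo, Fa) \<in> open_covering_morphisms (pi_tau X)" using A by simp
  interpret path_transport X "Obj H" Fo "\<lambda>y \<alpha>. Cod H (cov_lift H Fa y (path_class X \<alpha>))"
    by (rule open_covering_path_transport[OF X A'])
  have c: "covering_morphism H (pi_tau X) Fo Fa" and e: "Fo \<in> extensional (Obj H)"
    using A' by (auto simp: open_covering_morphisms_def)
  have S: "(total, Fo) \<in> semicoverings X"
    using semicovering_total e by (simp add: semicoverings_def topspace_total)
  have p: "continuous_map total X Fo" by (rule continuous_map_p)
  have B: "(pi_tau total, Fo, induced_class_map total X Fo) \<in> open_covering_morphisms (pi_tau X)"
    using pi_tau_shriek_obj_in[OF S] by (simp add: pi_tau_shriek_obj_def)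
  have "isomorphic_over A (pi_tau total, Fo, induced_class_map total X Fo)"
    unfolding \<open>A = (H, Fo, Fa)\<close>
  proof (rule isomorphic_over_cov_lift[OF A' B])
    fix h h' assume h: "h \<in> Arr H" and "h' \<in> Arr (pi_tau total)" and d: "Dom (pi_tau total) h' = Dom H h"
      and f: "induced_class_map total X Fo h' = Fa h"
    then have "h' \<in> Arr (FG total)" by simp
    then obtain \<gamma> where g: "\<gamma> \<in> paths total" "h' = path_class total \<gamma>" by (rule FG_ArrE)
    have "path_class X (compose {0..1} Fo \<gamma>) = Fa h" using f g p by (simp add: induced_class_map_class)
    moreover have "\<gamma> 0 = Dom H h" using d g by (simp add: FG_ends)
    ultimately have "cov_lift H Fa (\<gamma> 0) (path_class X (compose {0..1} Fo \<gamma>)) = h"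
      using h by (intro cov_lift_unique[OF c]) simp_all
    then show "Cod (pi_tau total) h' = Cod H h"
      using tr_projection[OF g(1)] g by (simp add: FG_ends)
  qed (simp_all add: topspace_total)
  then show ?thesis using S by (intro bexI[of _ "(total, Fo)"]) (simp_all add: pi_tau_shriek_obj_def)
qed

section \<open>Equivalences of categories\<close>

lemma is_functor_id: "category C \<Longrightarrow> is_functor C C (\<lambda>x. x) (\<lambda>f. f)"
  by (auto simp: is_functor_def category_def homset_def)

lemma is_functor_compose:
  assumes F: "is_functor C D Fo Fa" and G: "is_functor D E Go Ga"
  shows "is_functor C E (\<lambda>x. Go (Fo x)) (\<lambda>f. Ga (Fa f))"
  using F G by (auto simp: is_functor_def homset_def)

text \<open>The quasi-inverse chooses for each \<open>d\<close> an object together with an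
  isomorphism to \<open>d\<close>, and sends an arrow to the preimage of its conjugate. Every
  equation in \<open>C\<close> is verified after applying the functor, by faithfulness.\<close>

lemma fully_faithful_ess_surj_equivalence:
  assumes F: "is_functor C D Fo Fa"
    and faithful: "\<And>x y f f'. \<lbrakk>f \<in> homset C x y; f' \<in> homset C x y; Fa f = Fa f'\<rbrakk> \<Longrightarrow> f = f'"
    and full: "\<And>x y g. \<lbrakk>x \<in> Obj C; y \<in> Obj C; g \<in> homset D (Fo x) (Fo y)\<rbrakk> \<Longrightarrow> \<exists>f\<in>homset C x y. Fa f = g"
    and ess: "\<And>d. d \<in> Obj D \<Longrightarrow> \<exists>c\<in>Obj C. \<exists>k. k \<in> homset D (Fo c) d \<and> isomorphism D k"
  shows "equivalence_of_categories C D Fo Fa"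
proof -
  have C: "category C" and D: "category D" using F by (auto simp: is_functor_def)
  \<comment> \<open>The isomorphism and its inverse are chosen together. The implication makes the
    choice functions total on the type of \<open>d\<close>.\<close>
  have "\<forall>d. \<exists>c k j. d \<in> Obj D \<longrightarrow> c \<in> Obj C \<and> k \<in> homset D (Fo c) d \<and> j \<in> homset D d (Fo c) \<and>
      Comp D k j = Ident D (Fo c) \<and> Comp D j k = Ident D d"
  proof
    fix d
    show "\<exists>c k j. d \<in> Obj D \<longrightarrow> c \<in> Obj C \<and> k \<in> homset D (Fo c) d \<and> j \<in> homset D d (Fo c) \<and>
      Comp D k j = Ident D (Fo c) \<and> Comp D j k = Ident D d"
    proof (cases "d \<in> Obj D")
      case True
      then obtain c k where c: "c \<in> Obj C" "k \<in> homset D (Fo c) d" "isomorphism D k" using ess by blast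
      then obtain j where "inverse_arrows D k j" by (auto simp: isomorphism_def)
      then have "j \<in> homset D d (Fo c)" "Comp D k j = Ident D (Fo c)" "Comp D j k = Ident D d"
        using c by (auto simp: inverse_arrows_def homset_def)
      then show ?thesis using c by blast
    qed simp
  qed
  then obtain Go k j where *: "\<And>d. d \<in> Obj D \<Longrightarrow> Go d \<in> Obj C \<and> k d \<in> homset D (Fo (Go d)) d \<and>
      j d \<in> homset D d (Fo (Go d)) \<and> Comp D (k d) (j d) = Ident D (Fo (Go d)) \<and> Comp D (j d) (k d) = Ident D d"
    unfolding choice_iff by blast
  have Go: "Go d \<in> Obj C" and k: "k d \<in> homset D (Fo (Go d)) d" and j: "j d \<in> homset D d (Fo (Go d))"
    and kj: "Comp D (k d) (j d) = Ident D (Fo (Go d))" and jk: "Comp D (j d) (k d) = Ident D d"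
    if "d \<in> Obj D" for d using *[OF that] by auto
  have iso_k: "isomorphism D (k d)" if d: "d \<in> Obj D" for d
    unfolding isomorphism_def inverse_arrows_def
    using k[OF d] j[OF d] kj[OF d] jk[OF d] by (intro exI[of _ "j d"]) (simp add: homset_def)
  define pre where "pre x y g = (SOME f. f \<in> homset C x y \<and> Fa f = g)" for x y g
  have pre: "pre x y g \<in> homset C x y" "Fa (pre x y g) = g"
    if "x \<in> Obj C" "y \<in> Obj C" "g \<in> homset D (Fo x) (Fo y)" for x y g
    using full[OF that] someI_ex[of "\<lambda>f. f \<in> homset C x y \<and> Fa f = g"] unfolding pre_def by blast+
  let ?conj = "\<lambda>g. Comp D (Comp D (k (Dom D g)) g) (j (Cod D g))"
  define Ga where "Ga g = pre (Go (Dom D g)) (Go (Cod D g)) (?conj g)" for g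
  have conj_in: "Comp D (Comp D (k d) g) (j e) \<in> homset D (Fo (Go d)) (Fo (Go e))" if g: "g \<in> homset D d e" for d e g
    using category_homset_Obj[OF D g] by (intro category_Comp[OF D category_Comp[OF D k g] j]) auto
  have Ga: "Ga g \<in> homset C (Go d) (Go e)" "Fa (Ga g) = Comp D (Comp D (k d) g) (j e)" if g: "g \<in> homset D d e" for d e g
  proof -
    have "Ga g = pre (Go d) (Go e) (Comp D (Comp D (k d) g) (j e))" using g by (simp add: Ga_def homset_def)
    then show "Ga g \<in> homset C (Go d) (Go e)" "Fa (Ga g) = Comp D (Comp D (k d) g) (j e)"
      using pre[OF _ _ conj_in[OF g]] category_homset_Obj[OF D g] Go by auto
  qed
  \<comment> \<open>This is the naturality square of \<open>k\<close>; the same cancellation proves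
    that \<open>Ga\<close> respects composition.\<close>
  have cancel: "Comp D (Comp D (Comp D (k d) g) (j e)) (k e) = Comp D (k d) g" if g: "g \<in> homset D d e" for d e g
  proof -
    have d: "d \<in> Obj D" and e: "e \<in> Obj D" using category_homset_Obj[OF D g] by auto
    have kg: "Comp D (k d) g \<in> homset D (Fo (Go d)) e" by (rule category_Comp[OF D k[OF d] g])
    show ?thesis using category_assoc[OF D kg j[OF e] k[OF e]] jk[OF e] category_unit(2)[OF D kg] by simp
  qed
  have in_hom: "g \<in> homset D (Dom D g) (Cod D g)" if "g \<in> Arr D" for g using that by (simp add: homset_def)
  have G: "is_functor D C Go Ga"
    unfolding is_functor_def
  proof (intro conjI ballI impI)
    show "category C" "category D" by (fact C D)+
    show "Go d \<in> Obj C" if "d \<in> Obj D" for d by (rule Go[OF that])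
    show "Ga g \<in> homset C (Go (Dom D g)) (Go (Cod D g))" if "g \<in> Arr D" for g by (rule Ga(1)[OF in_hom[OF that]])
    show "Ga (Ident D d) = Ident C (Go d)" if d: "d \<in> Obj D" for d
    proof (rule faithful)
      have i: "Ident D d \<in> homset D d d" by (rule category_Ident[OF D d])
      show "Ga (Ident D d) \<in> homset C (Go d) (Go d)" by (rule Ga(1)[OF i])
      show "Ident C (Go d) \<in> homset C (Go d) (Go d)" by (rule category_Ident[OF C Go[OF d]])
      show "Fa (Ga (Ident D d)) = Fa (Ident C (Go d))"
        unfolding Ga(2)[OF i] functor_Ident[OF F Go[OF d]] category_unit(2)[OF D k[OF d]] by (rule kj[OF d])
    qed
    fix f g assume f: "f \<in> Arr D" and g: "g \<in> Arr D" and fg: "Cod D f = Dom D g"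
    let ?d = "Dom D f" and ?e = "Cod D f" and ?z = "Cod D g"
    have f': "f \<in> homset D ?d ?e" and g': "g \<in> homset D ?e ?z" using f g fg by (simp_all add: homset_def)
    have z: "?d \<in> Obj D" "?e \<in> Obj D" "?z \<in> Obj D" using category_homset_Obj[OF D f'] category_homset_Obj[OF D g'] by auto
    have h: "Comp D f g \<in> homset D ?d ?z" by (rule category_Comp[OF D f' g'])
    have kg: "Comp D (k ?e) g \<in> homset D (Fo (Go ?e)) ?z" by (rule category_Comp[OF D k[OF z(2)] g'])
    have kf: "Comp D (k ?d) f \<in> homset D (Fo (Go ?d)) ?e" by (rule category_Comp[OF D k[OF z(1)] f'])
    show "Ga (Comp D f g) = Comp C (Ga f) (Ga g)"
    proof (rule faithful)
      show "Ga (Comp D f g) \<in> homset C (Go ?d) (Go ?z)" by (rule Ga(1)[OF h])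
      show "Comp C (Ga f) (Ga g) \<in> homset C (Go ?d) (Go ?z)" by (rule category_Comp[OF C Ga(1)[OF f'] Ga(1)[OF g']])
      have "Comp D (Comp D (Comp D (k ?d) f) (j ?e)) (Comp D (Comp D (k ?e) g) (j ?z))
        = Comp D (Comp D (Comp D (Comp D (k ?d) f) (j ?e)) (Comp D (k ?e) g)) (j ?z)"
        by (rule category_assoc[symmetric, OF D conj_in[OF f'] kg j[OF z(3)]])
      also have "Comp D (Comp D (Comp D (k ?d) f) (j ?e)) (Comp D (k ?e) g)
        = Comp D (Comp D (Comp D (Comp D (k ?d) f) (j ?e)) (k ?e)) g"
        by (rule category_assoc[symmetric, OF D conj_in[OF f'] k[OF z(2)] g'])
      also have "\<dots> = Comp D (k ?d) (Comp D f g)"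
        unfolding cancel[OF f'] by (rule category_assoc[OF D k[OF z(1)] f' g'])
      finally show "Fa (Ga (Comp D f g)) = Fa (Comp C (Ga f) (Ga g))"
        unfolding functor_Comp[OF F Ga(1)[OF f'] Ga(1)[OF g']] Ga(2)[OF f'] Ga(2)[OF g'] Ga(2)[OF h] by simp
    qed
  qed
  have Fo: "Fo c \<in> Obj D" if "c \<in> Obj C" for c using F that by (simp add: is_functor_def)
  define \<eta> where "\<eta> c = pre c (Go (Fo c)) (j (Fo c))" for c
  have \<eta>: "\<eta> c \<in> homset C c (Go (Fo c))" "Fa (\<eta> c) = j (Fo c)" if c: "c \<in> Obj C" for c
    unfolding \<eta>_def using pre[OF c Go[OF Fo[OF c]] j[OF Fo[OF c]]] by auto
  have "natural_isomorphism C C (\<lambda>x. x) (\<lambda>f. f) (\<lambda>x. Go (Fo x)) (\<lambda>f. Ga (Fa f)) \<eta>"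
    unfolding natural_isomorphism_def
  proof (intro conjI ballI)
    show "is_functor C C (\<lambda>x. x) (\<lambda>f. f)" by (rule is_functor_id[OF C])
    show "is_functor C C (\<lambda>x. Go (Fo x)) (\<lambda>f. Ga (Fa f))" by (rule is_functor_compose[OF F G])
    show "\<eta> c \<in> homset C c (Go (Fo c))" if "c \<in> Obj C" for c by (rule \<eta>(1)[OF that])
    show "isomorphism C (\<eta> c)" if c: "c \<in> Obj C" for c
    proof -
      note d = Fo[OF c] and gc = Go[OF Fo[OF c]]
      let ?t = "pre (Go (Fo c)) c (k (Fo c))"
      note t = pre[OF gc c k[OF d]]
      have 1: "Comp C (\<eta> c) ?t = Ident C c"
        by (rule faithful[OF category_Comp[OF C \<eta>(1)[OF c] t(1)] category_Ident[OF C c]])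
          (simp add: functor_Comp[OF F \<eta>(1)[OF c] t(1)] \<eta>(2)[OF c] t(2) functor_Ident[OF F c] jk[OF d])
      have 2: "Comp C ?t (\<eta> c) = Ident C (Go (Fo c))"
        by (rule faithful[OF category_Comp[OF C t(1) \<eta>(1)[OF c]] category_Ident[OF C gc]])
          (simp add: functor_Comp[OF F t(1) \<eta>(1)[OF c]] \<eta>(2)[OF c] t(2) functor_Ident[OF F gc] kj[OF d])
      show ?thesis
        unfolding isomorphism_def inverse_arrows_def
        using 1 2 t(1) \<eta>(1)[OF c] by (intro exI[of _ ?t]) (simp add: homset_def)
    qed
    fix f assume "f \<in> Arr C"
    let ?x = "Dom C f" and ?y = "Cod C f"
    have f: "f \<in> homset C ?x ?y" using \<open>f \<in> Arr C\<close> by (simp add: homset_def)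
    have x: "?x \<in> Obj C" and y: "?y \<in> Obj C" using category_homset_Obj[OF C f] by auto
    note Ff = functor_homset[OF F f]
    show "Comp C f (\<eta> ?y) = Comp C (\<eta> ?x) (Ga (Fa f))"
    proof (rule faithful)
      show "Comp C f (\<eta> ?y) \<in> homset C ?x (Go (Fo ?y))" by (rule category_Comp[OF C f \<eta>(1)[OF y]])
      show "Comp C (\<eta> ?x) (Ga (Fa f)) \<in> homset C ?x (Go (Fo ?y))"
        by (rule category_Comp[OF C \<eta>(1)[OF x] Ga(1)[OF Ff]])
      note kf = category_Comp[OF D k[OF Fo[OF x]] Ff]
      have "Comp D (j (Fo ?x)) (Comp D (Comp D (k (Fo ?x)) (Fa f)) (j (Fo ?y)))
        = Comp D (Comp D (j (Fo ?x)) (Comp D (k (Fo ?x)) (Fa f))) (j (Fo ?y))"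
        by (rule category_assoc[symmetric, OF D j[OF Fo[OF x]] kf j[OF Fo[OF y]]])
      also have "Comp D (j (Fo ?x)) (Comp D (k (Fo ?x)) (Fa f)) = Fa f"
        using category_assoc[OF D j[OF Fo[OF x]] k[OF Fo[OF x]] Ff] jk[OF Fo[OF x]] category_unit(1)[OF D Ff] by simp
      finally show "Fa (Comp C f (\<eta> ?y)) = Fa (Comp C (\<eta> ?x) (Ga (Fa f)))"
        unfolding functor_Comp[OF F f \<eta>(1)[OF y]] functor_Comp[OF F \<eta>(1)[OF x] Ga(1)[OF Ff]]
          \<eta>(2)[OF x] \<eta>(2)[OF y] Ga(2)[OF Ff] by simp
    qed
  qed
  moreover have "natural_isomorphism D D (\<lambda>x. Fo (Go x)) (\<lambda>f. Fa (Ga f)) (\<lambda>x. x) (\<lambda>f. f) k"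
    unfolding natural_isomorphism_def
  proof (intro conjI ballI)
    show "is_functor D D (\<lambda>x. Fo (Go x)) (\<lambda>f. Fa (Ga f))" by (rule is_functor_compose[OF G F])
    show "is_functor D D (\<lambda>x. x) (\<lambda>f. f)" by (rule is_functor_id[OF D])
    show "k d \<in> homset D (Fo (Go d)) d" "isomorphism D (k d)" if "d \<in> Obj D" for d using k iso_k that by auto
    show "Comp D (Fa (Ga f)) (k (Cod D f)) = Comp D (k (Dom D f)) f" if "f \<in> Arr D" for f
      unfolding Ga(2)[OF in_hom[OF that]] by (rule cancel[OF in_hom[OF that]])
  qed
  ultimately show ?thesis unfolding equivalence_of_categories_def using F G by blast
qed

section \<open>The two categories and the functor between them\<close>

lemma category_SCov: "category (SCov X :: ('b topology \<times> ('b \<Rightarrow> 'a), _) cat)"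
  (is "category ?C")
  unfolding category_def
proof (intro conjI ballI impI)
  fix f assume "f \<in> Arr ?C"
  then obtain A B u where f: "f = (A, B, u)" "A \<in> semicoverings X" "B \<in> semicoverings X"
    "u \<in> maps (fst A) (fst B)" "\<forall>y\<in>topspace (fst A). snd B (u y) = snd A y"
    by (auto simp: SCov_def)
  have ue: "u \<in> extensional (topspace (fst A))" and uc: "continuous_map (fst A) (fst B) u"
    using f(4) by (simp_all add: maps_def)
  have ui: "u y \<in> topspace (fst B)" if "y \<in> topspace (fst A)" for y by (rule continuous_map_in_topspace[OF uc that])
  show "Dom ?C f \<in> Obj ?C" "Cod ?C f \<in> Obj ?C"
    using f by (simp_all add: SCov_def)
  show "Comp ?C (Ident ?C (Dom ?C f)) f = f"
    using ue by (auto simp: SCov_def f(1) compose_def extensional_def fun_eq_iff)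
  show "Comp ?C f (Ident ?C (Cod ?C f)) = f"
    using ue ui by (auto simp: SCov_def f(1) compose_def extensional_def fun_eq_iff)
  fix g assume "g \<in> Arr ?C"
  then obtain B' C v where g: "g = (B', C, v)" "B' \<in> semicoverings X" "C \<in> semicoverings X"
    "v \<in> maps (fst B') (fst C)" "\<forall>y\<in>topspace (fst B'). snd C (v y) = snd B' y"
    by (auto simp: SCov_def)
  have vc: "continuous_map (fst B') (fst C) v" using g(4) by (simp add: maps_def)
  show "Comp ?C f g \<in> homset ?C (Dom ?C f) (Cod ?C g)" if "Cod ?C f = Dom ?C g"
  proof -
    have B: "B' = B" using that by (simp add: SCov_def f(1) g(1))
    have "compose (topspace (fst A)) v u \<in> maps (fst A) (fst C)"
      using continuous_map_compose[OF uc vc[unfolded B]]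
      by (auto simp: maps_def compose_def o_def elim: continuous_map_eq)
    then show ?thesis using f g ui by (auto simp: SCov_def homset_def B compose_def)
  qed
  fix h assume "h \<in> Arr ?C"
  show "Comp ?C (Comp ?C f g) h = Comp ?C f (Comp ?C g h)"
    if "Cod ?C f = Dom ?C g \<and> Cod ?C g = Dom ?C h"
    using that ui by (cases h) (auto simp: SCov_def f(1) g(1) compose_def fun_eq_iff)
next
  fix A assume A: "A \<in> Obj ?C"
  have "restrict (\<lambda>y. y) (topspace (fst A)) \<in> maps (fst A) (fst A)"
    unfolding maps_def by (auto intro: continuous_map_eq[OF continuous_map_id])
  then show "Ident ?C A \<in> homset ?C A A"
    using A by (simp add: SCov_def homset_def)
qed

lemma category_OCovMor: "category (OCovMor G :: (('o, 'm, 'p, 'n) groupoid_over, _) cat)"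
  (is "category ?C")
  unfolding category_def
proof (intro conjI ballI impI)
  fix f assume "f \<in> Arr ?C"
  then obtain A B Ko Ka where f: "f = (A, B, Ko, Ka)" "A \<in> open_covering_morphisms G" "B \<in> open_covering_morphisms G"
    "over_morphism A B (Ko, Ka)"
    by (auto simp: OCovMor_def)
  obtain H P Q where A: "A = (H, P, Q)" by (cases A)
  obtain H' P' Q' where B: "B = (H', P', Q')" by (cases B)
  have K: "top_functor H H' Ko Ka" "Ko \<in> extensional (Obj H)" "Ka \<in> extensional (Arr H)"
    "\<forall>x\<in>Obj H. P' (Ko x) = P x" "\<forall>h\<in>Arr H. Q' (Ka h) = Q h"
    using f(4) by (simp_all add: over_morphism_def A B)
  have Ki: "Ko x \<in> Obj H'" if "x \<in> Obj H" for x using K(1) that by (simp add: top_functor_def is_functor_def)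
  have Kj: "Ka h \<in> Arr H'" if "h \<in> Arr H" for h using K(1) that by (simp add: top_functor_def is_functor_def homset_def)
  show "Dom ?C f \<in> Obj ?C" "Cod ?C f \<in> Obj ?C"
    using f by (simp_all add: OCovMor_def)
  show "Comp ?C (Ident ?C (Dom ?C f)) f = f"
    using K by (auto simp: OCovMor_def f(1) A compose_def extensional_def fun_eq_iff)
  show "Comp ?C f (Ident ?C (Cod ?C f)) = f"
    using K Ki Kj by (auto simp: OCovMor_def f(1) A B compose_def extensional_def fun_eq_iff)
  fix g assume "g \<in> Arr ?C"
  then obtain B' C Lo La where g: "g = (B', C, Lo, La)" "B' \<in> open_covering_morphisms G" "C \<in> open_covering_morphisms G"
    "over_morphism B' C (Lo, La)"
    by (auto simp: OCovMor_def)
  obtain H'' P'' Q'' where C: "C = (H'', P'', Q'')" by (cases C)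
  show "Comp ?C f g \<in> homset ?C (Dom ?C f) (Cod ?C g)"
    if "Cod ?C f = Dom ?C g"
  proof -
    have B': "B' = (H', P', Q')" using that by (simp add: OCovMor_def f(1) g(1) B)
    have L: "top_functor H' H'' Lo La" "\<forall>x\<in>Obj H'. P'' (Lo x) = P' x" "\<forall>h\<in>Arr H'. Q'' (La h) = Q' h"
      using g(4) by (simp_all add: over_morphism_def B' C)
    have F: "is_functor H H' Ko Ka" "is_functor H' H'' Lo La" using K(1) L(1) by (auto simp: top_functor_def)
    have cH: "category H" using F by (simp add: is_functor_def)
    have "is_functor H H'' (compose (Obj H) Lo Ko) (compose (Arr H) La Ka)"
      using is_functor_compose[OF F] unfolding is_functor_def
      by (auto simp: compose_def category_def homset_def)
    moreover have "continuous_map (hom_top H x y) (hom_top H'' (compose (Obj H) Lo Ko x) (compose (Obj H) Lo Ko y)) (compose (Arr H) La Ka)"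
      if x: "x \<in> Obj H" and y: "y \<in> Obj H" for x y
    proof -
      have "continuous_map (hom_top H x y) (hom_top H'' (Lo (Ko x)) (Lo (Ko y))) (La \<circ> Ka)"
        using K(1) L(1) x y Ki by (intro continuous_map_compose) (auto simp: top_functor_def)
      moreover have "topspace (hom_top H x y) \<subseteq> Arr H"
        using f(2) x y by (auto simp: A open_covering_morphisms_def top_groupoid_def homset_def)
      ultimately show ?thesis using x y by (auto simp: compose_def elim!: continuous_map_eq)
    qed
    ultimately have "top_functor H H'' (compose (Obj H) Lo Ko) (compose (Arr H) La Ka)"
      by (simp add: top_functor_def)
    then have "over_morphism A C (compose (Obj H) Lo Ko, compose (Arr H) La Ka)"
      using K L Ki Kj by (simp add: over_morphism_def A C) (simp add: compose_def)
    then show ?thesis using f g by (simp add: OCovMor_def homset_def A)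
  qed
  fix h assume "h \<in> Arr ?C"
  show "Comp ?C (Comp ?C f g) h = Comp ?C f (Comp ?C g h)"
    if "Cod ?C f = Dom ?C g \<and> Cod ?C g = Dom ?C h"
    using that Ki Kj by (cases h) (auto simp: OCovMor_def f(1) g(1) A B compose_def fun_eq_iff)
next
  fix A assume A: "A \<in> Obj ?C"
  obtain H P Q where A': "A = (H, P, Q)" by (cases A)
  have H: "(H, P, Q) \<in> open_covering_morphisms G" using A by (simp add: OCovMor_def A')
  then have t: "top_groupoid H" and cH: "category H"
    by (auto simp: open_covering_morphisms_def covering_morphism_def is_functor_def)
  have "is_functor H H (restrict (\<lambda>x. x) (Obj H)) (restrict (\<lambda>h. h) (Arr H))"
    using is_functor_id[OF cH] by (auto simp: is_functor_def category_def homset_def)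
  moreover have "continuous_map (hom_top H x y) (hom_top H x y) (restrict (\<lambda>h. h) (Arr H))"
    if "x \<in> Obj H" "y \<in> Obj H" for x y
    by (rule continuous_map_eq[OF continuous_map_id])
      (use t that in \<open>auto simp: top_groupoid_def homset_def\<close>)
  ultimately have "over_morphism A A (restrict (\<lambda>x. x) (Obj H), restrict (\<lambda>h. h) (Arr H))"
    by (simp add: over_morphism_def A' top_functor_def)
  then show "Ident ?C A \<in> homset ?C A A"
    using A by (simp add: OCovMor_def homset_def A')
qed

lemma induced_class_map_extensional: "induced_class_map Y X p \<in> extensional (Arr (FG Y))"
  by (simp add: induced_class_map_def)

text \<open>It serves two purposes: induced maps respect composition, and a map of semicoverings
  over \<open>X\<close> induces a functor over \<open>pi_tau X\<close>.\<close>

lemma induced_class_map_compose: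
  assumes f: "continuous_map Y Y' f" and q: "continuous_map Y' X q" and p: "continuous_map Y X p"
    and e: "\<And>y. y \<in> topspace Y \<Longrightarrow> q (f y) = p y" and h: "h \<in> Arr (FG Y)"
  shows "induced_class_map Y' X q (induced_class_map Y Y' f h) = induced_class_map Y X p h"
proof -
  obtain \<gamma> where g: "\<gamma> \<in> paths Y" "h = path_class Y \<gamma>" using h by (rule FG_ArrE)
  have "compose {0..1} q (compose {0..1} f \<gamma>) = compose {0..1} p \<gamma>"
    using e path_in_topspace[OF g(1)] by (auto simp: compose_def fun_eq_iff)
  then show ?thesis using g f p q by (simp add: induced_class_map_class path_compose_in)
qed

lemma is_functor_pi_tau_shriek:
  "is_functor (SCov X :: ('b topology \<times> ('b \<Rightarrow> 'a), _) cat) (OCovMor (pi_tau X))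
     (pi_tau_shriek_obj X) (pi_tau_shriek_arr X)"
  unfolding is_functor_def
proof (intro conjI ballI impI)
  show "category (SCov X)" "category (OCovMor (pi_tau X))" by (rule category_SCov category_OCovMor)+
  show "pi_tau_shriek_obj X A \<in> Obj (OCovMor (pi_tau X))"
    if "A \<in> Obj (SCov X)" for A :: "'b topology \<times> ('b \<Rightarrow> 'a)"
    using pi_tau_shriek_obj_in[of "fst A" "snd A" X] that by (simp add: SCov_def OCovMor_def)
  show "pi_tau_shriek_arr X (Ident (SCov X) A) = Ident (OCovMor (pi_tau X)) (pi_tau_shriek_obj X A)"
    if "A \<in> Obj (SCov X)" for A :: "'b topology \<times> ('b \<Rightarrow> 'a)"
  proof -
    obtain Y p where A: "A = (Y, p)" by (cases A)
    have c: "continuous_map Y Y (restrict (\<lambda>y. y) (topspace Y))"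
      by (auto intro: continuous_map_eq[OF continuous_map_id])
    have "induced_class_map Y Y (restrict (\<lambda>y. y) (topspace Y)) h = h" if "h \<in> Arr (FG Y)" for h
    proof -
      obtain \<gamma> where g: "\<gamma> \<in> paths Y" "h = path_class Y \<gamma>" using \<open>h \<in> Arr (FG Y)\<close> by (rule FG_ArrE)
      have "compose {0..1} (restrict (\<lambda>y. y) (topspace Y)) \<gamma> = \<gamma>"
        by (rule path_eqI[OF path_compose_in[OF c g(1)] g(1)]) (use path_in_topspace[OF g(1)] in \<open>simp add: compose_def\<close>)
      then show ?thesis using g c by (simp add: induced_class_map_class)
    qed
    then have "induced_class_map Y Y (restrict (\<lambda>y. y) (topspace Y)) = restrict (\<lambda>h. h) (Arr (FG Y))"
      by (intro extensionalityI[of _ "Arr (FG Y)"]) (auto simp: induced_class_map_def)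
    then show ?thesis by (simp add: SCov_def OCovMor_def pi_tau_shriek_arr_def pi_tau_shriek_obj_def A)
  qed
  fix f assume "f \<in> Arr (SCov X :: ('b topology \<times> ('b \<Rightarrow> 'a), _) cat)"
  then obtain Y p Y' p' u where f: "f = ((Y, p), (Y', p'), u)" "(Y, p) \<in> semicoverings X" "(Y', p') \<in> semicoverings X"
    "u \<in> maps Y Y'" "\<forall>y\<in>topspace Y. p' (u y) = p y"
    by (auto simp: SCov_def)
  have uc: "continuous_map Y Y' u" and ue: "u \<in> extensional (topspace Y)" using f(4) by (simp_all add: maps_def)
  have p: "continuous_map Y X p" "continuous_map Y' X p'"
    using f(2,3) by (auto simp: semicoverings_def intro: semicovering_continuous)
  show "pi_tau_shriek_arr X f \<in> homset (OCovMor (pi_tau X)) (pi_tau_shriek_obj X (Dom (SCov X) f)) (pi_tau_shriek_obj X (Cod (SCov X) f))"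
    using f(5) ue top_functor_pi_tau[OF uc] induced_class_map_compose[OF uc p(2,1)] pi_tau_shriek_obj_in[OF f(2)] pi_tau_shriek_obj_in[OF f(3)]
    by (simp add: f(1) SCov_def OCovMor_def homset_def pi_tau_shriek_arr_def over_morphism_def pi_tau_shriek_obj_def
        induced_class_map_extensional)
  fix g assume "g \<in> Arr (SCov X :: ('b topology \<times> ('b \<Rightarrow> 'a), _) cat)" and fg: "Cod (SCov X) f = Dom (SCov X) g"
  then obtain C v where g: "g = ((Y', p'), C, v)" "v \<in> maps Y' (fst C)"
    by (auto simp: SCov_def f(1))
  have vc: "continuous_map Y' (fst C) v" using g(2) by (simp add: maps_def)
  let ?w = "compose (topspace Y) v u"
  have wc: "continuous_map Y (fst C) ?w"
    using continuous_map_compose[OF uc vc] by (auto simp: compose_def o_def elim: continuous_map_eq)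
  have "induced_class_map Y (fst C) ?w = compose (Arr (FG Y)) (induced_class_map Y' (fst C) v) (induced_class_map Y Y' u)"
    by (rule extensionalityI[OF induced_class_map_extensional])
      (simp_all add: compose_eq induced_class_map_compose[OF uc vc wc])
  then show "pi_tau_shriek_arr X (Comp (SCov X) f g) = Comp (OCovMor (pi_tau X)) (pi_tau_shriek_arr X f) (pi_tau_shriek_arr X g)"
    by (simp add: SCov_def OCovMor_def pi_tau_shriek_arr_def f(1) g(1) pi_tau_shriek_obj_def)
qed

section \<open>The equivalence\<close>

lemma isomorphism_OCovMor:
  assumes A: "A \<in> open_covering_morphisms G" and B: "B \<in> open_covering_morphisms G" and i: "isomorphic_over A B"
  shows "\<exists>k. k \<in> homset (OCovMor G) B A \<and> isomorphism (OCovMor G) k"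
proof -
  obtain Ko Ka Lo La where K: "over_morphism A B (Ko, Ka)" "over_morphism B A (Lo, La)"
    "\<forall>x\<in>Obj (fst A). Lo (Ko x) = x" "\<forall>h\<in>Arr (fst A). La (Ka h) = h"
    "\<forall>y\<in>Obj (fst B). Ko (Lo y) = y" "\<forall>k\<in>Arr (fst B). Ka (La k) = k"
    using i unfolding isomorphic_over_def by blast
  have "compose (Obj (fst A)) Lo Ko = restrict (\<lambda>x. x) (Obj (fst A))"
    "compose (Arr (fst A)) La Ka = restrict (\<lambda>x. x) (Arr (fst A))"
    "compose (Obj (fst B)) Ko Lo = restrict (\<lambda>x. x) (Obj (fst B))"
    "compose (Arr (fst B)) Ka La = restrict (\<lambda>x. x) (Arr (fst B))"
    using K(3-6) by (auto simp: compose_def)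
  then have "inverse_arrows (OCovMor G) (B, A, Lo, La) (A, B, Ko, Ka)"
    using A B K(1,2) by (simp add: inverse_arrows_def OCovMor_def homset_def)
  then have "isomorphism (OCovMor G) (B, A, Lo, La)" unfolding isomorphism_def by (rule exI)
  moreover have "(B, A, Lo, La) \<in> homset (OCovMor G) B A" using A B K(2) by (simp add: OCovMor_def homset_def)
  ultimately show ?thesis by blast
qed

text \<open>The category in the first conjunct has path classes as arrows, because the values of the
  functor do. The second conjunct extends essential surjectivity to open covering morphisms whose
  arrows have an arbitrary type \<open>'m\<close>.\<close>

theorem theorem7p14:
  fixes X :: "'a topology"
  assumes "locally_wep_connected X"
  shows "equivalence_of_categories
           (SCov X :: ('b topology \<times> ('b \<Rightarrow> 'a), _) cat)
           (OCovMor (pi_tau X))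
           (pi_tau_shriek_obj X) (pi_tau_shriek_arr X)
       \<and> (\<forall>A \<in> Obj (OCovMor (pi_tau X) ::
                 (('b, 'm, 'a, (real \<Rightarrow> 'a) set) groupoid_over, _) cat).
            \<exists>S \<in> Obj (SCov X :: ('b topology \<times> ('b \<Rightarrow> 'a), _) cat).
              isomorphic_over A (pi_tau_shriek_obj X S))"
proof
  show "equivalence_of_categories (SCov X :: ('b topology \<times> ('b \<Rightarrow> 'a), _) cat) (OCovMor (pi_tau X))
      (pi_tau_shriek_obj X) (pi_tau_shriek_arr X)"
  proof (rule fully_faithful_ess_surj_equivalence[OF is_functor_pi_tau_shriek])
    fix A B :: "'b topology \<times> ('b \<Rightarrow> 'a)" and f f'
    assume "f \<in> homset (SCov X) A B" "f' \<in> homset (SCov X) A B" "pi_tau_shriek_arr X f = pi_tau_shriek_arr X f'"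
    \<comment> \<open>Faithfulness is immediate, since the image of a map of semicoverings contains
      the map as its object part.\<close>
    then show "f = f'" by (auto simp: homset_def SCov_def pi_tau_shriek_arr_def)
  next
    fix A B :: "'b topology \<times> ('b \<Rightarrow> 'a)" and g
    assume A: "A \<in> Obj (SCov X)" and B: "B \<in> Obj (SCov X)"
      and g: "g \<in> homset (OCovMor (pi_tau X)) (pi_tau_shriek_obj X A) (pi_tau_shriek_obj X B)"
    obtain Y p Y' p' where YY: "A = (Y, p)" "B = (Y', p')" by (metis surj_pair)
    obtain Ko Ka where gK: "g = (pi_tau_shriek_obj X A, pi_tau_shriek_obj X B, Ko, Ka)"
      and K: "over_morphism (pi_tau_shriek_obj X (Y, p)) (pi_tau_shriek_obj X (Y', p')) (Ko, Ka)"
      using g by (auto simp: homset_def OCovMor_def YY)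
    have s: "semicovering_map Y X p" "semicovering_map Y' X p'"
      using A B by (simp_all add: SCov_def semicoverings_def YY)
    \<comment> \<open>Fullness: the object part of a functor over \<open>pi_tau X\<close> is
      continuous and induces the arrow part, so it is itself the required map of
      semicoverings.\<close>
    note o = over_morphism_induced[OF assms s K]
    have "Ko \<in> maps Y Y'" "\<forall>y\<in>topspace Y. p' (Ko y) = p y"
      using K o(1) by (simp_all add: over_morphism_def pi_tau_shriek_obj_def maps_def)
    then have "(A, B, Ko) \<in> homset (SCov X) A B"
      using A B by (simp add: homset_def SCov_def YY)
    moreover have "pi_tau_shriek_arr X (A, B, Ko) = g"
      by (simp add: pi_tau_shriek_arr_def gK YY flip: o(2))
    ultimately show "\<exists>f\<in>homset (SCov X) A B. pi_tau_shriek_arr X f = g" by blast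
  next
    fix A :: "('b, (real \<Rightarrow> 'b) set, 'a, (real \<Rightarrow> 'a) set) groupoid_over"
    assume "A \<in> Obj (OCovMor (pi_tau X))"
    then have A: "A \<in> open_covering_morphisms (pi_tau X)" by (simp add: OCovMor_def)
    obtain S :: "'b topology \<times> ('b \<Rightarrow> 'a)" where S: "S \<in> semicoverings X" "isomorphic_over A (pi_tau_shriek_obj X S)"
      using open_covering_realized[OF assms A] by blast
    have "pi_tau_shriek_obj X S \<in> open_covering_morphisms (pi_tau X)"
      using pi_tau_shriek_obj_in[of "fst S" "snd S" X] S(1) by simp
    from isomorphism_OCovMor[OF A this S(2)] S(1)
    show "\<exists>c\<in>Obj (SCov X). \<exists>k. k \<in> homset (OCovMor (pi_tau X)) (pi_tau_shriek_obj X c) A \<and> isomorphism (OCovMor (pi_tau X)) k"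
      by (intro bexI[of _ S]) (simp_all add: SCov_def)
  qed
  show "\<forall>A \<in> Obj (OCovMor (pi_tau X) :: (('b, 'm, 'a, (real \<Rightarrow> 'a) set) groupoid_over, _) cat).
      \<exists>S \<in> Obj (SCov X :: ('b topology \<times> ('b \<Rightarrow> 'a), _) cat). isomorphic_over A (pi_tau_shriek_obj X S)"
  proof
    fix A :: "('b, 'm, 'a, (real \<Rightarrow> 'a) set) groupoid_over"
    assume "A \<in> Obj (OCovMor (pi_tau X))"
    then have "A \<in> open_covering_morphisms (pi_tau X)" by (simp add: OCovMor_def)
    from open_covering_realized[OF assms this]
    show "\<exists>S \<in> Obj (SCov X :: ('b topology \<times> ('b \<Rightarrow> 'a), _) cat). isomorphic_over A (pi_tau_shriek_obj X S)"
      by (simp add: SCov_def)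
  qed
qed

end
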